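(* Let $d,m\ge 1$, let $D\subseteq\mathbb{R}^d$, and let $h(z)=\sigma^2 e^{-z^2/(2w^2)}$ for $z\in\mathbb{R}$, where $\sigma^2,w^2>0$. Let $u_0:D\to\mathbb{R}^m$ be a random function that is almost surely bounded on bounded sets. Let $\{\xi_n\}_{n\ge1}$ be an i.i.d. sequence, independent of $u_0$, of random continuous functions $\xi_n:\mathbb{R}^m\to\mathbb{R}^m$ whose components $\xi_n^1,\dots,\xi_n^m$ are i.i.d. centred Gaussian processes on $\mathbb{R}^m$ with covariance function $(z,z')\mapsto h(\|z-z'\|_2)$. Define $u_{n+1}(x)=\xi_{n+1}(u_n(x))$ for $x\in D$, $n\ge 0$. If $\sigma^2<w^2/m$, then $$\mathbb{P}\big(\|u_n(x)-u_n(x')\|_2\to 0 \text{ as } n\to\infty \text{ for all } x,x'\in D\big)=1,$$ where $\mathbb{P}$ denotes the law of the process $\{u_n\}$.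
   Context: $\|\cdot\|_2$ is the Euclidean norm on $\mathbb{R}^m$. A Gaussian process $\mathrm{GP}(0,c)$ is a random function all of whose finite-dimensional distributions are centred Gaussian with covariance $\mathbb{E}[\xi(z)\xi(z')]=c(z,z')$. *)

theory Defs
  imports "HOL-Probability.Probability"
begin

text \<open>
  A random function with index set \<open>T\<close> is a measurable map into the product space
  \<open>PiM T (\<lambda>_. borel)\<close>. For \<open>T = UNIV\<close> the elements of that space are all functions, for other
  \<open>T\<close> they are the extensional ones, so that maps have to be restricted to \<open>T\<close>.
\<close>

definition iid_vars ::
    "'w measure \<Rightarrow> 'b measure \<Rightarrow> ('i \<Rightarrow> 'w \<Rightarrow> 'b) \<Rightarrow> 'i set \<Rightarrow> bool" where
  "iid_vars M N X I \<longleftrightarrow>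
     prob_space.indep_vars M (\<lambda>_. N) X I \<and>
     (\<forall>i\<in>I. \<forall>j\<in>I. distr M N (X i) = distr M N (X j))"

text \<open>
  Unlike \<open>prob_space.indep_var\<close>, this allows the two variables to take values in different types.
\<close>

definition indep_rvs ::
    "'w measure \<Rightarrow> 'a measure \<Rightarrow> ('w \<Rightarrow> 'a) \<Rightarrow> 'b measure \<Rightarrow> ('w \<Rightarrow> 'b) \<Rightarrow> bool" where
  "indep_rvs M N X N' Y \<longleftrightarrow>
     X \<in> measurable M N \<and> Y \<in> measurable M N' \<and>
     prob_space.indep_set M
       (sets (vimage_algebra (space M) X N)) (sets (vimage_algebra (space M) Y N'))"

text \<open>
  Centred Gaussian laws may be degenerate: on the line the point mass at 0 is included, and a law
  on a finite product of lines is Gaussian if all its one-dimensional linear images are.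
\<close>

definition centred_gaussian :: "real measure \<Rightarrow> bool" where
  "centred_gaussian \<mu> \<longleftrightarrow>
     \<mu> = return borel 0 \<or> (\<exists>s>0. \<mu> = density lborel (normal_density 0 s))"

definition centred_gaussian_PiM :: "'i set \<Rightarrow> ('i \<Rightarrow> real) measure \<Rightarrow> bool" where
  "centred_gaussian_PiM F \<mu> \<longleftrightarrow>
     (\<forall>a :: 'i \<Rightarrow> real. centred_gaussian (distr \<mu> borel (\<lambda>f. \<Sum>z\<in>F. a z * f z)))"

definition centred_gaussian_process ::
    "'w measure \<Rightarrow> ('i \<Rightarrow> 'i \<Rightarrow> real) \<Rightarrow> ('w \<Rightarrow> 'i \<Rightarrow> real) \<Rightarrow> bool" where
  "centred_gaussian_process M c X \<longleftrightarrow>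
     X \<in> measurable M (PiM UNIV (\<lambda>_. borel)) \<and>
     (\<forall>F. finite F \<longrightarrow>
        centred_gaussian_PiM F (distr M (PiM F (\<lambda>_. borel)) (\<lambda>\<omega>. restrict (X \<omega>) F))) \<and>
     (\<forall>z z'. (LINT \<omega>|M. X \<omega> z * X \<omega> z') = c z z')"

definition sq_exp :: "real \<Rightarrow> real \<Rightarrow> real \<Rightarrow> real" where
  "sq_exp \<sigma> w z = \<sigma>\<^sup>2 * exp (- (z\<^sup>2) / (2 * w\<^sup>2))"

primrec deep_gp :: "('w \<Rightarrow> 'a \<Rightarrow> 'b) \<Rightarrow> (nat \<Rightarrow> 'w \<Rightarrow> 'b \<Rightarrow> 'b) \<Rightarrow> nat \<Rightarrow> 'w \<Rightarrow> 'a \<Rightarrow> 'b" where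
  "deep_gp u0 \<xi> 0 \<omega> x = u0 \<omega> x"
| "deep_gp u0 \<xi> (Suc n) \<omega> x = \<xi> (Suc n) \<omega> (deep_gp u0 \<xi> n \<omega> x)"

end

theory Submission imports Defs begin

text \<open>
  Write \<open>\<Xi>\<^sub>n = \<xi>\<^sub>n \<circ> \<dots> \<circ> \<xi>\<^sub>1\<close>. Since \<open>u\<^sub>n = \<Xi>\<^sub>n \<circ> u\<^sub>0\<close>, it is enough that almost surely the diameter of \<open>\<Xi>\<^sub>n(Q)\<close> tends
  to 0 for every cube \<open>Q\<close>. Contraction of pairs in mean square, \<open>E \<parallel>\<xi>(y) - \<xi>(z)\<parallel>\<^sup>2 \<le> \<kappa> \<parallel>y - z\<parallel>\<^sup>2\<close> with
  \<open>\<kappa> = m \<sigma>\<^sup>2 / w\<^sup>2 < 1\<close>, alone does not suffice for chaining when \<open>m \<ge> 2\<close>, as a cube contains too many pairs. On a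
  small cube of radius \<open>r\<close>, however, \<open>\<Xi>\<^sub>N\<close> is affine up to an error \<open>o(r)\<close>, and an affine map is controlled by its
  increments along the \<open>m\<close> axes. So for a suitable \<open>N\<close> the mean radius is halved in \<open>N\<close> steps as long as it is
  small, and a small cube is contracted to a point with probability close to 1.

  Large cubes reach this regime. Gaussian suprema grow sublinearly with the radius, so the image of any cube
  eventually has radius at most a fixed \<open>B\<close> with probability \<open>1/2\<close>, and a map sends a cube of radius \<open>B\<close> into an
  arbitrarily small one with a positive probability that does not depend on the position. Hence the supremum \<open>S\<close> over all
  starting cubes of the probability of not being contracted satisfies \<open>S \<le> S - g S / 4\<close> for some \<open>g > 0\<close>, that
  is, \<open>S = 0\<close>.
\<close>

section \<open>Oscillation over cubes\<close>

text \<open>Chaining over cells of side 2^-k has to control 2^(mk) pairs, hence needs moments of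
  order above m. For m \<ge> 2 these carry Gaussian factors and need not contract under \<kappa> <
  1, so chaining the iterates is ruled out. It is used for single maps only, with the moment of
  order 2m and a constant that may be large; the gain over many steps enters through the second
  moment along the axes. The affine error of one map is O(r^2) in mean at each fixed point of a
  cube: the kernel is quadratic near 0 up to fourth order, and affine interpolation cancels the
  quadratic part. No derivative of a map is formed. The linear coefficient of the error over the
  whole cube can be made as small as desired, at the price of a larger quadratic one, and so it
  survives composition of any fixed number of maps. Conditioning is always done by freezing the
  centre and a majorant of the radius, which depend on the past, and integrating over the later
  maps.\<close>

abbreviation unit_cube :: "(real ^ 'm) set" where
  "unit_cube \<equiv> {u. \<forall>i. \<bar>u $ i\<bar> \<le> 1}"

definition corners :: "(real ^ 'm) set" where
  "corners = {h. \<forall>i. h $ i = 1/2 \<or> h $ i = - 1/2}"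

text \<open>Centres of the subcubes of half side \<open>2^-k\<close>. The recursion splits the
  coarsest cube first, so it matches the recursion of \<open>chain_max\<close>, which restarts in a
  subcube.\<close>

primrec centres :: "nat \<Rightarrow> (real ^ 'm) set" where
  "centres 0 = {0}"
| "centres (Suc k) = (\<lambda>(h, v). h + (1/2) *\<^sub>R v) ` (corners \<times> centres k)"

definition dyadics :: "(real ^ 'm) set" where
  "dyadics = (\<Union>k. centres k)"

lemma corners_image:
  "(corners :: (real ^ 'm) set) = (\<lambda>g. \<chi> i. g i) ` (UNIV \<rightarrow>\<^sub>E {1/2, - 1/2})"
proof (intro equalityI subsetI)
  fix h :: "real ^ 'm" assume h: "h \<in> corners"
  have "h = (\<chi> i. (($) h) i)" by (simp add: vec_eq_iff)
  moreover have "($) h \<in> UNIV \<rightarrow>\<^sub>E {1/2, - 1/2}" using h by (auto simp: corners_def)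
  ultimately show "h \<in> (\<lambda>g. \<chi> i. g i) ` (UNIV \<rightarrow>\<^sub>E {1/2, - 1/2})" by blast
qed (auto simp: corners_def PiE_def Pi_def)

lemma finite_corners [simp]: "finite (corners :: (real ^ 'm) set)"
  unfolding corners_image by (intro finite_imageI finite_PiE) auto

lemma card_corners: "card (corners :: (real ^ 'm) set) \<le> 2 ^ CARD('m)"
proof -
  have "card (corners :: (real ^ 'm) set) \<le> card ((UNIV :: 'm set) \<rightarrow>\<^sub>E {1/2 :: real, - 1/2})"
    unfolding corners_image by (intro card_image_le finite_PiE) auto
  also have "\<dots> = 2 ^ CARD('m)" by (simp add: card_PiE numeral_2_eq_2)
  finally show ?thesis .
qed

lemma corners_nonempty [simp]: "corners \<noteq> {}"
  by (auto simp: corners_def intro!: exI[of _ "\<chi> i. 1/2"])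

lemma corners_subset_cube: "corners \<subseteq> (unit_cube :: (real ^ 'm) set)"
proof (intro subsetI CollectI allI)
  fix h :: "real ^ 'm" and i assume "h \<in> corners"
  then have "h $ i = 1/2 \<or> h $ i = - 1/2" unfolding corners_def by blast
  then show "\<bar>h $ i\<bar> \<le> 1" by linarith
qed

lemma finite_centres [simp]: "finite (centres k)"
  by (induction k) auto

lemma centres_nonempty [simp]: "centres k \<noteq> {}"
  by (induction k) auto

lemma card_centres: "card (centres k :: (real ^ 'm) set) \<le> 2 ^ (CARD('m) * k)"
proof (induction k)
  case (Suc k)
  have "card (centres (Suc k) :: (real ^ 'm) set) \<le> card ((corners :: (real ^ 'm) set) \<times> (centres k :: (real ^ 'm) set))"
    by (simp only: centres.simps) (intro card_image_le finite_cartesian_product finite_corners finite_centres)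
  also have "\<dots> \<le> 2 ^ CARD('m) * 2 ^ (CARD('m) * k)"
    unfolding card_cartesian_product by (intro mult_mono card_corners Suc) auto
  finally show ?case by (simp add: power_add)
qed simp

lemma centres_subset_cube: "centres k \<subseteq> (unit_cube :: (real ^ 'm) set)"
proof (induction k)
  case (Suc k)
  have "\<bar>h $ i + v $ i / 2\<bar> \<le> 1" if "h \<in> corners" "v \<in> centres k" for h v :: "real ^ 'm" and i
  proof -
    have "\<bar>v $ i\<bar> \<le> 1" using Suc that(2) by blast
    moreover have "h $ i = 1/2 \<or> h $ i = - 1/2" using that(1) unfolding corners_def by blast
    ultimately show ?thesis by linarith
  qed
  then show ?case by auto
qed auto

lemma dyadics_subset_cube: "dyadics \<subseteq> unit_cube"
  using centres_subset_cube by (auto simp: dyadics_def)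

lemma countable_dyadics [simp]: "countable dyadics"
  unfolding dyadics_def by (intro countable_UN countable_finite[OF finite_centres]) auto

lemma dyadics_nonempty [simp]: "dyadics \<noteq> {}"
  by (auto simp: dyadics_def)

text \<open>\<open>h\<close> is the centre of a half-size subcube containing \<open>u\<close>;
  doubling \<open>u - h\<close> gives a point of the unit cube, to which the induction hypothesis
  applies.\<close>

lemma cube_cover:
  fixes u :: "real ^ 'm"
  assumes "u \<in> unit_cube"
  shows "\<exists>v\<in>centres k. \<exists>u'\<in>unit_cube. u = v + (1/2^k) *\<^sub>R u'"
  using assms
proof (induction k arbitrary: u)
  case (Suc k)
  define h :: "real ^ 'm" where "h = (\<chi> i. if u $ i \<ge> 0 then 1/2 else - 1/2)"
  have h: "h \<in> corners" by (auto simp: corners_def h_def)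
  have "\<bar>(2 *\<^sub>R (u - h)) $ i\<bar> \<le> 1" for i
    using Suc.prems[simplified, rule_format, of i] by (auto simp: h_def)
  then have "2 *\<^sub>R (u - h) \<in> unit_cube" by blast
  from Suc.IH[OF this] obtain v u' where v: "v \<in> centres k" "u' \<in> unit_cube"
    "2 *\<^sub>R (u - h) = v + (1/2^k) *\<^sub>R u'" by blast
  have "u = h + (1/2) *\<^sub>R (2 *\<^sub>R (u - h))" by (simp add: vec_eq_iff)
  also have "\<dots> = (h + (1/2) *\<^sub>R v) + (1/2^Suc k) *\<^sub>R u'" unfolding v(3) by (simp add: scaleR_add_right)
  finally have "u = (h + (1/2) *\<^sub>R v) + (1/2^Suc k) *\<^sub>R u'" .
  moreover have "h + (1/2) *\<^sub>R v \<in> centres (Suc k)" using h v(1) by (auto intro!: image_eqI[of _ _ "(h, v)"])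
  ultimately show ?case using v(2) by blast
qed auto

lemma norm_unit_cube: "norm u \<le> real CARD('m)" if "u \<in> unit_cube" for u :: "real ^ 'm"
proof -
  have "norm u \<le> (\<Sum>i\<in>UNIV. \<bar>u $ i\<bar>)" by (rule norm_le_l1_cart)
  also have "\<dots> \<le> (\<Sum>i\<in>(UNIV :: 'm set). 1)" using that by (intro sum_mono) auto
  finally show ?thesis by simp
qed

lemma cube_closure: "unit_cube \<subseteq> closure dyadics"
proof
  fix u :: "real ^ 'm" assume u: "u \<in> unit_cube"
  show "u \<in> closure dyadics"
  proof (rule closure_approachable[THEN iffD2], intro allI impI)
    fix e :: real assume "e > 0"
    then obtain k where k: "real CARD('m) / e < 2 ^ k" using real_arch_pow[of 2] by auto
    from cube_cover[OF u, of k] obtain v u' where v: "v \<in> centres k" "u' \<in> unit_cube"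
      "u = v + (1/2^k) *\<^sub>R u'" by blast
    have "dist v u = norm u' / 2^k" by (simp add: v(3) dist_norm)
    also have "\<dots> \<le> real CARD('m) / 2^k" using norm_unit_cube[OF v(2)] by (simp add: divide_right_mono)
    also have "\<dots> < e" using k \<open>e > 0\<close> by (simp add: field_simps)
    finally show "\<exists>y\<in>dyadics. dist y u < e" using v(1) by (auto simp: dyadics_def)
  qed
qed

text \<open>Images are measured in the Euclidean norm but enclosed in cubes, since cubes subdivide.
  The ball of radius \<open>r\<close> lies in the cube of half side \<open>r\<close>, so no constant
  is lost at a restart.\<close>

lemma scaled_cubeE:
  fixes d :: "real ^ 'm"
  assumes "norm d \<le> r"
  obtains u where "u \<in> unit_cube" "d = r *\<^sub>R u"
proof (cases "r = 0")
  case True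
  then show ?thesis using assms that[of 0] by auto
next
  case False
  with assms have "r > 0" using norm_ge_zero[of d] by linarith
  moreover have "\<bar>d $ i\<bar> \<le> r" for i using component_le_norm_cart[of d i] assms by linarith
  ultimately show ?thesis by (intro that[of "(1/r) *\<^sub>R d"]) (auto simp: field_simps abs_mult)
qed

lemma axis_unit_cube: "axis j (1::real) \<in> unit_cube"
  by (auto simp: axis_def)

text \<open>The supremum runs over a countable set only, which makes it measurable; an infinite one yields the junk value 0,
  but for continuous functions it is finite and agrees with the supremum over the whole cube.\<close>

definition cube_sup :: "(real ^ 'm \<Rightarrow> real ^ 'm) \<Rightarrow> real" where
  "cube_sup f = enn2real (SUP q\<in>dyadics. ennreal (norm (f q)))"

lemma cube_sup_nonneg [simp]: "cube_sup f \<ge> 0"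
  by (simp add: cube_sup_def)

lemma cube_sup_le: "cube_sup f \<le> c" if "\<And>q. q \<in> dyadics \<Longrightarrow> norm (f q) \<le> c" "0 \<le> c"
proof -
  have "(SUP q\<in>dyadics. ennreal (norm (f q))) \<le> ennreal c"
    by (intro SUP_least ennreal_leI that)
  then show ?thesis unfolding cube_sup_def using that(2) by (intro enn2real_leI)
qed

lemma unit_cube_eq_cbox: "unit_cube = cbox (- 1) (1 :: real ^ 'm)"
  by (auto simp: mem_box_cart abs_le_iff minus_le_iff)

text \<open>Compactness excludes the infinite supremum, so its real value bounds \<open>f\<close> at
  the dyadic points; the bound passes to the whole cube because it defines a closed set.\<close>

lemma le_cube_sup:
  fixes f :: "real ^ 'm \<Rightarrow> real ^ 'm"
  assumes "continuous_on UNIV f" "u \<in> unit_cube"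
  shows "norm (f u) \<le> cube_sup f"
proof -
  have "compact (f ` cbox (-1) 1)"
    by (intro compact_continuous_image continuous_on_subset[OF assms(1)]) auto
  then obtain B where B: "\<And>q. q \<in> unit_cube \<Longrightarrow> norm (f q) \<le> B"
    unfolding unit_cube_eq_cbox by (meson bounded_iff compact_imp_bounded image_eqI)
  have "(SUP q\<in>dyadics. ennreal (norm (f q))) \<le> ennreal B"
    using B dyadics_subset_cube by (intro SUP_least ennreal_leI) auto
  then have fin: "(SUP q\<in>dyadics. ennreal (norm (f q))) < top"
    by (meson ennreal_less_top le_less_trans)
  have dy: "norm (f q) \<le> cube_sup f" if "q \<in> dyadics" for q
  proof -
    have "ennreal (norm (f q)) \<le> (SUP q\<in>dyadics. ennreal (norm (f q)))" using that by (rule SUP_upper)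
    also have "\<dots> = ennreal (cube_sup f)" using fin by (simp add: cube_sup_def)
    finally show ?thesis by simp
  qed
  have "closed {q. norm (f q) \<le> cube_sup f}"
    by (intro closed_Collect_le continuous_on_norm assms(1) continuous_intros)
  then have "closure dyadics \<subseteq> {q. norm (f q) \<le> cube_sup f}"
    using dy by (intro closure_minimal) auto
  then show ?thesis using cube_closure assms(2) by blast
qed

section \<open>Oscillation and deviation from affine maps\<close>

definition osc :: "(real ^ 'm \<Rightarrow> real ^ 'm) \<Rightarrow> real ^ 'm \<Rightarrow> real \<Rightarrow> real" where
  "osc f x r = cube_sup (\<lambda>u. f (x + r *\<^sub>R u) - f x)"

text \<open>The error against the affine map that agrees with \<open>f\<close> at \<open>x\<close>
  and at the \<open>m\<close> points at distance \<open>r\<close> from it along the axes.\<close>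

definition affine_defect ::
    "(real ^ 'm \<Rightarrow> real ^ 'm) \<Rightarrow> real ^ 'm \<Rightarrow> real \<Rightarrow> real ^ 'm \<Rightarrow> real ^ 'm" where
  "affine_defect f x r u = f (x + r *\<^sub>R u) - f x - (\<Sum>j\<in>UNIV. u $ j *\<^sub>R (f (x + r *\<^sub>R axis j 1) - f x))"

definition nonaff :: "(real ^ 'm \<Rightarrow> real ^ 'm) \<Rightarrow> real ^ 'm \<Rightarrow> real \<Rightarrow> real" where
  "nonaff f x r = cube_sup (affine_defect f x r)"

lemma osc_nonneg [simp]: "osc f x r \<ge> 0"
  and nonaff_nonneg [simp]: "nonaff f x r \<ge> 0"
  by (simp_all add: osc_def nonaff_def)

lemma le_osc:
  assumes "continuous_on UNIV f" "u \<in> unit_cube"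
  shows "norm (f (x + r *\<^sub>R u) - f x) \<le> osc f x r"
  unfolding osc_def
  by (rule le_cube_sup[OF _ assms(2)]) (intro continuous_intros continuous_on_compose2[OF assms(1)]; simp)

lemma le_osc_norm:
  assumes "continuous_on UNIV f" "norm (y - x) \<le> r"
  shows "norm (f y - f x) \<le> osc f x r"
proof -
  obtain u where "u \<in> unit_cube" "y - x = r *\<^sub>R u" using scaled_cubeE[OF assms(2)] by blast
  then show ?thesis using le_osc[OF assms(1), of u x r] by (simp add: algebra_simps)
qed

lemma osc_le:
  assumes "\<And>u. u \<in> unit_cube \<Longrightarrow> norm (f (x + r *\<^sub>R u) - f x) \<le> c" "0 \<le> c"
  shows "osc f x r \<le> c"
  unfolding osc_def using assms dyadics_subset_cube by (intro cube_sup_le) auto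

lemma le_nonaff:
  assumes "continuous_on UNIV f" "u \<in> unit_cube"
  shows "norm (affine_defect f x r u) \<le> nonaff f x r"
  unfolding nonaff_def affine_defect_def
  by (rule le_cube_sup[OF _ assms(2)]) (intro continuous_intros continuous_on_compose2[OF assms(1)]; simp)

lemma nonaff_le:
  assumes "\<And>u. u \<in> unit_cube \<Longrightarrow> norm (affine_defect f x r u) \<le> c" "0 \<le> c"
  shows "nonaff f x r \<le> c"
  unfolding nonaff_def using assms dyadics_subset_cube by (intro cube_sup_le) auto

lemma osc_0 [simp]: "osc f x 0 = 0"
  by (intro antisym osc_le) auto

section \<open>Measurable evaluation and composition\<close>

abbreviation fun_sigma :: "(real ^ 'm \<Rightarrow> real ^ 'm) measure" where
  "fun_sigma \<equiv> PiM UNIV (\<lambda>_. borel)"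

definition grid_floor :: "nat \<Rightarrow> real ^ 'm \<Rightarrow> int ^ 'm" where
  "grid_floor k z = (\<chi> i. \<lfloor>2 ^ k * z $ i\<rfloor>)"

definition grid_point :: "nat \<Rightarrow> int ^ 'm \<Rightarrow> real ^ 'm" where
  "grid_point k a = (\<chi> i. real_of_int (a $ i) / 2 ^ k)"

text \<open>Evaluation at a random point is not measurable on the product space of all functions; evaluation of
  \<open>reg f\<close> is, and \<open>reg f = f\<close> for continuous \<open>f\<close>.\<close>

definition reg :: "(real ^ 'm \<Rightarrow> real ^ 'm) \<Rightarrow> real ^ 'm \<Rightarrow> real ^ 'm" where
  "reg f z = lim (\<lambda>k. f (grid_point k (grid_floor k z)))"

lemma grid_tendsto: "(\<lambda>k. grid_point k (grid_floor k z)) \<longlonglongrightarrow> z"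
proof (rule vec_tendstoI)
  fix i
  have "(\<lambda>k. real_of_int \<lfloor>2 ^ k * z $ i\<rfloor> / 2 ^ k) \<longlonglongrightarrow> z $ i"
  proof (rule Lim_null[THEN iffD2], rule Lim_null_comparison)
    show "(\<lambda>k. (1/2) ^ k :: real) \<longlonglongrightarrow> 0" by (rule LIMSEQ_power_zero) auto
    show "\<forall>\<^sub>F k in sequentially. norm (real_of_int \<lfloor>2 ^ k * z $ i\<rfloor> / 2 ^ k - z $ i) \<le> (1/2) ^ k"
    proof (intro always_eventually allI)
      fix k :: nat
      have "\<bar>real_of_int \<lfloor>2 ^ k * z $ i\<rfloor> - 2 ^ k * z $ i\<bar> \<le> 1" by linarith
      moreover have "real_of_int \<lfloor>2 ^ k * z $ i\<rfloor> / 2 ^ k - z $ i = (real_of_int \<lfloor>2 ^ k * z $ i\<rfloor> - 2 ^ k * z $ i) / 2 ^ k"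
        by (simp add: field_simps)
      ultimately show "norm (real_of_int \<lfloor>2 ^ k * z $ i\<rfloor> / 2 ^ k - z $ i) \<le> (1/2) ^ k"
        by (simp add: power_divide divide_right_mono)
    qed
  qed
  then show "((\<lambda>k. grid_point k (grid_floor k z) $ i) \<longlongrightarrow> z $ i) sequentially"
    by (simp add: grid_point_def grid_floor_def)
qed

lemma reg_continuous: "reg f = f" if "continuous_on UNIV f"
proof
  fix z
  have "isCont f z" using that by (simp add: continuous_on_eq_continuous_at)
  then have "(\<lambda>k. f (grid_point k (grid_floor k z))) \<longlonglongrightarrow> f z"
    using grid_tendsto by (rule isCont_tendsto_compose)
  then show "reg f z = f z" unfolding reg_def by (rule limI)
qed

lemma measurable_vec_nth [measurable]: "(\<lambda>z :: real ^ 'm. z $ i) \<in> borel_measurable borel"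
  by (intro borel_measurable_continuous_onI continuous_intros)

lemma measurable_grid_floor [measurable]: "grid_floor k \<in> measurable borel (count_space UNIV)"
proof (subst measurable_count_space_eq2_countable, intro conjI ballI)
  fix a :: "int ^ 'm"
  have "grid_floor k -` {a} \<inter> space borel = {z \<in> space borel. \<forall>i. \<lfloor>2 ^ k * z $ i\<rfloor> = a $ i}"
    by (auto simp: grid_floor_def vec_eq_iff)
  also have "\<dots> \<in> sets borel" by measurable
  finally show "grid_floor k -` {a} \<inter> space borel \<in> sets borel" .
qed auto

text \<open>\<open>grid_floor k\<close> takes countably many values, so the value at the grid point
  is pieced together from countably many evaluations at fixed points; \<open>reg\<close> is the
  limit in \<open>k\<close>.\<close>

lemma measurable_reg [measurable (raw)]:
  fixes z :: "'a \<Rightarrow> real ^ 'm"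
  assumes f: "f \<in> measurable N fun_sigma" and z [measurable]: "z \<in> borel_measurable N"
  shows "(\<lambda>\<omega>. reg (f \<omega>) (z \<omega>)) \<in> borel_measurable N"
proof -
  have *: "(\<lambda>\<omega>. f \<omega> y) \<in> borel_measurable N" for y
    using measurable_compose[OF f measurable_component_singleton[of y UNIV "\<lambda>_. borel"]] by simp
  have "(\<lambda>\<omega>. f \<omega> (grid_point k (grid_floor k (z \<omega>)))) \<in> borel_measurable N" for k
    by (rule measurable_compose_countable'[where f="\<lambda>a \<omega>. f \<omega> (grid_point k a)" and I=UNIV])
      (use * in \<open>auto\<close>)
  then show ?thesis unfolding reg_def by measurable
qed

text \<open>Applies the maps with indices \<open>s\<close> to \<open>s + n - 1\<close>. Going
  through \<open>reg\<close> makes it measurable jointly in the maps and the starting point; the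
  initial index is kept because the flow is restarted at later times.\<close>

primrec flow :: "(nat \<Rightarrow> real ^ 'm \<Rightarrow> real ^ 'm) \<Rightarrow> nat \<Rightarrow> nat \<Rightarrow> real ^ 'm \<Rightarrow> real ^ 'm" where
  "flow F s 0 z = z"
| "flow F s (Suc n) z = reg (F (s + n)) (flow F s n z)"

lemma flow_add: "flow F s (n + j) z = flow F (s + n) j (flow F s n z)"
  by (induction j) (simp_all add: add.assoc)

lemma flow_cong: "(\<And>i. s \<le> i \<Longrightarrow> i < s + n \<Longrightarrow> F i = G i) \<Longrightarrow> flow F s n z = flow G s n z"
  by (induction n) auto

lemma continuous_flow: "(\<And>i. continuous_on UNIV (F i)) \<Longrightarrow> continuous_on UNIV (flow F s n)"
proof (induction n)
  case 0
  have "flow F s 0 = (\<lambda>z. z)" by auto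
  then show ?case by simp
next
  case (Suc n)
  have "flow F s (Suc n) = (\<lambda>z. F (s + n) (flow F s n z))"
    by (auto simp: reg_continuous[OF Suc.prems])
  then show ?case using Suc by (auto intro: continuous_on_compose2[of UNIV])
qed

lemma measurable_flow [measurable (raw)]:
  assumes F: "F \<in> measurable N (PiM UNIV (\<lambda>_. fun_sigma))" and [measurable]: "z \<in> borel_measurable N"
  shows "(\<lambda>\<omega>. flow (F \<omega>) s n (z \<omega>)) \<in> borel_measurable N"
proof (induction n)
  case (Suc n)
  have [measurable]: "(\<lambda>\<omega>. F \<omega> i) \<in> measurable N fun_sigma" for i
    using measurable_compose[OF F measurable_component_singleton[of i UNIV "\<lambda>_. fun_sigma"]] by simp
  show ?case using Suc by (simp, measurable)
qed auto

lemma measurable_cube_sup [measurable (raw)]: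
  "(\<And>q. q \<in> dyadics \<Longrightarrow> (\<lambda>\<omega>. f \<omega> q) \<in> borel_measurable N) \<Longrightarrow> (\<lambda>\<omega>. cube_sup (f \<omega>)) \<in> borel_measurable N"
  unfolding cube_sup_def by measurable

lemma measurable_osc:
  assumes [measurable]: "\<And>z. z \<in> borel_measurable N \<Longrightarrow> (\<lambda>\<omega>. f \<omega> (z \<omega>)) \<in> borel_measurable N"
    "x \<in> borel_measurable N" "r \<in> borel_measurable N"
  shows "(\<lambda>\<omega>. osc (f \<omega>) (x \<omega>) (r \<omega>)) \<in> borel_measurable N"
  unfolding osc_def by (intro measurable_cube_sup borel_measurable_diff assms(1)) measurable

lemma measurable_nonaff:
  assumes [measurable]: "\<And>z. z \<in> borel_measurable N \<Longrightarrow> (\<lambda>\<omega>. f \<omega> (z \<omega>)) \<in> borel_measurable N"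
    "x \<in> borel_measurable N" "r \<in> borel_measurable N"
  shows "(\<lambda>\<omega>. nonaff (f \<omega>) (x \<omega>) (r \<omega>)) \<in> borel_measurable N"
  unfolding nonaff_def affine_defect_def
  by (intro measurable_cube_sup borel_measurable_diff borel_measurable_sum borel_measurable_scaleR assms(1)) measurable

section \<open>Conditioning on the past and chaining\<close>

text \<open>A Markov property without conditional expectations: past and future have a product law,
  and Tonelli integrates the future while the value of \<open>G\<close> on the past is held fixed.
  In \<open>ennreal\<close> no integrability has to be carried along.\<close>

lemma (in prob_space) nn_integral_freeze_le:
  fixes X :: "nat \<Rightarrow> 'a \<Rightarrow> 'b" and G :: "(nat \<Rightarrow> 'b) \<Rightarrow> 'c"
  assumes indep: "indep_vars (\<lambda>_. S) X UNIV"
    and G [measurable]: "G \<in> measurable (PiM UNIV (\<lambda>_. S)) N"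
    and G_past: "\<And>F F'. (\<And>i. i < t \<Longrightarrow> F i = F' i) \<Longrightarrow> G F = G F'"
    and h [measurable]: "(\<lambda>(F, y). h F y) \<in> borel_measurable (PiM UNIV (\<lambda>_. S) \<Otimes>\<^sub>M N)"
    and h_future: "\<And>F F' y. (\<And>i. i \<ge> t \<Longrightarrow> F i = F' i) \<Longrightarrow> h F y = h F' y"
    and k [measurable]: "k \<in> borel_measurable N"
    and le: "\<And>y. y \<in> space N \<Longrightarrow> (\<integral>\<^sup>+\<omega>. h (\<lambda>i. X i \<omega>) y \<partial>M) \<le> k y"
  shows "(\<integral>\<^sup>+\<omega>. h (\<lambda>i. X i \<omega>) (G (\<lambda>i. X i \<omega>)) \<partial>M) \<le> (\<integral>\<^sup>+\<omega>. k (G (\<lambda>i. X i \<omega>)) \<partial>M)"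
proof -
  have rv [measurable]: "X i \<in> measurable M S" for i
    using indep by (auto simp: indep_vars_def)
  obtain \<omega>0 where "\<omega>0 \<in> space M" using not_empty by auto
  define c where "c = X 0 \<omega>0"
  have c: "c \<in> space S" using rv[of 0] \<open>\<omega>0 \<in> space M\<close> by (auto simp: c_def measurable_def)
  define P where "P A = PiM A (\<lambda>_ :: nat. S)" for A
  \<comment> \<open>\<open>G\<close> and \<open>h\<close> take whole sequences; \<open>emb\<close>
    fills the missing half with a constant, which \<open>G_past\<close> and \<open>h_future\<close>
    make invisible.\<close>
  define emb where "emb A f = (\<lambda>i. if i \<in> A then f i else c)" for A :: "nat set" and f :: "nat \<Rightarrow> 'b"
  have emb [measurable]: "emb A \<in> measurable (P A) (PiM UNIV (\<lambda>_. S))" for A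
    unfolding emb_def P_def
  proof (rule measurable_PiM_single')
    show "(\<lambda>f. if i \<in> A then f i else c) \<in> measurable (PiM A (\<lambda>_. S)) S" for i
      using c by (cases "i \<in> A") auto
    show "(\<lambda>\<omega> i. if i \<in> A then \<omega> i else c) \<in> space (PiM A (\<lambda>_. S)) \<rightarrow> UNIV \<rightarrow>\<^sub>E space S"
      using c by (auto simp: space_PiM PiE_def Pi_def)
  qed
  define X1 where "X1 \<omega> = restrict (\<lambda>i. X i \<omega>) {..<t}" for \<omega>
  define X2 where "X2 \<omega> = restrict (\<lambda>i. X i \<omega>) {t..}" for \<omega>
  have ind: "indep_var (P {..<t}) X1 (P {t..}) X2"
    unfolding P_def X1_def X2_def using indep by (rule indep_var_restrict) auto
  have X1 [measurable]: "X1 \<in> measurable M (P {..<t})" and X2 [measurable]: "X2 \<in> measurable M (P {t..})"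
    using ind by (auto dest: indep_var_rv1 indep_var_rv2)
  have G1: "G (\<lambda>i. X i \<omega>) = G (emb {..<t} (X1 \<omega>))" for \<omega>
    by (rule G_past) (simp add: emb_def X1_def)
  have h2: "h (\<lambda>i. X i \<omega>) y = h (emb {t..} (X2 \<omega>)) y" for \<omega> y
    by (rule h_future) (simp add: emb_def X2_def)
  interpret D2: prob_space "distr M (P {t..}) X2" by (rule prob_space_distr) measurable
  define H where "H = (\<lambda>(f1, f2). h (emb {t..} f2) (G (emb {..<t} f1)))"
  have H [measurable]: "H \<in> borel_measurable (P {..<t} \<Otimes>\<^sub>M P {t..})"
  proof -
    have "(\<lambda>p. (emb {t..} (snd p), G (emb {..<t} (fst p)))) \<in> measurable (P {..<t} \<Otimes>\<^sub>M P {t..}) (PiM UNIV (\<lambda>_. S) \<Otimes>\<^sub>M N)"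
      by measurable
    from measurable_compose[OF this h] show ?thesis by (simp add: H_def case_prod_beta')
  qed
  have "(\<integral>\<^sup>+\<omega>. h (\<lambda>i. X i \<omega>) (G (\<lambda>i. X i \<omega>)) \<partial>M) = (\<integral>\<^sup>+\<omega>. H (X1 \<omega>, X2 \<omega>) \<partial>M)"
    by (subst G1, subst h2) (simp add: H_def)
  also have "\<dots> = (\<integral>\<^sup>+p. H p \<partial>distr M (P {..<t} \<Otimes>\<^sub>M P {t..}) (\<lambda>\<omega>. (X1 \<omega>, X2 \<omega>)))"
    by (rule nn_integral_distr[symmetric]) measurable
  also have "\<dots> = (\<integral>\<^sup>+p. H p \<partial>(distr M (P {..<t}) X1 \<Otimes>\<^sub>M distr M (P {t..}) X2))"
    using ind by (simp add: indep_var_distribution_eq)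
  also have "\<dots> = (\<integral>\<^sup>+f1. \<integral>\<^sup>+f2. H (f1, f2) \<partial>distr M (P {t..}) X2 \<partial>distr M (P {..<t}) X1)"
    by (rule D2.nn_integral_fst[symmetric]) measurable
  also have "\<dots> = (\<integral>\<^sup>+\<omega>1. \<integral>\<^sup>+\<omega>2. H (X1 \<omega>1, X2 \<omega>2) \<partial>M \<partial>M)"
  proof -
    have "(\<lambda>f1. \<integral>\<^sup>+f2. H (f1, f2) \<partial>distr M (P {t..}) X2) \<in> borel_measurable (P {..<t})"
      by (rule D2.borel_measurable_nn_integral) measurable
    then have "(\<integral>\<^sup>+f1. \<integral>\<^sup>+f2. H (f1, f2) \<partial>distr M (P {t..}) X2 \<partial>distr M (P {..<t}) X1) =
        (\<integral>\<^sup>+\<omega>1. \<integral>\<^sup>+f2. H (X1 \<omega>1, f2) \<partial>distr M (P {t..}) X2 \<partial>M)"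
      by (subst nn_integral_distr) auto
    also have "\<dots> = (\<integral>\<^sup>+\<omega>1. \<integral>\<^sup>+\<omega>2. H (X1 \<omega>1, X2 \<omega>2) \<partial>M \<partial>M)"
      by (intro nn_integral_cong nn_integral_distr) (use X1 in measurable)
    finally show ?thesis .
  qed
  also have "\<dots> \<le> (\<integral>\<^sup>+\<omega>. k (G (\<lambda>i. X i \<omega>)) \<partial>M)"
  proof (rule nn_integral_mono)
    fix \<omega>1 assume "\<omega>1 \<in> space M"
    then have "X1 \<omega>1 \<in> space (P {..<t})" using X1 by (auto simp: measurable_def)
    then have "G (emb {..<t} (X1 \<omega>1)) \<in> space N" by (rule measurable_space[OF measurable_compose[OF emb G]])
    from le[OF this] show "(\<integral>\<^sup>+\<omega>2. H (X1 \<omega>1, X2 \<omega>2) \<partial>M) \<le> k (G (\<lambda>i. X i \<omega>1))"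
      unfolding G1 h2 H_def by simp
  qed
  finally show ?thesis .
qed

text \<open>\<open>chain_max f k\<close> bounds the increments from \<open>x\<close> to the centres of level \<open>k\<close> along chains of nested
  half-size cubes; its self-similarity replaces the usual dyadic chaining sum.\<close>

primrec chain_max :: "(real ^ 'm \<Rightarrow> real ^ 'm) \<Rightarrow> nat \<Rightarrow> real ^ 'm \<Rightarrow> real \<Rightarrow> real" where
  "chain_max f 0 x r = 0"
| "chain_max f (Suc k) x r =
     Max ((\<lambda>h. norm (f (x + r *\<^sub>R h) - f x) + chain_max f k (x + r *\<^sub>R h) (r / 2)) ` corners)"

lemma chain_max_step:
  "h \<in> corners \<Longrightarrow> norm (f (x + r *\<^sub>R h) - f x) + chain_max f k (x + r *\<^sub>R h) (r / 2) \<le> chain_max f (Suc k) x r"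
  unfolding chain_max.simps by (intro Max_ge finite_imageI finite_corners imageI)

lemma chain_max_attained:
  obtains h where "h \<in> corners"
    "chain_max f (Suc k) x r = norm (f (x + r *\<^sub>R h) - f x) + chain_max f k (x + r *\<^sub>R h) (r / 2)"
proof -
  let ?A = "(\<lambda>h. norm (f (x + r *\<^sub>R h) - f x) + chain_max f k (x + r *\<^sub>R h) (r / 2)) ` corners"
  have "Max ?A \<in> ?A" by (intro Max_in) auto
  then show ?thesis using that unfolding chain_max.simps by blast
qed

lemma chain_max_nonneg [simp]: "chain_max f k x r \<ge> 0"
proof (induction k arbitrary: x r)
  case (Suc k)
  obtain h where "h \<in> corners"
    "chain_max f (Suc k) x r = norm (f (x + r *\<^sub>R h) - f x) + chain_max f k (x + r *\<^sub>R h) (r / 2)"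
    by (rule chain_max_attained)
  then show ?case using Suc[of "x + r *\<^sub>R h" "r / 2"] by simp
qed simp

lemma chain_max_mono: "chain_max f k x r \<le> chain_max f (Suc k) x r"
proof (induction k arbitrary: x r)
  case 0
  show ?case using chain_max_nonneg[of f 1 x r] by simp
next
  case (Suc k)
  obtain h where h: "h \<in> corners"
    "chain_max f (Suc k) x r = norm (f (x + r *\<^sub>R h) - f x) + chain_max f k (x + r *\<^sub>R h) (r / 2)"
    by (rule chain_max_attained)
  show ?case using Suc[of "x + r *\<^sub>R h" "r / 2"] chain_max_step[OF h(1), of f x r "Suc k"] h(2) by linarith
qed

lemma le_chain_max: "q \<in> centres k \<Longrightarrow> norm (f (x + r *\<^sub>R q) - f x) \<le> chain_max f k x r"
proof (induction k arbitrary: x r q)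
  case (Suc k)
  then obtain h v where h: "h \<in> corners" "v \<in> centres k" "q = h + (1/2) *\<^sub>R v" by auto
  have eq: "x + r *\<^sub>R q = x + r *\<^sub>R h + (r / 2) *\<^sub>R v" by (simp add: h(3) algebra_simps)
  have "norm (f (x + r *\<^sub>R q) - f x) \<le> norm (f (x + r *\<^sub>R h) - f x) + norm (f (x + r *\<^sub>R h + (r / 2) *\<^sub>R v) - f (x + r *\<^sub>R h))"
    unfolding eq using norm_triangle_ineq[of "f (x + r *\<^sub>R h) - f x" "f (x + r *\<^sub>R h + (r / 2) *\<^sub>R v) - f (x + r *\<^sub>R h)"]
    by (simp add: algebra_simps)
  then show ?case using Suc.IH[OF h(2), of "x + r *\<^sub>R h" "r / 2"] chain_max_step[OF h(1), of f x r k] by linarith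
qed simp

text \<open>If the chain maxima are unbounded, so are their powers, except for \<open>p = 0\<close>,
  where both sides are 1. Otherwise the maxima increase to a limit that bounds every dyadic
  increment.\<close>

lemma osc_power_le_chain_max: "ennreal (osc f x r ^ p) \<le> (SUP k. ennreal (chain_max f k x r ^ p))"
proof (cases "(SUP k. ennreal (chain_max f k x r)) = top")
  case True
  show ?thesis
  proof (cases "p = 0")
    case False
    have "(SUP k. ennreal (chain_max f k x r ^ p)) = top"
    proof (rule ennreal_SUP_eq_top)
      fix n :: nat
      have "ennreal (real n + 1) < (SUP k. ennreal (chain_max f k x r))" unfolding True by simp
      then obtain k where k: "ennreal (real n + 1) < ennreal (chain_max f k x r)" by (auto simp: less_SUP_iff)
      then have "real n + 1 < chain_max f k x r" by (subst (asm) ennreal_less_iff) auto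
      moreover from this have "chain_max f k x r \<le> chain_max f k x r ^ p" using False by (intro self_le_power) auto
      ultimately have "ennreal (real n) \<le> ennreal (chain_max f k x r ^ p)" by (intro ennreal_leI) linarith
      then show "\<exists>i\<in>UNIV. of_nat n \<le> ennreal (chain_max f i x r ^ p)" by (auto simp: ennreal_of_nat_eq_real_of_nat)
    qed
    then show ?thesis by (simp only: top_greatest)
  qed simp
next
  case False
  then obtain c where c: "(SUP k. ennreal (chain_max f k x r)) = ennreal c" "c \<ge> 0"
    by (cases "(SUP k. ennreal (chain_max f k x r))") auto
  have le_c: "chain_max f k x r \<le> c" for k
  proof -
    have "ennreal (chain_max f k x r) \<le> ennreal c" unfolding c(1)[symmetric] by (rule SUP_upper) simp
    then show ?thesis using c(2) by simp
  qed
  have lim: "(\<lambda>k. chain_max f k x r) \<longlonglongrightarrow> c"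
  proof -
    have "(\<lambda>k. ennreal (chain_max f k x r)) \<longlonglongrightarrow> ennreal c"
      unfolding c(1)[symmetric] by (intro LIMSEQ_SUP incseq_SucI ennreal_leI chain_max_mono)
    then show ?thesis using c(2) by (simp add: tendsto_ennreal_iff)
  qed
  have "osc f x r \<le> c"
    unfolding osc_def
  proof (rule cube_sup_le[OF _ c(2)])
    fix q :: "real ^ 'a" assume "q \<in> dyadics"
    then obtain k where "q \<in> centres k" by (auto simp: dyadics_def)
    from le_chain_max[OF this, of f x r] show "norm (f (x + r *\<^sub>R q) - f x) \<le> c" using le_c[of k] by linarith
  qed
  then have "ennreal (osc f x r ^ p) \<le> ennreal (c ^ p)" by (intro ennreal_leI power_mono) auto
  also have "\<dots> \<le> (SUP k. ennreal (chain_max f k x r ^ p))"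
  proof (rule LIMSEQ_le_const2)
    show "(\<lambda>k. ennreal (chain_max f k x r ^ p)) \<longlonglongrightarrow> ennreal (c ^ p)"
      by (intro tendsto_ennrealI tendsto_power lim)
    show "\<exists>N. \<forall>n\<ge>N. ennreal (chain_max f n x r ^ p) \<le> (SUP k. ennreal (chain_max f k x r ^ p))"
      by (intro exI[of _ 0] allI impI SUP_upper UNIV_I)
  qed
  finally show ?thesis .
qed

text \<open>The recursion for the moments of \<open>chain_max\<close> closes because \<open>(4/3)\<^sup>2 < 2\<close>.\<close>

lemma power_sum_le:
  fixes a b :: real
  assumes "a \<ge> 0" "b \<ge> 0"
  shows "(a + b) ^ p \<le> 4 ^ p * a ^ p + (4/3) ^ p * b ^ p"
proof (cases "a \<le> b / 3")
  case True
  then have "(a + b) ^ p \<le> (4/3 * b) ^ p" using assms by (intro power_mono) auto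
  then show ?thesis using assms unfolding power_mult_distrib by (intro add_increasing) auto
next
  case False
  then have "(a + b) ^ p \<le> (4 * a) ^ p" using assms by (intro power_mono) auto
  then show ?thesis using assms unfolding power_mult_distrib by (intro add_increasing2) auto
qed

text \<open>The shape of most mean estimates below: a pointwise bound is integrated in
  \<open>ennreal\<close>, with \<open>Y\<close> free of measurability conditions.\<close>

lemma nn_integral_affine_le:
  assumes [measurable]: "X \<in> borel_measurable M" and "prob_space M"
    and "\<And>\<omega>. \<omega> \<in> space M \<Longrightarrow> Y \<omega> \<le> a + w * X \<omega>" "\<And>\<omega>. X \<omega> \<ge> 0" "0 \<le> a" "0 \<le> w" "0 \<le> B"
    and "(\<integral>\<^sup>+\<omega>. ennreal (X \<omega>) \<partial>M) \<le> ennreal B"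
  shows "(\<integral>\<^sup>+\<omega>. ennreal (Y \<omega>) \<partial>M) \<le> ennreal (a + w * B)"
proof -
  interpret prob_space M by fact
  have "(\<integral>\<^sup>+\<omega>. ennreal (Y \<omega>) \<partial>M) \<le> (\<integral>\<^sup>+\<omega>. ennreal a + ennreal w * ennreal (X \<omega>) \<partial>M)"
    using assms by (intro nn_integral_mono) (auto simp flip: ennreal_plus ennreal_mult intro!: ennreal_leI)
  also have "\<dots> = ennreal a + ennreal w * (\<integral>\<^sup>+\<omega>. ennreal (X \<omega>) \<partial>M)"
    by (subst nn_integral_add) (auto simp: nn_integral_cmult emeasure_space_1)
  also have "\<dots> \<le> ennreal a + ennreal w * ennreal B" by (intro add_left_mono mult_left_mono assms) auto
  also have "\<dots> = ennreal (a + w * B)" using assms by (simp add: ennreal_mult)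
  finally show ?thesis .
qed

lemma nn_integral_sum_le:
  assumes [measurable]: "\<And>i. i \<in> I \<Longrightarrow> X i \<in> borel_measurable M"
    and "\<And>i. i \<in> I \<Longrightarrow> (\<integral>\<^sup>+\<omega>. ennreal (X i \<omega>) \<partial>M) \<le> ennreal (B i)"
    and "\<And>i \<omega>. i \<in> I \<Longrightarrow> X i \<omega> \<ge> 0" "\<And>i. i \<in> I \<Longrightarrow> 0 \<le> B i"
    and "\<And>\<omega>. \<omega> \<in> space M \<Longrightarrow> Y \<omega> \<le> (\<Sum>i\<in>I. X i \<omega>)"
  shows "(\<integral>\<^sup>+\<omega>. ennreal (Y \<omega>) \<partial>M) \<le> ennreal (\<Sum>i\<in>I. B i)"
proof -
  have "(\<integral>\<^sup>+\<omega>. ennreal (Y \<omega>) \<partial>M) \<le> (\<integral>\<^sup>+\<omega>. (\<Sum>i\<in>I. ennreal (X i \<omega>)) \<partial>M)"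
    using assms by (intro nn_integral_mono) (simp add: sum_ennreal ennreal_leI)
  also have "\<dots> = (\<Sum>i\<in>I. \<integral>\<^sup>+\<omega>. ennreal (X i \<omega>) \<partial>M)"
    by (rule nn_integral_sum) measurable
  also have "\<dots> \<le> (\<Sum>i\<in>I. ennreal (B i))" by (intro sum_mono assms)
  also have "\<dots> = ennreal (\<Sum>i\<in>I. B i)" using assms by (simp add: sum_ennreal)
  finally show ?thesis .
qed

lemma nn_integral_add_le:
  assumes [measurable]: "X \<in> borel_measurable M" "Z \<in> borel_measurable M"
    and "(\<integral>\<^sup>+\<omega>. ennreal (X \<omega>) \<partial>M) \<le> ennreal A" "(\<integral>\<^sup>+\<omega>. ennreal (Z \<omega>) \<partial>M) \<le> ennreal B"
    and "\<And>\<omega>. X \<omega> \<ge> 0" "\<And>\<omega>. Z \<omega> \<ge> 0" "0 \<le> A" "0 \<le> B"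
    and "\<And>\<omega>. \<omega> \<in> space M \<Longrightarrow> Y \<omega> \<le> X \<omega> + Z \<omega>"
  shows "(\<integral>\<^sup>+\<omega>. ennreal (Y \<omega>) \<partial>M) \<le> ennreal (A + B)"
proof -
  have "(\<integral>\<^sup>+\<omega>. ennreal (Y \<omega>) \<partial>M) \<le> (\<integral>\<^sup>+\<omega>. ennreal (X \<omega>) + ennreal (Z \<omega>) \<partial>M)"
    using assms by (intro nn_integral_mono) (simp flip: ennreal_plus add: ennreal_leI)
  also have "\<dots> = (\<integral>\<^sup>+\<omega>. ennreal (X \<omega>) \<partial>M) + (\<integral>\<^sup>+\<omega>. ennreal (Z \<omega>) \<partial>M)"
    by (rule nn_integral_add) measurable
  also have "\<dots> \<le> ennreal A + ennreal B" by (intro add_mono assms)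
  also have "\<dots> = ennreal (A + B)" using assms by simp
  finally show ?thesis .
qed

text \<open>Stands in for Hoelder's inequality: with the threshold \<open>a\<close> at the expected
  size of \<open>u\<close>, a bound on the moment of order \<open>p\<close> gives one of order
  \<open>j\<close>.\<close>

lemma power_le_scaled_power:
  fixes u a :: real
  assumes "a > 0" "u \<ge> 0" "j \<le> p"
  shows "u ^ j \<le> a ^ j + (1 / a ^ (p - j)) * u ^ p"
proof (cases "u \<le> a")
  case True
  then show ?thesis using assms by (intro add_increasing2 power_mono) auto
next
  case False
  then have "a ^ (p - j) \<le> u ^ (p - j)" using assms by (intro power_mono) auto
  then have "u ^ j * a ^ (p - j) \<le> u ^ j * u ^ (p - j)" using assms by (intro mult_left_mono) auto
  also have "\<dots> = u ^ p" using assms(3) by (simp flip: power_add)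
  finally have "u ^ j \<le> (1 / a ^ (p - j)) * u ^ p" using assms by (simp add: field_simps)
  then show ?thesis using assms by (intro add_increasing) auto
qed

section \<open>Finite nets and the oscillation within their cells\<close>

definition osc_max :: "(real ^ 'm \<Rightarrow> real ^ 'm) \<Rightarrow> nat \<Rightarrow> real ^ 'm \<Rightarrow> real \<Rightarrow> real" where
  "osc_max f k x r = Max ((\<lambda>v. osc f (x + r *\<^sub>R v) (r / 2 ^ k)) ` centres k)"

lemma le_osc_max: "v \<in> centres k \<Longrightarrow> osc f (x + r *\<^sub>R v) (r / 2 ^ k) \<le> osc_max f k x r"
  unfolding osc_max_def by (intro Max_ge) auto

lemma osc_max_attained: obtains v where "v \<in> centres k" "osc_max f k x r = osc f (x + r *\<^sub>R v) (r / 2 ^ k)"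
proof -
  have "osc_max f k x r \<in> (\<lambda>v. osc f (x + r *\<^sub>R v) (r / 2 ^ k)) ` centres k"
    unfolding osc_max_def by (intro Max_in) auto
  then show ?thesis using that by blast
qed

lemma osc_max_nonneg [simp]: "osc_max f k x r \<ge> 0"
  by (rule osc_max_attained[of k f x r]) simp

lemma norm_sub_centre_le:
  assumes "continuous_on UNIV f" "u' \<in> unit_cube" "v \<in> centres k"
  shows "norm (f (x + r *\<^sub>R (v + (1/2^k) *\<^sub>R u')) - f (x + r *\<^sub>R v)) \<le> osc_max f k x r"
proof -
  have "x + r *\<^sub>R (v + (1/2^k) *\<^sub>R u') = x + r *\<^sub>R v + (r / 2 ^ k) *\<^sub>R u'" by (simp add: algebra_simps)
  then show ?thesis using le_osc[OF assms(1,2), of "x + r *\<^sub>R v" "r / 2 ^ k"] le_osc_max[OF assms(3), of f x r] by (simp add: add.assoc)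
qed

lemma osc_le_net:
  assumes "continuous_on UNIV f"
  shows "osc f x r \<le> (\<Sum>v\<in>centres k. norm (f (x + r *\<^sub>R v) - f x)) + osc_max f k x r"
proof (rule osc_le)
  fix u :: "real ^ 'a" assume "u \<in> unit_cube"
  from cube_cover[OF this, of k] obtain v u' where v: "v \<in> centres k" "u' \<in> unit_cube" "u = v + (1/2^k) *\<^sub>R u'" by blast
  have "norm (f (x + r *\<^sub>R v) - f x) \<le> (\<Sum>v\<in>centres k. norm (f (x + r *\<^sub>R v) - f x))"
    using v(1) by (intro member_le_sum) auto
  moreover have "norm (f (x + r *\<^sub>R u) - f x) \<le> norm (f (x + r *\<^sub>R v) - f x) + norm (f (x + r *\<^sub>R u) - f (x + r *\<^sub>R v))"
    using norm_triangle_ineq[of "f (x + r *\<^sub>R v) - f x" "f (x + r *\<^sub>R u) - f (x + r *\<^sub>R v)"] by (simp add: algebra_simps)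
  ultimately show "norm (f (x + r *\<^sub>R u) - f x) \<le> (\<Sum>v\<in>centres k. norm (f (x + r *\<^sub>R v) - f x)) + osc_max f k x r"
    using norm_sub_centre_le[OF assms v(2,1), of x r] unfolding v(3) by linarith
qed (simp add: sum_nonneg)

text \<open>Moving from \<open>u\<close> to the centre of its cell changes the defect by an
  increment within the cell and by the interpolating linear map on a displacement with coordinates
  at most \<open>2^-k\<close>; the latter costs at most \<open>m / 2^k\<close> times the oscillation
  over the whole cube.\<close>

lemma nonaff_le_net:
  fixes f :: "real ^ 'm \<Rightarrow> real ^ 'm"
  assumes "continuous_on UNIV f"
  shows "nonaff f x r \<le> (\<Sum>v\<in>centres k. norm (affine_defect f x r v)) + osc_max f k x r + (real CARD('m) / 2 ^ k) * osc f x r"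
proof (rule nonaff_le)
  fix u :: "real ^ 'm" assume "u \<in> unit_cube"
  from cube_cover[OF this, of k] obtain v u' where v: "v \<in> centres k" "u' \<in> unit_cube" "u = v + (1/2^k) *\<^sub>R u'" by blast
  define d where "d j = f (x + r *\<^sub>R axis j 1) - f x" for j
  have "norm (affine_defect f x r v) \<le> (\<Sum>v\<in>centres k. norm (affine_defect f x r v))"
    using v(1) by (intro member_le_sum) auto
  moreover have "affine_defect f x r u = affine_defect f x r v + (f (x + r *\<^sub>R u) - f (x + r *\<^sub>R v))
      - (\<Sum>j\<in>UNIV. (u' $ j / 2 ^ k) *\<^sub>R d j)"
    unfolding affine_defect_def d_def[symmetric] v(3) by (simp add: algebra_simps sum.distrib)
  then have "norm (affine_defect f x r u) \<le> norm (affine_defect f x r v) + norm (f (x + r *\<^sub>R u) - f (x + r *\<^sub>R v))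
      + norm (\<Sum>j\<in>UNIV. (u' $ j / 2 ^ k) *\<^sub>R d j)"
    using norm_triangle_ineq4[of "affine_defect f x r v + (f (x + r *\<^sub>R u) - f (x + r *\<^sub>R v))" "\<Sum>j\<in>UNIV. (u' $ j / 2 ^ k) *\<^sub>R d j"]
      norm_triangle_ineq[of "affine_defect f x r v" "f (x + r *\<^sub>R u) - f (x + r *\<^sub>R v)"] by simp
  moreover have "norm (\<Sum>j\<in>UNIV. (u' $ j / 2 ^ k) *\<^sub>R d j) \<le> (real CARD('m) / 2 ^ k) * osc f x r"
  proof -
    have "norm (\<Sum>j\<in>UNIV. (u' $ j / 2 ^ k) *\<^sub>R d j) \<le> (\<Sum>j\<in>(UNIV :: 'm set). (1 / 2 ^ k) * osc f x r)"
    proof (rule sum_norm_le)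
      fix j :: 'm
      have "\<bar>u' $ j / 2 ^ k\<bar> \<le> 1 / 2 ^ k" using v(2) by (auto simp: divide_right_mono)
      moreover have "norm (d j) \<le> osc f x r"
        unfolding d_def by (rule le_osc[OF assms axis_unit_cube])
      ultimately show "norm ((u' $ j / 2 ^ k) *\<^sub>R d j) \<le> (1 / 2 ^ k) * osc f x r"
        unfolding norm_scaleR by (intro mult_mono) auto
    qed
    then show ?thesis by simp
  qed
  ultimately show "norm (affine_defect f x r u) \<le> (\<Sum>v\<in>centres k. norm (affine_defect f x r v)) + osc_max f k x r + (real CARD('m) / 2 ^ k) * osc f x r"
    using norm_sub_centre_le[OF assms v(2,1), of x r] unfolding v(3) by linarith
qed (simp add: sum_nonneg)

section \<open>Abstract random maps and their one-step bounds\<close>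

abbreviation (in prob_space) nnexp :: "('a \<Rightarrow> real) \<Rightarrow> ennreal" where
  "nnexp X \<equiv> \<integral>\<^sup>+\<omega>. ennreal (X \<omega>) \<partial>M"

text \<open>What the dynamical part uses about the maps. The order \<open>2m\<close> outweighs the
  number \<open>2^(mk)\<close> of cells, and \<open>c\<close> may be large; the gain per step comes
  from the second moment. \<open>bounded_increment\<close> yields the return to bounded cubes,
  \<open>affine_defect\<close> the smallness of the affine error, \<open>small_ball\<close> the
  passage from bounded to small cubes.\<close>

locale random_maps = prob_space M for M :: "'w measure" +
  fixes \<xi> :: "nat \<Rightarrow> 'w \<Rightarrow> real ^ 'm \<Rightarrow> real ^ 'm" and c \<kappa> b K :: real
  assumes indep: "indep_vars (\<lambda>_. fun_sigma) \<xi> UNIV"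
    and continuous: "\<omega> \<in> space M \<Longrightarrow> continuous_on UNIV (\<xi> n \<omega>)"
    and moment: "nnexp (\<lambda>\<omega>. norm (\<xi> n \<omega> y - \<xi> n \<omega> z) ^ (2 * CARD('m)))
      \<le> ennreal (c * norm (y - z) ^ (2 * CARD('m)))"
    and contraction: "nnexp (\<lambda>\<omega>. (norm (\<xi> n \<omega> y - \<xi> n \<omega> z))\<^sup>2) \<le> ennreal (\<kappa> * (norm (y - z))\<^sup>2)"
    and bounded_increment: "nnexp (\<lambda>\<omega>. norm (\<xi> n \<omega> y - \<xi> n \<omega> z)) \<le> ennreal b"
    and affine_defect: "u \<in> unit_cube \<Longrightarrow> r \<ge> 0 \<Longrightarrow>
      nnexp (\<lambda>\<omega>. norm (affine_defect (\<xi> n \<omega>) x r u)) \<le> ennreal (K * r\<^sup>2)"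
    and small_ball: "R > 0 \<Longrightarrow> d > 0 \<Longrightarrow> \<exists>g>0. \<forall>n x. g \<le> prob {\<omega> \<in> space M. osc (\<xi> n \<omega>) x R \<le> d}"
    and c_nonneg: "0 \<le> c" and \<kappa>: "0 \<le> \<kappa>" "\<kappa> < 1" and b_nonneg: "0 \<le> b" and K_nonneg: "0 \<le> K"
begin

lemma random_map [measurable]: "\<xi> n \<in> measurable M fun_sigma"
  using indep by (auto simp: indep_vars_def)

lemma random_map_value [measurable]: "(\<lambda>\<omega>. \<xi> n \<omega> z) \<in> borel_measurable M"
  using measurable_compose[OF random_map measurable_component_singleton[of z UNIV "\<lambda>_. borel"]] by simp

lemma reg_random_map: "\<omega> \<in> space M \<Longrightarrow> reg (\<xi> n \<omega>) = \<xi> n \<omega>"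
  by (rule reg_continuous[OF continuous])

lemma random_map_eval [measurable (raw)]:
  assumes [measurable]: "z \<in> borel_measurable M"
  shows "(\<lambda>\<omega>. \<xi> n \<omega> (z \<omega>)) \<in> borel_measurable M"
proof -
  have "(\<lambda>\<omega>. reg (\<xi> n \<omega>) (z \<omega>)) \<in> borel_measurable M" by measurable
  then show ?thesis by (rule measurable_cong[THEN iffD1, rotated]) (simp add: reg_random_map)
qed

lemma measurable_osc_map [measurable]: "(\<lambda>\<omega>. osc (\<xi> n \<omega>) x r) \<in> borel_measurable M"
  by (rule measurable_osc; measurable)

lemma measurable_nonaff_map [measurable]: "(\<lambda>\<omega>. nonaff (\<xi> n \<omega>) x r) \<in> borel_measurable M"
  by (rule measurable_nonaff; measurable)

lemma measurable_chain_max [measurable]: "(\<lambda>\<omega>. chain_max (\<xi> n \<omega>) k x r) \<in> borel_measurable M"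
proof (induction k arbitrary: x r)
  case (Suc k)
  note Suc [measurable]
  show ?case unfolding chain_max.simps by (intro borel_measurable_Max) (auto intro!: measurable)
qed auto

text \<open>The solution of \<open>C = 2^m * c' + (8/9) * C\<close>, the recursion met in
  \<open>chain_max_moment\<close>, with \<open>c'\<close> the constant of the first chain
  link.\<close>

definition moment_const :: real where
  "moment_const = 9 * (2 ^ CARD('m) * (4 ^ (2 * CARD('m)) * (c * real CARD('m) ^ (2 * CARD('m)))))"

lemma moment_const_nonneg: "0 \<le> moment_const"
  using c_nonneg by (simp add: moment_const_def)

text \<open>The maximum over the corners is bounded by the sum. The remaining chain then carries a
  factor \<open>2^m\<close> from the number of corners, \<open>(4/3)^(2m)\<close> from
  \<open>power_sum_le\<close> and \<open>2^(-2m)\<close> from halving the radius, in total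
  \<open>(8/9)^m\<close>, so the constant does not grow with \<open>k\<close>.\<close>

lemma chain_max_moment:
  "r \<ge> 0 \<Longrightarrow> nnexp (\<lambda>\<omega>. chain_max (\<xi> n \<omega>) k x r ^ (2 * CARD('m))) \<le> ennreal (moment_const * r ^ (2 * CARD('m)))"
proof (induction k arbitrary: x r)
  case 0
  then show ?case using moment_const_nonneg by (simp add: power_0_left)
next
  case (Suc k)
  let ?p = "2 * CARD('m)" and ?C = moment_const
  define c' where "c' = 4 ^ ?p * (c * real CARD('m) ^ ?p)"
  have c': "c' \<ge> 0" using c_nonneg by (simp add: c'_def)
  define X where "X h \<omega> = 4 ^ ?p * norm (\<xi> n \<omega> (x + r *\<^sub>R h) - \<xi> n \<omega> x) ^ ?p
      + (4/3) ^ ?p * chain_max (\<xi> n \<omega>) k (x + r *\<^sub>R h) (r / 2) ^ ?p" for h \<omega>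
  have X: "nnexp (\<lambda>\<omega>. X h \<omega>) \<le> ennreal (c' * r ^ ?p + (4/3) ^ ?p * (?C * (r / 2) ^ ?p))"
    if h: "h \<in> corners" for h
  proof (rule nn_integral_add_le)
    have "nnexp (\<lambda>\<omega>. norm (\<xi> n \<omega> (x + r *\<^sub>R h) - \<xi> n \<omega> x) ^ ?p) \<le> ennreal (c * norm (r *\<^sub>R h) ^ ?p)"
      using moment[of n "x + r *\<^sub>R h" x] by simp
    also have "\<dots> \<le> ennreal (c * (real CARD('m) * r) ^ ?p)"
    proof (intro ennreal_leI mult_left_mono power_mono c_nonneg)
      have "norm h \<le> real CARD('m)" using h corners_subset_cube by (intro norm_unit_cube) blast
      then show "norm (r *\<^sub>R h) \<le> real CARD('m) * r" using \<open>r \<ge> 0\<close> by (simp add: mult.commute mult_left_mono)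
    qed auto
    finally show "nnexp (\<lambda>\<omega>. 4 ^ ?p * norm (\<xi> n \<omega> (x + r *\<^sub>R h) - \<xi> n \<omega> x) ^ ?p) \<le> ennreal (c' * r ^ ?p)"
      using nn_integral_affine_le[of "\<lambda>\<omega>. norm (\<xi> n \<omega> (x + r *\<^sub>R h) - \<xi> n \<omega> x) ^ ?p" M _ 0 "4 ^ ?p" "c * (real CARD('m) * r) ^ ?p"]
        prob_space_axioms c_nonneg \<open>r \<ge> 0\<close> by (simp add: c'_def power_mult_distrib mult_ac)
    show "nnexp (\<lambda>\<omega>. (4/3) ^ ?p * chain_max (\<xi> n \<omega>) k (x + r *\<^sub>R h) (r / 2) ^ ?p) \<le> ennreal ((4/3) ^ ?p * (?C * (r / 2) ^ ?p))"
      using nn_integral_affine_le[of "\<lambda>\<omega>. chain_max (\<xi> n \<omega>) k (x + r *\<^sub>R h) (r / 2) ^ ?p" M _ 0 "(4/3) ^ ?p" "?C * (r / 2) ^ ?p"]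
        prob_space_axioms moment_const_nonneg \<open>r \<ge> 0\<close> Suc.IH[of "r / 2" "x + r *\<^sub>R h"] by simp
  qed (use c' moment_const_nonneg \<open>r \<ge> 0\<close> in \<open>auto simp: X_def\<close>)
  have "nnexp (\<lambda>\<omega>. chain_max (\<xi> n \<omega>) (Suc k) x r ^ ?p)
      \<le> ennreal (\<Sum>h\<in>(corners :: (real ^ 'm) set). c' * r ^ ?p + (4/3) ^ ?p * (?C * (r / 2) ^ ?p))"
  proof (rule nn_integral_sum_le[OF _ X])
    fix \<omega>
    obtain h where h: "h \<in> corners"
      "chain_max (\<xi> n \<omega>) (Suc k) x r = norm (\<xi> n \<omega> (x + r *\<^sub>R h) - \<xi> n \<omega> x) + chain_max (\<xi> n \<omega>) k (x + r *\<^sub>R h) (r / 2)"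
      by (rule chain_max_attained)
    have "chain_max (\<xi> n \<omega>) (Suc k) x r ^ ?p \<le> X h \<omega>"
      unfolding h(2) X_def by (intro power_sum_le) auto
    also have "\<dots> \<le> (\<Sum>h\<in>corners. X h \<omega>)" using h(1) by (intro member_le_sum) (auto simp: X_def)
    finally show "chain_max (\<xi> n \<omega>) (Suc k) x r ^ ?p \<le> (\<Sum>h\<in>corners. X h \<omega>)" .
  qed (use c' moment_const_nonneg \<open>r \<ge> 0\<close> in \<open>auto simp: X_def\<close>)
  also have "\<dots> \<le> ennreal (?C * r ^ ?p)"
  proof (rule ennreal_leI)
    have "(4/3 :: real) ^ ?p * (1/2) ^ ?p * 2 ^ CARD('m) = (8/9) ^ CARD('m)"
      unfolding power_mult power_mult_distrib[symmetric] by (simp add: power2_eq_square)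
    also have "\<dots> \<le> 8/9"
      using power_decreasing[of 1 "CARD('m)" "8/9 :: real"] by (simp add: Suc_leI)
    finally have *: "(4/3 :: real) ^ ?p * (1/2) ^ ?p * 2 ^ CARD('m) \<le> 8/9" .
    have "(\<Sum>h\<in>(corners :: (real ^ 'm) set). c' * r ^ ?p + (4/3) ^ ?p * (?C * (r / 2) ^ ?p))
        = real (card (corners :: (real ^ 'm) set)) * (c' * r ^ ?p + (4/3) ^ ?p * (?C * (r / 2) ^ ?p))" by simp
    also have "\<dots> \<le> 2 ^ CARD('m) * (c' * r ^ ?p + (4/3) ^ ?p * (?C * (r / 2) ^ ?p))"
    proof (intro mult_right_mono)
      show "real (card (corners :: (real ^ 'm) set)) \<le> 2 ^ CARD('m)"
        using card_corners[where 'm='m] by (metis of_nat_le_iff of_nat_numeral of_nat_power)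
    qed (use c' moment_const_nonneg \<open>r \<ge> 0\<close> in auto)
    also have "\<dots> = (2 ^ CARD('m) * c' + ((4/3) ^ ?p * (1/2) ^ ?p * 2 ^ CARD('m)) * ?C) * r ^ ?p"
      by (simp add: algebra_simps power_divide)
    also have "\<dots> \<le> (?C / 9 + 8/9 * ?C) * r ^ ?p"
      using * moment_const_nonneg \<open>r \<ge> 0\<close>
      by (intro mult_right_mono add_mono) (auto simp: moment_const_def c'_def)
    also have "\<dots> = ?C * r ^ ?p" by simp
    finally show "(\<Sum>h\<in>(corners :: (real ^ 'm) set). c' * r ^ ?p + (4/3) ^ ?p * (?C * (r / 2) ^ ?p)) \<le> ?C * r ^ ?p" .
  qed
  finally show ?case .
qed

lemma osc_moment:
  assumes "r \<ge> 0"
  shows "nnexp (\<lambda>\<omega>. osc (\<xi> n \<omega>) x r ^ (2 * CARD('m))) \<le> ennreal (moment_const * r ^ (2 * CARD('m)))"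
proof -
  let ?p = "2 * CARD('m)"
  have "nnexp (\<lambda>\<omega>. osc (\<xi> n \<omega>) x r ^ ?p) \<le> (\<integral>\<^sup>+\<omega>. (SUP k. ennreal (chain_max (\<xi> n \<omega>) k x r ^ ?p)) \<partial>M)"
    by (intro nn_integral_mono osc_power_le_chain_max)
  also have "\<dots> = (SUP k. \<integral>\<^sup>+\<omega>. ennreal (chain_max (\<xi> n \<omega>) k x r ^ ?p) \<partial>M)"
    by (intro nn_integral_monotone_convergence_SUP incseq_SucI le_funI ennreal_leI power_mono chain_max_mono) auto
  also have "\<dots> \<le> ennreal (moment_const * r ^ ?p)"
    by (intro SUP_least chain_max_moment assms)
  finally show ?thesis .
qed

lemma osc_low_moment:
  assumes "r \<ge> 0" "0 < j" "j \<le> 2"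
  shows "nnexp (\<lambda>\<omega>. osc (\<xi> n \<omega>) x r ^ j) \<le> ennreal ((1 + moment_const) * r ^ j)"
proof (cases "r = 0")
  case True
  then show ?thesis using assms by (simp add: power_0_left)
next
  case False
  let ?p = "2 * CARD('m)"
  have j: "j \<le> ?p" using assms Suc_leI[OF zero_less_card_finite[where 'a='m]] by linarith
  have "nnexp (\<lambda>\<omega>. osc (\<xi> n \<omega>) x r ^ j) \<le> ennreal (r ^ j + (1 / r ^ (?p - j)) * (moment_const * r ^ ?p))"
  proof (rule nn_integral_affine_le[OF _ prob_space_axioms _ _ _ _ _ osc_moment])
    show "osc (\<xi> n \<omega>) x r ^ j \<le> r ^ j + 1 / r ^ (?p - j) * osc (\<xi> n \<omega>) x r ^ ?p" for \<omega>
      using False assms j by (intro power_le_scaled_power) auto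
  qed (use assms moment_const_nonneg in auto)
  also have "r ^ ?p = r ^ (?p - j) * r ^ j" using j by (simp flip: power_add)
  finally show ?thesis using False by (simp add: algebra_simps)
qed

lemma measurable_osc_max [measurable]: "(\<lambda>\<omega>. osc_max (\<xi> n \<omega>) k x r) \<in> borel_measurable M"
  unfolding osc_max_def by (intro borel_measurable_Max) auto

text \<open>Summing over \<open>2^(mk)\<close> cells of radius \<open>r / 2^k\<close> leaves a
  factor \<open>2^(-mk)\<close> in the moment of order \<open>2m\<close>, so the largest oscillation
  within a cell becomes small relative to \<open>r\<close>, uniformly in the position.\<close>

lemma osc_max_mean:
  assumes "e > 0"
  shows "\<exists>k0. \<forall>k\<ge>k0. \<forall>n x. \<forall>r\<ge>0. nnexp (\<lambda>\<omega>. osc_max (\<xi> n \<omega>) k x r) \<le> ennreal (e * r)"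
proof -
  let ?p = "2 * CARD('m)"
  \<comment> \<open>The threshold for the passage to the first moment is \<open>a * r\<close>;
    \<open>k0\<close> makes the moment term no larger than it, so each accounts for half of
    \<open>e * r\<close>.\<close>
  define a where "a = e / 2"
  have a: "a > 0" using assms by (simp add: a_def)
  obtain k0 where k0: "moment_const / (a * a ^ (?p - 1)) < 2 ^ k0" using real_arch_pow[of 2] by auto
  have "nnexp (\<lambda>\<omega>. osc_max (\<xi> n \<omega>) k x r) \<le> ennreal (e * r)" if k: "k \<ge> k0" and r: "r \<ge> 0" for k n x r
  proof (cases "r = 0")
    case True
    then have "osc_max (\<xi> n \<omega>) k x r = 0" for \<omega>
      by (cases rule: osc_max_attained[of k "\<xi> n \<omega>" x r]) simp
    then show ?thesis by simp
  next
    case False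
    then have r: "r > 0" using r by simp
    have "nnexp (\<lambda>\<omega>. osc_max (\<xi> n \<omega>) k x r ^ ?p)
        \<le> ennreal (\<Sum>v\<in>(centres k :: (real ^ 'm) set). moment_const * (r / 2 ^ k) ^ ?p)"
    proof (rule nn_integral_sum_le[OF _ osc_moment])
      fix \<omega>
      obtain v where v: "v \<in> centres k" "osc_max (\<xi> n \<omega>) k x r = osc (\<xi> n \<omega>) (x + r *\<^sub>R v) (r / 2 ^ k)"
        by (rule osc_max_attained)
      show "osc_max (\<xi> n \<omega>) k x r ^ ?p \<le> (\<Sum>v\<in>centres k. osc (\<xi> n \<omega>) (x + r *\<^sub>R v) (r / 2 ^ k) ^ ?p)"
        unfolding v(2) using v(1) by (intro member_le_sum[of v _ "\<lambda>v. osc (\<xi> n \<omega>) (x + r *\<^sub>R v) (r / 2 ^ k) ^ ?p"]) auto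
    qed (use r moment_const_nonneg in auto)
    also have "\<dots> \<le> ennreal (moment_const / 2 ^ k * r ^ ?p)"
    proof (rule ennreal_leI)
      have "(\<Sum>v\<in>(centres k :: (real ^ 'm) set). moment_const * (r / 2 ^ k) ^ ?p)
          = real (card (centres k :: (real ^ 'm) set)) * (moment_const * (r / 2 ^ k) ^ ?p)" by simp
      also have "\<dots> \<le> 2 ^ (CARD('m) * k) * (moment_const * (r / 2 ^ k) ^ ?p)"
      proof (intro mult_right_mono)
        show "real (card (centres k :: (real ^ 'm) set)) \<le> 2 ^ (CARD('m) * k)"
          using card_centres[where 'm='m and k=k] by (metis of_nat_le_iff of_nat_numeral of_nat_power)
      qed (use r moment_const_nonneg in auto)
      also have "\<dots> = moment_const / 2 ^ (CARD('m) * k) * r ^ ?p"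
        by (simp add: power_divide field_simps flip: power_mult power_add)
      also have "\<dots> \<le> moment_const / 2 ^ k * r ^ ?p"
        using r moment_const_nonneg Suc_leI[OF zero_less_card_finite[where 'a='m]]
        by (intro mult_right_mono divide_left_mono power_increasing) auto
      finally show "(\<Sum>v\<in>(centres k :: (real ^ 'm) set). moment_const * (r / 2 ^ k) ^ ?p) \<le> moment_const / 2 ^ k * r ^ ?p" .
    qed
    finally have mom: "nnexp (\<lambda>\<omega>. osc_max (\<xi> n \<omega>) k x r ^ ?p) \<le> ennreal (moment_const / 2 ^ k * r ^ ?p)" .
    have "nnexp (\<lambda>\<omega>. osc_max (\<xi> n \<omega>) k x r) \<le> ennreal (a * r + (1 / (a * r) ^ (?p - 1)) * (moment_const / 2 ^ k * r ^ ?p))"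
    proof (rule nn_integral_affine_le[OF _ prob_space_axioms _ _ _ _ _ mom])
      show "osc_max (\<xi> n \<omega>) k x r \<le> a * r + 1 / (a * r) ^ (?p - 1) * osc_max (\<xi> n \<omega>) k x r ^ ?p" for \<omega>
        using a r power_le_scaled_power[of "a * r" "osc_max (\<xi> n \<omega>) k x r" 1 ?p] by simp
    qed (use r a moment_const_nonneg in auto)
    also have "\<dots> \<le> ennreal (e * r)"
    proof (rule ennreal_leI)
      have "moment_const < a * a ^ (?p - 1) * 2 ^ k0" using k0 a by (simp add: field_simps)
      also have "\<dots> \<le> a * a ^ (?p - 1) * 2 ^ k" using a k by (intro mult_left_mono power_increasing) auto
      finally have "moment_const / 2 ^ k \<le> a * a ^ (?p - 1)" by (simp add: field_simps)
      then have "(1 / (a * r) ^ (?p - 1)) * (moment_const / 2 ^ k * r ^ ?p) \<le> (1 / (a * r) ^ (?p - 1)) * (a * a ^ (?p - 1) * r ^ ?p)"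
        using a r by (intro mult_left_mono mult_right_mono) auto
      also have "(1 / (a * r) ^ (?p - 1)) * (a * a ^ (?p - 1) * r ^ ?p) = a * r"
      proof -
        have "r ^ ?p = r * r ^ (?p - 1)" by (simp flip: power_Suc)
        then show ?thesis using a r by (simp add: power_mult_distrib)
      qed
      finally have "(1 / (a * r) ^ (?p - 1)) * (moment_const / 2 ^ k * r ^ ?p) \<le> a * r" .
      moreover have "a * r + a * r = e * r" by (simp add: a_def)
      ultimately show "a * r + (1 / (a * r) ^ (?p - 1)) * (moment_const / 2 ^ k * r ^ ?p) \<le> e * r"
        by linarith
    qed
    finally show ?thesis .
  qed
  then show ?thesis by blast
qed

text \<open>A net of fixed level has a fixed number of increments, each of mean at most
  \<open>b\<close> for every \<open>r\<close>; only the oscillation within the cells scales with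
  \<open>r\<close>, and the level \<open>k\<close> brings its slope down to 1/2.\<close>

lemma osc_drift: "\<exists>b'\<ge>0. \<forall>n x. \<forall>r\<ge>0. nnexp (\<lambda>\<omega>. osc (\<xi> n \<omega>) x r) \<le> ennreal (b' + r / 2)"
proof -
  obtain k where k: "\<And>n x r. r \<ge> 0 \<Longrightarrow> nnexp (\<lambda>\<omega>. osc_max (\<xi> n \<omega>) k x r) \<le> ennreal (1/2 * r)"
    using osc_max_mean[of "1/2"] by (metis order_refl half_gt_zero zero_less_one)
  have "nnexp (\<lambda>\<omega>. osc (\<xi> n \<omega>) x r) \<le> ennreal ((\<Sum>v\<in>(centres k :: (real ^ 'm) set). b) + 1/2 * r)" if "r \<ge> 0" for n x r
  proof (rule nn_integral_add_le[OF _ _ _ k[OF that]])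
    show "nnexp (\<lambda>\<omega>. \<Sum>v\<in>centres k. norm (\<xi> n \<omega> (x + r *\<^sub>R v) - \<xi> n \<omega> x)) \<le> ennreal (\<Sum>v\<in>(centres k :: (real ^ 'm) set). b)"
      by (rule nn_integral_sum_le[OF _ bounded_increment]) (auto simp: b_nonneg)
  qed (use that b_nonneg osc_le_net[OF continuous] in \<open>auto intro: sum_nonneg\<close>)
  then show ?thesis using b_nonneg by (intro exI[of _ "\<Sum>v\<in>(centres k :: (real ^ 'm) set). b"]) auto
qed

text \<open>At the net points the mean defect is of order \<open>r^2\<close>. The linear terms come
  from the oscillation within cells and from rounding to centres, and each takes half of
  \<open>e\<close>. \<open>K'\<close> is \<open>K\<close> times the number of net points and so
  depends on \<open>e\<close>.\<close>

lemma nonaff_mean: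
  assumes "e > 0"
  shows "\<exists>K'\<ge>0. \<forall>n x. \<forall>r\<ge>0. nnexp (\<lambda>\<omega>. nonaff (\<xi> n \<omega>) x r) \<le> ennreal (e * r + K' * r\<^sup>2)"
proof -
  obtain k0 where k0: "\<And>k n x r. k \<ge> k0 \<Longrightarrow> r \<ge> 0 \<Longrightarrow> nnexp (\<lambda>\<omega>. osc_max (\<xi> n \<omega>) k x r) \<le> ennreal (e / 2 * r)"
    using osc_max_mean[of "e / 2"] assms by (metis half_gt_zero)
  obtain k1 where k1: "real CARD('m) * (1 + moment_const) / (e / 2) < 2 ^ k1" using real_arch_pow[of 2] by auto
  define k where "k = max k0 k1"
  have "(2 :: real) ^ k1 \<le> 2 ^ k" by (intro power_increasing) (auto simp: k_def)
  then have k2: "real CARD('m) / 2 ^ k * (1 + moment_const) \<le> e / 2"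
  proof -
    have "real CARD('m) * (1 + moment_const) < e / 2 * 2 ^ k1" using k1 assms by (simp add: pos_divide_less_eq mult.commute)
    also have "\<dots> \<le> e / 2 * 2 ^ k" using \<open>2 ^ k1 \<le> 2 ^ k\<close> assms by (intro mult_left_mono) auto
    finally have "real CARD('m) * (1 + moment_const) / 2 ^ k \<le> e / 2" by (simp add: pos_divide_le_eq)
    then show ?thesis by simp
  qed
  define K' where "K' = (\<Sum>v\<in>(centres k :: (real ^ 'm) set). K)"
  have K': "K' \<ge> 0" unfolding K'_def using K_nonneg by (intro sum_nonneg)
  have "nnexp (\<lambda>\<omega>. nonaff (\<xi> n \<omega>) x r) \<le> ennreal (e * r + K' * r\<^sup>2)" if r: "r \<ge> 0" for n x r
  proof -
    have 1: "nnexp (\<lambda>\<omega>. \<Sum>v\<in>centres k. norm (affine_defect (\<xi> n \<omega>) x r v)) \<le> ennreal (\<Sum>v\<in>(centres k :: (real ^ 'm) set). K * r\<^sup>2)"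
      by (rule nn_integral_sum_le[OF _ affine_defect])
        (use r K_nonneg centres_subset_cube in \<open>auto simp: affine_defect_def\<close>)
    have 2: "nnexp (\<lambda>\<omega>. (real CARD('m) / 2 ^ k) * osc (\<xi> n \<omega>) x r) \<le> ennreal (0 + (real CARD('m) / 2 ^ k) * ((1 + moment_const) * r ^ 1))"
      by (rule nn_integral_affine_le[where X="\<lambda>\<omega>. osc (\<xi> n \<omega>) x r", OF _ prob_space_axioms])
        (use r moment_const_nonneg osc_low_moment[of r 1 n x] in auto)
    have 3: "nnexp (\<lambda>\<omega>. osc_max (\<xi> n \<omega>) k x r + (real CARD('m) / 2 ^ k) * osc (\<xi> n \<omega>) x r)
        \<le> ennreal (e / 2 * r + (0 + (real CARD('m) / 2 ^ k) * ((1 + moment_const) * r ^ 1)))"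
      by (rule nn_integral_add_le[OF _ _ k0[of k r n x] 2]) (use r assms moment_const_nonneg in \<open>auto simp: k_def\<close>)
    have "nnexp (\<lambda>\<omega>. nonaff (\<xi> n \<omega>) x r) \<le> ennreal ((\<Sum>v\<in>(centres k :: (real ^ 'm) set). K * r\<^sup>2) +
        (e / 2 * r + (0 + (real CARD('m) / 2 ^ k) * ((1 + moment_const) * r ^ 1))))"
      by (rule nn_integral_add_le[OF _ _ 1 3])
        (use r assms moment_const_nonneg K_nonneg nonaff_le_net[OF continuous] in \<open>auto simp: affine_defect_def sum_nonneg add.assoc\<close>)
    also have "\<dots> \<le> ennreal (e * r + K' * r\<^sup>2)"
    proof (rule ennreal_leI)
      have "(real CARD('m) / 2 ^ k) * ((1 + moment_const) * r ^ 1) \<le> e / 2 * r"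
        using mult_right_mono[OF k2 r] by (simp add: mult.assoc)
      then show "(\<Sum>v\<in>(centres k :: (real ^ 'm) set). K * r\<^sup>2) + (e / 2 * r + (0 + (real CARD('m) / 2 ^ k) * ((1 + moment_const) * r ^ 1)))
        \<le> e * r + K' * r\<^sup>2" unfolding K'_def sum_distrib_right[symmetric] by linarith
    qed
    finally show ?thesis .
  qed
  then show ?thesis using K' by blast
qed

end

section \<open>Multi-step estimates\<close>

text \<open>Iterated majorant of the radius of the image of the cube of radius \<open>r\<close> around \<open>x\<close>. Together with the
  centre \<open>flow F s n x\<close> it is a Markov chain, unlike the radius itself.\<close>

primrec rad :: "(nat \<Rightarrow> real ^ 'm \<Rightarrow> real ^ 'm) \<Rightarrow> nat \<Rightarrow> nat \<Rightarrow> real ^ 'm \<Rightarrow> real \<Rightarrow> real" where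
  "rad F s 0 x r = r"
| "rad F s (Suc n) x r = osc (reg (F (s + n))) (flow F s n x) (rad F s n x r)"

lemma rad_nonneg: "r \<ge> 0 \<Longrightarrow> rad F s n x r \<ge> 0"
  by (cases n) auto

lemma rad_cong: "(\<And>i. i < s + n \<Longrightarrow> F i = G i) \<Longrightarrow> rad F s n x r = rad G s n x r"
proof (induction n)
  case (Suc n)
  have "flow F s n x = flow G s n x" using Suc.prems by (intro flow_cong) auto
  moreover have "F (s + n) = G (s + n)" using Suc.prems by simp
  ultimately show ?case using Suc.IH Suc.prems by simp
qed simp

lemma measurable_rad [measurable (raw)]:
  assumes F [measurable]: "F \<in> measurable N (PiM UNIV (\<lambda>_. fun_sigma))"
    and [measurable]: "x \<in> borel_measurable N" "r \<in> borel_measurable N"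
  shows "(\<lambda>\<omega>. rad (F \<omega>) s n (x \<omega>) (r \<omega>)) \<in> borel_measurable N"
proof (induction n)
  case (Suc n)
  note Suc [measurable]
  have [measurable]: "(\<lambda>\<omega>. F \<omega> i) \<in> measurable N fun_sigma" for i
    using measurable_compose[OF F measurable_component_singleton[of i UNIV "\<lambda>_. fun_sigma"]] by simp
  show ?case by (simp, rule measurable_osc; measurable)
qed simp

lemma measurable_osc_flow [measurable (raw)]:
  assumes [measurable]: "F \<in> measurable N (PiM UNIV (\<lambda>_. fun_sigma))"
    "x \<in> borel_measurable N" "r \<in> borel_measurable N"
  shows "(\<lambda>\<omega>. osc (flow (F \<omega>) s n) (x \<omega>) (r \<omega>)) \<in> borel_measurable N"
    "(\<lambda>\<omega>. nonaff (flow (F \<omega>) s n) (x \<omega>) (r \<omega>)) \<in> borel_measurable N"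
proof -
  show "(\<lambda>\<omega>. osc (flow (F \<omega>) s n) (x \<omega>) (r \<omega>)) \<in> borel_measurable N"
    by (rule measurable_osc; measurable)
  show "(\<lambda>\<omega>. nonaff (flow (F \<omega>) s n) (x \<omega>) (r \<omega>)) \<in> borel_measurable N"
    by (rule measurable_nonaff; measurable)
qed

lemma measurable_osc_reg [measurable (raw)]:
  assumes [measurable]: "f \<in> measurable N fun_sigma"
    "x \<in> borel_measurable N" "r \<in> borel_measurable N"
  shows "(\<lambda>\<omega>. osc (reg (f \<omega>)) (x \<omega>) (r \<omega>)) \<in> borel_measurable N"
    "(\<lambda>\<omega>. nonaff (reg (f \<omega>)) (x \<omega>) (r \<omega>)) \<in> borel_measurable N"
proof -
  show "(\<lambda>\<omega>. osc (reg (f \<omega>)) (x \<omega>) (r \<omega>)) \<in> borel_measurable N"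
    by (rule measurable_osc; measurable)
  show "(\<lambda>\<omega>. nonaff (reg (f \<omega>)) (x \<omega>) (r \<omega>)) \<in> borel_measurable N"
    by (rule measurable_nonaff; measurable)
qed

lemma osc_cong: "(\<And>z. f z = g z) \<Longrightarrow> osc f x r = osc g x r"
  by (rule arg_cong[of f g "\<lambda>f. osc f x r"]) auto

lemma osc_flow_cong: "(\<And>i. s \<le> i \<Longrightarrow> i < s + n \<Longrightarrow> F i = G i) \<Longrightarrow> osc (flow F s n) x r = osc (flow G s n) x r"
  by (intro osc_cong flow_cong)

lemma nonaff_flow_cong: "(\<And>i. s \<le> i \<Longrightarrow> i < s + n \<Longrightarrow> F i = G i) \<Longrightarrow> nonaff (flow F s n) x r = nonaff (flow G s n) x r"
  by (rule arg_cong[of "flow F s n" "flow G s n" "\<lambda>f. nonaff f x r"]) (auto intro: flow_cong)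

section \<open>Composition along one sequence of continuous maps\<close>

context
  fixes F :: "nat \<Rightarrow> real ^ 'm \<Rightarrow> real ^ 'm"
  assumes cont: "\<And>i. continuous_on UNIV (F i)"
begin

lemma flow_in_cube:
  assumes "u \<in> unit_cube"
  obtains w where "w \<in> unit_cube" "flow F s n (x + r *\<^sub>R u) = flow F s n x + rad F s n x r *\<^sub>R w"
proof -
  have "\<exists>w\<in>unit_cube. flow F s n (x + r *\<^sub>R u) = flow F s n x + rad F s n x r *\<^sub>R w"
  proof (induction n)
    case 0
    then show ?case using assms by auto
  next
    case (Suc n)
    then obtain w where w: "w \<in> unit_cube" "flow F s n (x + r *\<^sub>R u) = flow F s n x + rad F s n x r *\<^sub>R w" by blast
    have "norm (F (s + n) (flow F s n x + rad F s n x r *\<^sub>R w) - F (s + n) (flow F s n x)) \<le> osc (F (s + n)) (flow F s n x) (rad F s n x r)"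
      by (rule le_osc[OF cont w(1)])
    then obtain w' where "w' \<in> unit_cube"
      "F (s + n) (flow F s n x + rad F s n x r *\<^sub>R w) - F (s + n) (flow F s n x) = osc (F (s + n)) (flow F s n x) (rad F s n x r) *\<^sub>R w'"
      by (rule scaled_cubeE)
    then show ?case by (intro bexI[of _ w']) (auto simp: reg_continuous[OF cont] w(2) algebra_simps)
  qed
  then show ?thesis using that by blast
qed

lemma osc_flow_add_le: "osc (flow F s (n + j)) x r \<le> osc (flow F (s + n) j) (flow F s n x) (rad F s n x r)"
proof (rule osc_le)
  fix u :: "real ^ 'm" assume "u \<in> unit_cube"
  then obtain w where w: "w \<in> unit_cube" "flow F s n (x + r *\<^sub>R u) = flow F s n x + rad F s n x r *\<^sub>R w"
    by (rule flow_in_cube)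
  show "norm (flow F s (n + j) (x + r *\<^sub>R u) - flow F s (n + j) x) \<le> osc (flow F (s + n) j) (flow F s n x) (rad F s n x r)"
    unfolding flow_add w(2) by (rule le_osc[OF continuous_flow[OF cont] w(1)])
qed simp

lemma osc_flow_le_rad: "n > 0 \<Longrightarrow> osc (flow F s n) x r \<le> rad F s n x r"
proof (cases n)
  case (Suc k)
  have "osc (flow F s (k + 1)) x r \<le> osc (flow F (s + k) 1) (flow F s k x) (rad F s k x r)"
    by (rule osc_flow_add_le)
  also have "\<dots> = rad F s (Suc k) x r" by simp (rule osc_cong, simp)
  finally show ?thesis by (simp add: Suc)
qed simp

text \<open>On the cube of radius \<rho> around \<open>y\<close>, the increment of \<open>f\<close>
  is a linear map \<open>L\<close> of the cube coordinate plus a defect. By linearity,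
  \<open>L\<close> contributes to the new defect its value at the old defect divided by \<rho>. The
  old defect belongs to the past, and \<open>osc f y \<rho> / \<rho>\<close> has bounded mean given
  the past, so the bound can be iterated.\<close>

lemma nonaff_flow_Suc_le:
  fixes s n x r
  defines "f \<equiv> F (s + n)" and "y \<equiv> flow F s n x" and "\<rho> \<equiv> rad F s n x r"
  assumes r: "r \<ge> 0"
  shows "nonaff (flow F s (Suc n)) x r \<le>
    real CARD('m) * (osc f y \<rho> / \<rho>) * nonaff (flow F s n) x r + (1 + real CARD('m)) * nonaff f y \<rho>"
proof (rule nonaff_le)
  fix u :: "real ^ 'm" assume u: "u \<in> unit_cube"
  have f: "continuous_on UNIV f" unfolding f_def by (rule cont)
  have \<rho>: "\<rho> \<ge> 0" unfolding \<rho>_def by (rule rad_nonneg[OF r])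
  obtain w where w: "w \<in> unit_cube" "flow F s n (x + r *\<^sub>R u) = y + \<rho> *\<^sub>R w"
    unfolding y_def \<rho>_def by (rule flow_in_cube[OF u])
  have "\<exists>w\<in>unit_cube. flow F s n (x + r *\<^sub>R axis j 1) = y + \<rho> *\<^sub>R w" for j
    unfolding y_def \<rho>_def using flow_in_cube[OF axis_unit_cube] by metis
  then obtain wj where wj: "\<And>j. wj j \<in> unit_cube" "\<And>j. flow F s n (x + r *\<^sub>R axis j 1) = y + \<rho> *\<^sub>R wj j"
    by metis
  define d where "d i = f (y + \<rho> *\<^sub>R axis i 1) - f y" for i
  define L where "L v = (\<Sum>i\<in>UNIV. v $ i *\<^sub>R d i)" for v :: "real ^ 'm"
  have fw: "f (y + \<rho> *\<^sub>R v) - f y = L v + affine_defect f y \<rho> v" for v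
    by (simp add: affine_defect_def L_def d_def)
  \<comment> \<open>Measures how far the cube coordinates are from depending linearly on
    \<open>u\<close>; \<rho> times it is the old defect.\<close>
  define v where "v = w - (\<Sum>j\<in>UNIV. u $ j *\<^sub>R wj j)"
  have Lv: "L v = L w - (\<Sum>j\<in>UNIV. u $ j *\<^sub>R L (wj j))"
  proof -
    have "(\<Sum>i\<in>UNIV. (\<Sum>j\<in>UNIV. u $ j * wj j $ i) *\<^sub>R d i) = (\<Sum>j\<in>UNIV. u $ j *\<^sub>R (\<Sum>i\<in>UNIV. wj j $ i *\<^sub>R d i))"
      unfolding scaleR_sum_left scaleR_sum_right by (subst sum.swap) (simp add: mult.commute)
    then show ?thesis by (simp add: L_def v_def scaleR_diff_left sum_subtractf)
  qed
  have \<rho>v: "\<rho> *\<^sub>R v = affine_defect (flow F s n) x r u"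
    unfolding affine_defect_def w(2) wj(2) v_def
    by (simp add: y_def scaleR_diff_right scaleR_sum_right mult.commute)
  have "affine_defect (flow F s (Suc n)) x r u = f (y + \<rho> *\<^sub>R w) - f y - (\<Sum>j\<in>UNIV. u $ j *\<^sub>R (f (y + \<rho> *\<^sub>R wj j) - f y))"
    unfolding affine_defect_def flow.simps w(2) wj(2) reg_continuous[OF cont]
    by (simp add: f_def y_def)
  also have "\<dots> = L v + affine_defect f y \<rho> w - (\<Sum>j\<in>UNIV. u $ j *\<^sub>R affine_defect f y \<rho> (wj j))"
    unfolding fw Lv by (simp add: scaleR_add_right sum.distrib)
  finally have eq: "affine_defect (flow F s (Suc n)) x r u = \<dots>" .
  have 1: "norm (L v) \<le> real CARD('m) * (osc f y \<rho> / \<rho>) * nonaff (flow F s n) x r"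
  proof (cases "\<rho> = 0")
    \<comment> \<open>Division by zero makes the right side 0; \<open>L\<close> vanishes too, its
      columns being increments over distance 0.\<close>
    case True
    then show ?thesis by (simp add: L_def d_def)
  next
    case False
    have nv: "\<bar>v $ i\<bar> \<le> nonaff (flow F s n) x r / \<rho>" for i
    proof -
      have "\<rho> * \<bar>v $ i\<bar> = \<bar>(\<rho> *\<^sub>R v) $ i\<bar>" using \<rho> by (simp add: abs_mult)
      also have "\<dots> \<le> nonaff (flow F s n) x r"
        unfolding \<rho>v using component_le_norm_cart le_nonaff[OF continuous_flow[OF cont] u] by (rule order_trans)
      finally show ?thesis using False \<rho> by (simp add: pos_le_divide_eq mult.commute)
    qed
    have "norm (L v) \<le> (\<Sum>i\<in>(UNIV :: 'm set). (nonaff (flow F s n) x r / \<rho>) * osc f y \<rho>)"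
      unfolding L_def
    proof (rule sum_norm_le)
      fix i
      show "norm (v $ i *\<^sub>R d i) \<le> (nonaff (flow F s n) x r / \<rho>) * osc f y \<rho>"
        unfolding norm_scaleR d_def using \<rho> by (intro mult_mono nv le_osc[OF f axis_unit_cube]) auto
    qed
    then show ?thesis by (simp add: mult_ac)
  qed
  have 2: "norm (affine_defect f y \<rho> w) \<le> nonaff f y \<rho>" by (rule le_nonaff[OF f w(1)])
  have 3: "norm (\<Sum>j\<in>UNIV. u $ j *\<^sub>R affine_defect f y \<rho> (wj j)) \<le> (\<Sum>j\<in>(UNIV :: 'm set). 1 * nonaff f y \<rho>)"
  proof (rule sum_norm_le)
    fix j
    show "norm (u $ j *\<^sub>R affine_defect f y \<rho> (wj j)) \<le> 1 * nonaff f y \<rho>"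
      unfolding norm_scaleR using u by (intro mult_mono le_nonaff[OF f wj(1)]) auto
  qed
  show "norm (affine_defect (flow F s (Suc n)) x r u) \<le>
    real CARD('m) * (osc f y \<rho> / \<rho>) * nonaff (flow F s n) x r + (1 + real CARD('m)) * nonaff f y \<rho>"
    unfolding eq
    using 1 2 3 norm_triangle_ineq4[of "L v + affine_defect f y \<rho> w" "\<Sum>j\<in>UNIV. u $ j *\<^sub>R affine_defect f y \<rho> (wj j)"]
      norm_triangle_ineq[of "L v" "affine_defect f y \<rho> w"]
    by (simp add: distrib_right)
next
  have "\<rho> \<ge> 0" unfolding \<rho>_def by (rule rad_nonneg[OF r])
  then show "0 \<le> real CARD('m) * (osc f y \<rho> / \<rho>) * nonaff (flow F s n) x r + (1 + real CARD('m)) * nonaff f y \<rho>"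
    by simp
qed

end

lemma osc_le_axes:
  fixes f :: "real ^ 'm \<Rightarrow> real ^ 'm"
  assumes "continuous_on UNIV f"
  shows "osc f x r \<le> (\<Sum>j\<in>UNIV. norm (f (x + r *\<^sub>R axis j 1) - f x)) + nonaff f x r"
proof (rule osc_le)
  fix u :: "real ^ 'm" assume u: "u \<in> unit_cube"
  have "f (x + r *\<^sub>R u) - f x = (\<Sum>j\<in>UNIV. u $ j *\<^sub>R (f (x + r *\<^sub>R axis j 1) - f x)) + affine_defect f x r u"
    by (simp add: affine_defect_def)
  moreover have "norm (\<Sum>j\<in>UNIV. u $ j *\<^sub>R (f (x + r *\<^sub>R axis j 1) - f x)) \<le> (\<Sum>j\<in>UNIV. 1 * norm (f (x + r *\<^sub>R axis j 1) - f x))"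
  proof (rule sum_norm_le)
    fix j
    show "norm (u $ j *\<^sub>R (f (x + r *\<^sub>R axis j 1) - f x)) \<le> 1 * norm (f (x + r *\<^sub>R axis j 1) - f x)"
      unfolding norm_scaleR using u by (intro mult_right_mono) auto
  qed
  ultimately show "norm (f (x + r *\<^sub>R u) - f x) \<le> (\<Sum>j\<in>UNIV. norm (f (x + r *\<^sub>R axis j 1) - f x)) + nonaff f x r"
    using le_nonaff[OF assms u, of x r] norm_triangle_ineq[of "\<Sum>j\<in>UNIV. u $ j *\<^sub>R (f (x + r *\<^sub>R axis j 1) - f x)" "affine_defect f x r u"]
    by simp
qed (simp add: sum_nonneg)

lemma osc_mono:
  assumes "continuous_on UNIV f" "0 \<le> r" "r \<le> R"
  shows "osc f x r \<le> osc f x R"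
proof (rule osc_le)
  fix u :: "real ^ 'a" assume u: "u \<in> unit_cube"
  show "norm (f (x + r *\<^sub>R u) - f x) \<le> osc f x R"
  proof (cases "R = 0")
    case False
    then have R: "R > 0" using assms by linarith
    have "\<bar>r / R\<bar> * \<bar>u $ i\<bar> \<le> 1" for i using u assms R by (intro mult_le_one) auto
    then have "(r / R) *\<^sub>R u \<in> unit_cube" by (auto simp: abs_mult)
    from le_osc[OF assms(1) this, of x R] show ?thesis using R by simp
  qed (use assms in auto)
qed simp

section \<open>Means along the flow\<close>

context random_maps
begin

abbreviation maps :: "'w \<Rightarrow> nat \<Rightarrow> real ^ 'm \<Rightarrow> real ^ 'm" where
  "maps \<omega> \<equiv> (\<lambda>i. \<xi> i \<omega>)"

lemma measurable_maps [measurable]: "maps \<in> measurable M (PiM UNIV (\<lambda>_. fun_sigma))"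
  by (rule measurable_PiM_single') (auto simp: space_PiM)

lemma maps_continuous: "\<omega> \<in> space M \<Longrightarrow> continuous_on UNIV (maps \<omega> i)"
  by (rule continuous)

lemma freeze:
  assumes G: "G \<in> measurable (PiM UNIV (\<lambda>_. fun_sigma)) N"
    and G_past: "\<And>F F'. (\<And>i. i < t \<Longrightarrow> F i = F' i) \<Longrightarrow> G F = G F'"
    and h: "(\<lambda>p. h (fst p) (snd p)) \<in> borel_measurable (PiM UNIV (\<lambda>_. fun_sigma) \<Otimes>\<^sub>M N)"
    and h_future: "\<And>F F' y. (\<And>i. i \<ge> t \<Longrightarrow> F i = F' i) \<Longrightarrow> h F y = h F' y"
    and k: "k \<in> borel_measurable N" and Pm: "Measurable.pred N P"
    and le: "\<And>y. y \<in> space N \<Longrightarrow> P y \<Longrightarrow> (\<integral>\<^sup>+\<omega>. h (maps \<omega>) y \<partial>M) \<le> k y"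
    and P: "\<And>\<omega>. \<omega> \<in> space M \<Longrightarrow> P (G (maps \<omega>))"
  shows "(\<integral>\<^sup>+\<omega>. h (maps \<omega>) (G (maps \<omega>)) \<partial>M) \<le> (\<integral>\<^sup>+\<omega>. k (G (maps \<omega>)) \<partial>M)"
proof -
  have "(\<integral>\<^sup>+\<omega>. h (maps \<omega>) (G (maps \<omega>)) \<partial>M) \<le> (\<integral>\<^sup>+\<omega>. (if P (G (maps \<omega>)) then k (G (maps \<omega>)) else top) \<partial>M)"
  proof (rule nn_integral_freeze_le[OF indep G G_past _ h_future])
    show "(\<lambda>(F, y). h F y) \<in> borel_measurable (PiM UNIV (\<lambda>_. fun_sigma) \<Otimes>\<^sub>M N)"
      using h by (simp add: case_prod_beta')
    show "(\<lambda>y. if P y then k y else top) \<in> borel_measurable N"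
      using k Pm by measurable
    show "(\<integral>\<^sup>+\<omega>. h (maps \<omega>) y \<partial>M) \<le> (if P y then k y else top)" if "y \<in> space N" for y
      using le[OF that] by simp
  qed
  also have "\<dots> = (\<integral>\<^sup>+\<omega>. k (G (maps \<omega>)) \<partial>M)" using P by (intro nn_integral_cong) simp
  finally show ?thesis .
qed

definition growth :: real where "growth = 1 + moment_const"

lemma growth_ge_1: "1 \<le> growth"
  using moment_const_nonneg by (simp add: growth_def)

text \<open>The bound expands by \<open>growth\<close> at every step, so it serves for a number of
  steps fixed in advance. Orders 1 and 2 match the two terms of the bound in
  \<open>nonaff_mean\<close>.\<close>

lemma rad_moment:
  assumes r: "r \<ge> 0" and j: "0 < j" "j \<le> 2"
  shows "nnexp (\<lambda>\<omega>. rad (maps \<omega>) s n x r ^ j) \<le> ennreal (growth ^ n * r ^ j)"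
proof (induction n)
  case 0
  show ?case by (simp add: emeasure_space_1)
next
  case (Suc n)
  have "nnexp (\<lambda>\<omega>. rad (maps \<omega>) s (Suc n) x r ^ j)
      = (\<integral>\<^sup>+\<omega>. (\<lambda>F p. ennreal (osc (reg (F (s + n))) (fst p) (snd p) ^ j)) (maps \<omega>) (flow (maps \<omega>) s n x, rad (maps \<omega>) s n x r) \<partial>M)"
    by simp
  also have "\<dots> \<le> (\<integral>\<^sup>+\<omega>. (\<lambda>p. ennreal growth * ennreal (snd p ^ j)) (flow (maps \<omega>) s n x, rad (maps \<omega>) s n x r) \<partial>M)"
  proof (rule freeze[where N="borel \<Otimes>\<^sub>M borel" and t="s + n" and P="\<lambda>p. 0 \<le> snd p" and
        G="\<lambda>F. (flow F s n x, rad F s n x r)"])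
    fix p :: "(real ^ 'm) \<times> real" assume "0 \<le> snd p"
    then show "nnexp (\<lambda>\<omega>. osc (reg (maps \<omega> (s + n))) (fst p) (snd p) ^ j) \<le> ennreal growth * ennreal (snd p ^ j)"
      using osc_low_moment[of "snd p" j "s + n" "fst p"] j growth_ge_1
      by (simp add: reg_random_map growth_def ennreal_mult' cong: nn_integral_cong)
  next
    fix F F' :: "nat \<Rightarrow> real ^ 'm \<Rightarrow> real ^ 'm" assume "\<And>i. i < s + n \<Longrightarrow> F i = F' i"
    then show "(flow F s n x, rad F s n x r) = (flow F' s n x, rad F' s n x r)"
      by (auto intro!: flow_cong rad_cong)
  next
    show "(\<lambda>p. ennreal (osc (reg (fst p (s + n))) (fst (snd p)) (snd (snd p)) ^ j))
      \<in> borel_measurable (PiM UNIV (\<lambda>_. fun_sigma) \<Otimes>\<^sub>M (borel \<Otimes>\<^sub>M borel))"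
      by measurable
  qed (auto simp: rad_nonneg r)
  also have "\<dots> = ennreal growth * nnexp (\<lambda>\<omega>. rad (maps \<omega>) s n x r ^ j)"
    by (simp add: nn_integral_cmult)
  also have "\<dots> \<le> ennreal growth * ennreal (growth ^ n * r ^ j)" by (intro mult_left_mono Suc.IH) simp
  also have "\<dots> = ennreal (growth ^ Suc n * r ^ j)" using growth_ge_1 r by (simp add: ennreal_mult' mult.assoc)
  finally show ?case .
qed

lemma rad_drift:
  "\<exists>b'\<ge>0. \<forall>s x. \<forall>r\<ge>0. \<forall>n. nnexp (\<lambda>\<omega>. rad (maps \<omega>) s n x r) \<le> ennreal (r / 2 ^ n + b')"
proof -
  obtain b' where b': "b' \<ge> 0"
    "\<And>n x r. r \<ge> 0 \<Longrightarrow> nnexp (\<lambda>\<omega>. osc (\<xi> n \<omega>) x r) \<le> ennreal (b' + r / 2)"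
    using osc_drift by blast
  \<comment> \<open>\<open>2 * b'\<close> solves \<open>t = b' + t / 2\<close>, so the offset is
    preserved while the initial radius is halved at every step.\<close>
  have "nnexp (\<lambda>\<omega>. rad (maps \<omega>) s n x r) \<le> ennreal (r / 2 ^ n + 2 * b')" if r: "r \<ge> 0" for s x r n
  proof (induction n)
    case 0
    show ?case using b' r by (simp add: emeasure_space_1)
  next
    case (Suc n)
    have "nnexp (\<lambda>\<omega>. rad (maps \<omega>) s (Suc n) x r)
        = (\<integral>\<^sup>+\<omega>. (\<lambda>F p. ennreal (osc (reg (F (s + n))) (fst p) (snd p))) (maps \<omega>) (flow (maps \<omega>) s n x, rad (maps \<omega>) s n x r) \<partial>M)"
      by simp
    also have "\<dots> \<le> (\<integral>\<^sup>+\<omega>. (\<lambda>p. ennreal (b' + snd p / 2)) (flow (maps \<omega>) s n x, rad (maps \<omega>) s n x r) \<partial>M)"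
    proof (rule freeze[where N="borel \<Otimes>\<^sub>M borel" and t="s + n" and P="\<lambda>p. 0 \<le> snd p" and
          G="\<lambda>F. (flow F s n x, rad F s n x r)"])
      fix p :: "(real ^ 'm) \<times> real" assume "0 \<le> snd p"
      then show "nnexp (\<lambda>\<omega>. osc (reg (maps \<omega> (s + n))) (fst p) (snd p)) \<le> ennreal (b' + snd p / 2)"
        using b'(2)[of "snd p" "s + n" "fst p"] by (simp add: reg_random_map cong: nn_integral_cong)
    next
      fix F F' :: "nat \<Rightarrow> real ^ 'm \<Rightarrow> real ^ 'm" assume "\<And>i. i < s + n \<Longrightarrow> F i = F' i"
      then show "(flow F s n x, rad F s n x r) = (flow F' s n x, rad F' s n x r)"
        by (auto intro!: flow_cong rad_cong)
    next
      show "(\<lambda>p. ennreal (osc (reg (fst p (s + n))) (fst (snd p)) (snd (snd p))))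
        \<in> borel_measurable (PiM UNIV (\<lambda>_. fun_sigma) \<Otimes>\<^sub>M (borel \<Otimes>\<^sub>M borel))"
        by measurable
    qed (auto simp: rad_nonneg r)
    also have "\<dots> \<le> ennreal (b' + 1/2 * (r / 2 ^ n + 2 * b'))"
      by (rule nn_integral_affine_le[where X="\<lambda>\<omega>. rad (maps \<omega>) s n x r", OF _ prob_space_axioms])
        (use b' r Suc.IH rad_nonneg[OF r] in auto)
    also have "b' + 1/2 * (r / 2 ^ n + 2 * b') = r / 2 ^ Suc n + 2 * b'" by simp
    finally show ?case .
  qed
  then show ?thesis using b'(1) by (intro exI[of _ "2 * b'"]) auto
qed

lemma pair_contraction:
  "nnexp (\<lambda>\<omega>. (norm (flow (maps \<omega>) s n y - flow (maps \<omega>) s n z))\<^sup>2) \<le> ennreal (\<kappa> ^ n * (norm (y - z))\<^sup>2)"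
proof (induction n)
  case 0
  show ?case by (simp add: emeasure_space_1)
next
  case (Suc n)
  have "nnexp (\<lambda>\<omega>. (norm (flow (maps \<omega>) s (Suc n) y - flow (maps \<omega>) s (Suc n) z))\<^sup>2)
      = (\<integral>\<^sup>+\<omega>. (\<lambda>F p. ennreal ((norm (reg (F (s + n)) (fst p) - reg (F (s + n)) (snd p)))\<^sup>2)) (maps \<omega>) (flow (maps \<omega>) s n y, flow (maps \<omega>) s n z) \<partial>M)"
    by simp
  also have "\<dots> \<le> (\<integral>\<^sup>+\<omega>. (\<lambda>p. ennreal \<kappa> * ennreal ((norm (fst p - snd p))\<^sup>2)) (flow (maps \<omega>) s n y, flow (maps \<omega>) s n z) \<partial>M)"
  proof (rule freeze[where N="borel \<Otimes>\<^sub>M borel" and t="s + n" and P="\<lambda>p. True" and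
        G="\<lambda>F. (flow F s n y, flow F s n z)"])
    fix p :: "(real ^ 'm) \<times> (real ^ 'm)"
    show "nnexp (\<lambda>\<omega>. (norm (reg (maps \<omega> (s + n)) (fst p) - reg (maps \<omega> (s + n)) (snd p)))\<^sup>2) \<le> ennreal \<kappa> * ennreal ((norm (fst p - snd p))\<^sup>2)"
      using contraction[of "s + n" "fst p" "snd p"] \<kappa>(1) by (simp add: reg_random_map ennreal_mult' cong: nn_integral_cong)
  next
    fix F F' :: "nat \<Rightarrow> real ^ 'm \<Rightarrow> real ^ 'm" assume "\<And>i. i < s + n \<Longrightarrow> F i = F' i"
    then show "(flow F s n y, flow F s n z) = (flow F' s n y, flow F' s n z)"
      by (auto intro!: flow_cong)
  next
    show "(\<lambda>p. ennreal ((norm (reg (fst p (s + n)) (fst (snd p)) - reg (fst p (s + n)) (snd (snd p))))\<^sup>2))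
      \<in> borel_measurable (PiM UNIV (\<lambda>_. fun_sigma) \<Otimes>\<^sub>M (borel \<Otimes>\<^sub>M borel))"
      by measurable
  qed auto
  also have "\<dots> = ennreal \<kappa> * nnexp (\<lambda>\<omega>. (norm (flow (maps \<omega>) s n y - flow (maps \<omega>) s n z))\<^sup>2)"
    by (simp add: nn_integral_cmult)
  also have "\<dots> \<le> ennreal \<kappa> * ennreal (\<kappa> ^ n * (norm (y - z))\<^sup>2)" by (intro mult_left_mono Suc.IH) simp
  also have "\<dots> = ennreal (\<kappa> ^ Suc n * (norm (y - z))\<^sup>2)" using \<kappa>(1) by (simp add: ennreal_mult' mult.assoc)
  finally show ?case .
qed

text \<open>By \<open>nonaff_flow_Suc_le\<close> one step inflates the old error by
  \<open>m * growth\<close> and adds the defect of a map on a cube of mean radius up to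
  \<open>growth^n * r\<close>. Both factors are fixed for given \<open>n\<close>, so choosing
  smaller linear coefficients beforehand compensates for them.\<close>

lemma nonaff_flow_mean:
  "e > 0 \<Longrightarrow> \<exists>K'\<ge>0. \<forall>s x. \<forall>r\<ge>0. nnexp (\<lambda>\<omega>. nonaff (flow (maps \<omega>) s n) x r) \<le> ennreal (e * r + K' * r\<^sup>2)"
proof (induction n arbitrary: e)
  case 0
  have "nonaff (flow F s 0) x r = 0" for F :: "nat \<Rightarrow> real ^ 'm \<Rightarrow> real ^ 'm" and s x r
  proof -
    have "affine_defect (flow F s 0) x r u = 0" for u :: "real ^ 'm"
      by (simp add: affine_defect_def vec_eq_iff axis_def if_distrib cong: if_cong)
    then show ?thesis by (intro antisym nonaff_le) auto
  qed
  note * = this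
  show ?case
    by (intro exI[of _ 0]) (unfold *, simp)
next
  case (Suc n)
  let ?m = "real CARD('m)"
  \<comment> \<open>Chosen so that the old and the new error each contribute
    \<open>e / 2 * r\<close>.\<close>
  define e1 where "e1 = e / (2 * (?m * growth))"
  define e2 where "e2 = e / (2 * ((1 + ?m) * growth ^ n))"
  have pos: "e1 > 0" "e2 > 0" "growth > 0" using Suc.prems growth_ge_1 by (simp_all add: e1_def e2_def)
  obtain K1 where K1: "K1 \<ge> 0" "\<And>s x r. r \<ge> 0 \<Longrightarrow> nnexp (\<lambda>\<omega>. nonaff (flow (maps \<omega>) s n) x r) \<le> ennreal (e1 * r + K1 * r\<^sup>2)"
    using Suc.IH[OF pos(1)] by blast
  obtain K2 where K2: "K2 \<ge> 0" "\<And>n x r. r \<ge> 0 \<Longrightarrow> nnexp (\<lambda>\<omega>. nonaff (\<xi> n \<omega>) x r) \<le> ennreal (e2 * r + K2 * r\<^sup>2)"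
    using nonaff_mean[OF pos(2)] by blast
  define K' where "K' = ?m * growth * K1 + (1 + ?m) * growth ^ n * K2"
  have K': "K' \<ge> 0" using K1 K2 pos by (simp add: K'_def)
  have "nnexp (\<lambda>\<omega>. nonaff (flow (maps \<omega>) s (Suc n)) x r) \<le> ennreal (e * r + K' * r\<^sup>2)" if r: "r \<ge> 0" for s x r
  proof -
    let ?G = "\<lambda>F. (flow F s n x, rad F s n x r, nonaff (flow F s n) x r)"
    define h where "h f y \<rho> A = ?m * (osc f y \<rho> / \<rho>) * A + (1 + ?m) * nonaff f y \<rho>" for f :: "real ^ 'm \<Rightarrow> real ^ 'm" and y \<rho> A
    have "nnexp (\<lambda>\<omega>. nonaff (flow (maps \<omega>) s (Suc n)) x r)
        \<le> (\<integral>\<^sup>+\<omega>. (\<lambda>F p. ennreal (h (reg (F (s + n))) (fst p) (fst (snd p)) (snd (snd p)))) (maps \<omega>) (?G (maps \<omega>)) \<partial>M)"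
      using nonaff_flow_Suc_le[of "maps _" r s n x, OF maps_continuous r]
      by (intro nn_integral_mono ennreal_leI) (simp add: h_def reg_random_map del: flow.simps)
    also have "\<dots> \<le> (\<integral>\<^sup>+\<omega>. (\<lambda>p. ennreal (?m * growth * snd (snd p) + (1 + ?m) * (e2 * fst (snd p) + K2 * (fst (snd p))\<^sup>2))) (?G (maps \<omega>)) \<partial>M)"
    proof (rule freeze[where N="borel \<Otimes>\<^sub>M (borel \<Otimes>\<^sub>M borel)" and t="s + n" and P="\<lambda>p. 0 \<le> fst (snd p) \<and> 0 \<le> snd (snd p)" and G="?G"])
      fix p :: "(real ^ 'm) \<times> real \<times> real" assume p: "0 \<le> fst (snd p) \<and> 0 \<le> snd (snd p)"
      obtain y \<rho> A where p_eq: "p = (y, \<rho>, A)" by (cases p) auto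
      have \<rho>: "\<rho> \<ge> 0" "A \<ge> 0" using p by (auto simp: p_eq)
      have 1: "nnexp (\<lambda>\<omega>. ?m * (osc (\<xi> (s + n) \<omega>) y \<rho> / \<rho>) * A) \<le> ennreal (0 + (?m / \<rho> * A) * (growth * \<rho>))"
        by (rule nn_integral_affine_le[where X="\<lambda>\<omega>. osc (\<xi> (s + n) \<omega>) y \<rho>", OF _ prob_space_axioms])
          (use osc_low_moment[of \<rho> 1 "s + n" y] \<rho> pos in \<open>auto simp: growth_def mult_ac\<close>)
      have "(?m / \<rho> * A) * (growth * \<rho>) \<le> ?m * growth * A" using \<rho> pos by (cases "\<rho> = 0") auto
      then have 1: "nnexp (\<lambda>\<omega>. ?m * (osc (\<xi> (s + n) \<omega>) y \<rho> / \<rho>) * A) \<le> ennreal (?m * growth * A)"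
        using order_trans[OF 1 ennreal_leI] by simp
      have 2: "nnexp (\<lambda>\<omega>. (1 + ?m) * nonaff (\<xi> (s + n) \<omega>) y \<rho>) \<le> ennreal (0 + (1 + ?m) * (e2 * \<rho> + K2 * \<rho>\<^sup>2))"
        by (rule nn_integral_affine_le[OF _ prob_space_axioms _ _ _ _ _ K2(2)]) (use \<rho> pos K2 in auto)
      have "nnexp (\<lambda>\<omega>. h (\<xi> (s + n) \<omega>) y \<rho> A) \<le> ennreal (?m * growth * A + (0 + (1 + ?m) * (e2 * \<rho> + K2 * \<rho>\<^sup>2)))"
        by (rule nn_integral_add_le[OF _ _ 1 2]) (use \<rho> pos K2 in \<open>auto simp: h_def\<close>)
      then show "nnexp (\<lambda>\<omega>. h (reg (maps \<omega> (s + n))) (fst p) (fst (snd p)) (snd (snd p)))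
        \<le> ennreal (?m * growth * snd (snd p) + (1 + ?m) * (e2 * fst (snd p) + K2 * (fst (snd p))\<^sup>2))"
        by (simp add: p_eq reg_random_map cong: nn_integral_cong)
    next
      fix F F' :: "nat \<Rightarrow> real ^ 'm \<Rightarrow> real ^ 'm" assume "\<And>i. i < s + n \<Longrightarrow> F i = F' i"
      then show "?G F = ?G F'"
        by (auto intro!: flow_cong rad_cong nonaff_flow_cong)
    next
      show "(\<lambda>p. ennreal (h (reg (fst p (s + n))) (fst (snd p)) (fst (snd (snd p))) (snd (snd (snd p)))))
        \<in> borel_measurable (PiM UNIV (\<lambda>_. fun_sigma) \<Otimes>\<^sub>M (borel \<Otimes>\<^sub>M (borel \<Otimes>\<^sub>M borel)))"
        unfolding h_def by measurable
    qed (auto simp: rad_nonneg r)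
    also have "\<dots> \<le> ennreal ((0 + (?m * growth) * (e1 * r + K1 * r\<^sup>2)) + (0 + (1 + ?m) * ((0 + e2 * (growth ^ n * r ^ 1)) + (0 + K2 * (growth ^ n * r\<^sup>2)))))"
    proof (rule nn_integral_add_le[where X="\<lambda>\<omega>. (?m * growth) * nonaff (flow (maps \<omega>) s n) x r"
          and Z="\<lambda>\<omega>. (1 + ?m) * (e2 * rad (maps \<omega>) s n x r + K2 * (rad (maps \<omega>) s n x r)\<^sup>2)"])
      show "nnexp (\<lambda>\<omega>. (?m * growth) * nonaff (flow (maps \<omega>) s n) x r) \<le> ennreal (0 + (?m * growth) * (e1 * r + K1 * r\<^sup>2))"
        by (rule nn_integral_affine_le[OF _ prob_space_axioms _ _ _ _ _ K1(2)]) (use r pos K1 in auto)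
      have 1: "nnexp (\<lambda>\<omega>. e2 * rad (maps \<omega>) s n x r) \<le> ennreal (0 + e2 * (growth ^ n * r ^ 1))"
        by (rule nn_integral_affine_le[where X="\<lambda>\<omega>. rad (maps \<omega>) s n x r", OF _ prob_space_axioms])
          (use r pos rad_moment[of r 1 s n x] rad_nonneg[OF r] in auto)
      have 2: "nnexp (\<lambda>\<omega>. K2 * (rad (maps \<omega>) s n x r)\<^sup>2) \<le> ennreal (0 + K2 * (growth ^ n * r\<^sup>2))"
        by (rule nn_integral_affine_le[where X="\<lambda>\<omega>. (rad (maps \<omega>) s n x r)\<^sup>2", OF _ prob_space_axioms])
          (use r pos K2 rad_moment[of r 2 s n x] in auto)
      have 3: "nnexp (\<lambda>\<omega>. e2 * rad (maps \<omega>) s n x r + K2 * (rad (maps \<omega>) s n x r)\<^sup>2)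
        \<le> ennreal ((0 + e2 * (growth ^ n * r ^ 1)) + (0 + K2 * (growth ^ n * r\<^sup>2)))"
        by (rule nn_integral_add_le[OF _ _ 1 2]) (use r pos K2 rad_nonneg[OF r] in \<open>auto intro!: add_nonneg_nonneg mult_nonneg_nonneg\<close>)
      show "nnexp (\<lambda>\<omega>. (1 + ?m) * (e2 * rad (maps \<omega>) s n x r + K2 * (rad (maps \<omega>) s n x r)\<^sup>2))
        \<le> ennreal (0 + (1 + ?m) * ((0 + e2 * (growth ^ n * r ^ 1)) + (0 + K2 * (growth ^ n * r\<^sup>2))))"
        by (rule nn_integral_affine_le[OF _ prob_space_axioms _ _ _ _ _ 3]) (use r pos K2 rad_nonneg[OF r] in \<open>auto intro!: add_nonneg_nonneg mult_nonneg_nonneg\<close>)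
    qed (use r pos K1 K2 rad_nonneg[OF r] in \<open>auto intro!: add_nonneg_nonneg mult_nonneg_nonneg\<close>)
    also have "(0 + (?m * growth) * (e1 * r + K1 * r\<^sup>2)) + (0 + (1 + ?m) * ((0 + e2 * (growth ^ n * r ^ 1)) + (0 + K2 * (growth ^ n * r\<^sup>2)))) = e * r + K' * r\<^sup>2"
    proof -
      have *: "(?m * growth) * e1 = e / 2" "((1 + ?m) * growth ^ n) * e2 = e / 2"
        using pos by (simp_all add: e1_def e2_def add_pos_pos[THEN less_imp_neq, symmetric])
      have "((?m * growth) * e1) * r + (((1 + ?m) * growth ^ n) * e2) * r = e * r" unfolding * by simp
      then show ?thesis by (simp add: K'_def algebra_simps)
    qed
    finally show ?thesis .
  qed
  then show ?case using K' by blast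
qed

text \<open>The order of choice matters: \<open>N\<close> makes the axis increments small through
  \<kappa>^N, then the affine error of the \<open>N\<close>-step flow fixes \<open>K'\<close>, and
  only then \<open>r0\<close> is taken.\<close>

lemma block_contraction:
  "\<exists>N>0. \<exists>r0>0. \<forall>s x r. 0 \<le> r \<longrightarrow> r \<le> r0 \<longrightarrow>
     nnexp (\<lambda>\<omega>. osc (flow (maps \<omega>) s N) x r) \<le> ennreal (r / 2)"
proof -
  let ?m = "real CARD('m)"
  \<comment> \<open>Each of the \<open>m\<close> axis increments has mean at most
    \<open>2 * e * r\<close>, in total \<open>r / 8\<close>; with \<open>r / 8\<close> for the
    linear and \<open>r / 4\<close> for the quadratic part of the affine error this stays within
    \<open>r / 2\<close>.\<close>
  define e where "e = 1 / (16 * ?m)"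
  have e: "e > 0" by (simp add: e_def)
  obtain N0 where N0: "\<kappa> ^ N0 < e * e" using real_arch_pow_inv[of "e * e" \<kappa>] e \<kappa> by auto
  \<comment> \<open>The successor makes the block nonempty.\<close>
  define N where "N = Suc N0"
  have "\<kappa> ^ N \<le> \<kappa> ^ N0" unfolding N_def using \<kappa> by (intro power_decreasing) auto
  then have N: "\<kappa> ^ N \<le> e * e" "N > 0" using N0 by (auto simp: N_def)
  obtain K' where K': "K' \<ge> 0" "\<And>s x r. r \<ge> 0 \<Longrightarrow> nnexp (\<lambda>\<omega>. nonaff (flow (maps \<omega>) s N) x r) \<le> ennreal (1/8 * r + K' * r\<^sup>2)"
    using nonaff_flow_mean[of "1/8" N] by auto
  define r0 where "r0 = 1 / (4 * (K' + 1))"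
  have r0: "r0 > 0" using K' by (simp add: r0_def)
  have "nnexp (\<lambda>\<omega>. osc (flow (maps \<omega>) s N) x r) \<le> ennreal (r / 2)" if r: "0 \<le> r" "r \<le> r0" for s x r
  proof (cases "r = 0")
    case False
    then have r_pos: "r > 0" using r by simp
    define D where "D j \<omega> = norm (flow (maps \<omega>) s N (x + r *\<^sub>R axis j 1) - flow (maps \<omega>) s N x)" for j \<omega>
    have D [measurable]: "D j \<in> borel_measurable M" for j unfolding D_def by measurable
    have Dj: "nnexp (\<lambda>\<omega>. D j \<omega>) \<le> ennreal (2 * e * r)" for j
    proof -
      have "nnexp (\<lambda>\<omega>. D j \<omega>) \<le> ennreal (e * r + 1 / (e * r) * (\<kappa> ^ N * r\<^sup>2))"
      proof (rule nn_integral_affine_le[where X="\<lambda>\<omega>. (D j \<omega>)\<^sup>2", OF _ prob_space_axioms])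
        show "D j \<omega> \<le> e * r + 1 / (e * r) * (D j \<omega>)\<^sup>2" for \<omega>
          using power_le_scaled_power[of "e * r" "D j \<omega>" 1 2] e r_pos by (simp add: D_def)
        show "nnexp (\<lambda>\<omega>. (D j \<omega>)\<^sup>2) \<le> ennreal (\<kappa> ^ N * r\<^sup>2)"
          using pair_contraction[of s N "x + r *\<^sub>R axis j 1" x] by (simp add: D_def norm_axis_1)
      qed (use e r_pos \<kappa> in auto)
      also have "\<dots> \<le> ennreal (2 * e * r)"
      proof (rule ennreal_leI)
        have "1 / (e * r) * (\<kappa> ^ N * r\<^sup>2) \<le> 1 / (e * r) * ((e * e) * r\<^sup>2)"
          using N e r_pos by (intro mult_left_mono mult_right_mono) auto
        also have "\<dots> = e * r" using e r_pos by (simp add: power2_eq_square)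
        finally show "e * r + 1 / (e * r) * (\<kappa> ^ N * r\<^sup>2) \<le> 2 * e * r" by simp
      qed
      finally show ?thesis .
    qed
    have 1: "nnexp (\<lambda>\<omega>. \<Sum>j\<in>UNIV. D j \<omega>) \<le> ennreal (\<Sum>j\<in>(UNIV :: 'm set). 2 * e * r)"
      by (rule nn_integral_sum_le[OF D Dj]) (use e r_pos in \<open>auto simp: D_def\<close>)
    have "nnexp (\<lambda>\<omega>. osc (flow (maps \<omega>) s N) x r) \<le> ennreal ((\<Sum>j\<in>(UNIV :: 'm set). 2 * e * r) + (1/8 * r + K' * r\<^sup>2))"
    proof (rule nn_integral_add_le[OF _ _ 1 K'(2)[OF r(1)]])
      show "osc (flow (maps \<omega>) s N) x r \<le> (\<Sum>j\<in>UNIV. D j \<omega>) + nonaff (flow (maps \<omega>) s N) x r" if "\<omega> \<in> space M" for \<omega>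
        unfolding D_def by (rule osc_le_axes[OF continuous_flow[OF maps_continuous[OF that]]])
    qed (use K' r e in \<open>auto simp: D_def sum_nonneg\<close>)
    also have "\<dots> \<le> ennreal (r / 2)"
    proof (rule ennreal_leI)
      have "K' * r \<le> K' * r0" using K' r by (intro mult_left_mono) auto
      also have "\<dots> \<le> 1/4" using K' by (simp add: r0_def field_simps)
      finally have "K' * r * r \<le> 1/4 * r" using r by (intro mult_right_mono) auto
      moreover have "(\<Sum>j\<in>(UNIV :: 'm set). 2 * e * r) = r / 8" by (simp add: e_def)
      ultimately show "(\<Sum>j\<in>(UNIV :: 'm set). 2 * e * r) + (1/8 * r + K' * r\<^sup>2) \<le> r / 2"
        unfolding power2_eq_square mult.assoc[symmetric] by linarith
    qed
    finally show ?thesis .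
  qed simp
  then show ?thesis using N(2) r0 by blast
qed

end

section \<open>Synchronisation\<close>

text \<open>A limsup exists and is measurable for every sequence of maps, and can be compared across
  a restart; it is 0 exactly if the oscillation tends to 0.\<close>

definition lim_osc :: "(nat \<Rightarrow> real ^ 'm \<Rightarrow> real ^ 'm) \<Rightarrow> nat \<Rightarrow> real ^ 'm \<Rightarrow> real \<Rightarrow> ennreal" where
  "lim_osc F s x r = limsup (\<lambda>n. ennreal (osc (flow F s n) x r))"

lemma measurable_lim_osc [measurable (raw)]:
  assumes [measurable]: "F \<in> measurable N (PiM UNIV (\<lambda>_. fun_sigma))"
    "x \<in> borel_measurable N" "r \<in> borel_measurable N"
  shows "(\<lambda>\<omega>. lim_osc (F \<omega>) s (x \<omega>) (r \<omega>)) \<in> borel_measurable N"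
  unfolding lim_osc_def by measurable

lemma lim_osc_cong: "(\<And>i. s \<le> i \<Longrightarrow> F i = G i) \<Longrightarrow> lim_osc F s x r = lim_osc G s x r"
proof -
  assume "\<And>i. s \<le> i \<Longrightarrow> F i = G i"
  then have "osc (flow F s n) x r = osc (flow G s n) x r" for n by (intro osc_flow_cong)
  then show ?thesis by (simp only: lim_osc_def)
qed

lemma lim_osc_eq_0: "(\<lambda>n. osc (flow F s n) x r) \<longlonglongrightarrow> 0 \<Longrightarrow> lim_osc F s x r = 0"
  unfolding lim_osc_def by (intro lim_imp_Limsup) (auto simp: ennreal_tendsto_0_iff)

lemma lim_osc_0_tendsto: "lim_osc F s x r = 0 \<Longrightarrow> (\<lambda>n. osc (flow F s n) x r) \<longlonglongrightarrow> 0"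
  unfolding lim_osc_def by (drule tendsto_0_if_Limsup_eq_0_ennreal) (simp add: ennreal_tendsto_0_iff)

lemma lim_osc_step_le:
  assumes "\<And>i. continuous_on UNIV (F i)"
  shows "lim_osc F s x r \<le> lim_osc F (s + n) (flow F s n x) (rad F s n x r)"
proof -
  have "lim_osc F s x r = limsup (\<lambda>j. ennreal (osc (flow F s (j + n)) x r))"
    unfolding lim_osc_def by (rule limsup_shift_k[symmetric])
  also have "\<dots> \<le> lim_osc F (s + n) (flow F s n x) (rad F s n x r)"
    unfolding lim_osc_def using osc_flow_add_le[OF assms, where s=s and n=n]
    by (intro Limsup_mono always_eventually allI ennreal_leI) (simp add: add.commute)
  finally show ?thesis .
qed

text \<open>With this truncation at \<open>r0\<close> the mean is halved in every block.\<close>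

primrec block_rad :: "nat \<Rightarrow> real \<Rightarrow> (nat \<Rightarrow> real ^ 'm \<Rightarrow> real ^ 'm) \<Rightarrow> nat \<Rightarrow> nat \<Rightarrow> real ^ 'm \<Rightarrow> real \<Rightarrow> real" where
  "block_rad N r0 F s 0 x r = r"
| "block_rad N r0 F s (Suc k) x r =
     (if block_rad N r0 F s k x r \<le> r0
      then osc (flow F (s + k * N) N) (flow F s (k * N) x) (block_rad N r0 F s k x r) else 0)"

lemma block_rad_nonneg: "r \<ge> 0 \<Longrightarrow> block_rad N r0 F s k x r \<ge> 0"
  by (cases k) auto

lemma block_rad_cong: "(\<And>i. i < s + k * N \<Longrightarrow> F i = G i) \<Longrightarrow> block_rad N r0 F s k x r = block_rad N r0 G s k x r"
proof (induction k)
  case (Suc k)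
  have "flow F s (k * N) x = flow G s (k * N) x" using Suc.prems by (intro flow_cong) auto
  moreover have "osc (flow F (s + k * N) N) y \<rho> = osc (flow G (s + k * N) N) y \<rho>" for y \<rho>
    using Suc.prems by (intro osc_flow_cong) auto
  ultimately show ?case using Suc by simp
qed simp

lemma measurable_block_rad [measurable (raw)]:
  assumes [measurable]: "F \<in> measurable Q (PiM UNIV (\<lambda>_. fun_sigma))"
    "x \<in> borel_measurable Q" "r \<in> borel_measurable Q"
  shows "(\<lambda>\<omega>. block_rad N r0 (F \<omega>) s k (x \<omega>) (r \<omega>)) \<in> borel_measurable Q"
proof (induction k)
  case (Suc k)
  note Suc [measurable]
  show ?case by simp
qed simp

lemma flow_in_block_cube:
  fixes F :: "nat \<Rightarrow> real ^ 'm \<Rightarrow> real ^ 'm"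
  assumes cont: "\<And>i. continuous_on UNIV (F i)" and "\<And>k. block_rad N r0 F s k x r \<le> r0" and u: "u \<in> unit_cube"
  shows "\<exists>w\<in>unit_cube. flow F s (k * N) (x + r *\<^sub>R u) = flow F s (k * N) x + block_rad N r0 F s k x r *\<^sub>R w"
proof (induction k)
  case 0
  then show ?case using u by auto
next
  case (Suc k)
  then obtain w where w: "w \<in> unit_cube" "flow F s (k * N) (x + r *\<^sub>R u) = flow F s (k * N) x + block_rad N r0 F s k x r *\<^sub>R w" by blast
  let ?y = "flow F s (k * N) x" and ?\<rho> = "block_rad N r0 F s k x r" and ?f = "flow F (s + k * N) N"
  have "norm (?f (?y + ?\<rho> *\<^sub>R w) - ?f ?y) \<le> osc ?f ?y ?\<rho>"
    by (rule le_osc[OF continuous_flow[OF cont] w(1)])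
  then obtain w' where w': "w' \<in> unit_cube" "?f (?y + ?\<rho> *\<^sub>R w) - ?f ?y = osc ?f ?y ?\<rho> *\<^sub>R w'"
    by (rule scaled_cubeE)
  have Suc_eq: "flow F s (Suc k * N) z = ?f (flow F s (k * N) z)" for z
    using flow_add[of F s "k * N" N z] by (simp add: add.commute)
  have "block_rad N r0 F s (Suc k) x r = osc ?f ?y ?\<rho>" using assms(2)[of k] by simp
  moreover have "?f (?y + ?\<rho> *\<^sub>R w) = ?f ?y + osc ?f ?y ?\<rho> *\<^sub>R w'" using w'(2) by (metis add.commute diff_add_cancel)
  ultimately show ?case using w'(1) unfolding Suc_eq w(2) by metis
qed

lemma osc_flow_block_le:
  fixes F :: "nat \<Rightarrow> real ^ 'm \<Rightarrow> real ^ 'm"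
  assumes cont: "\<And>i. continuous_on UNIV (F i)" and "\<And>k. block_rad N r0 F s k x r \<le> r0"
  shows "osc (flow F s (k * N + j)) x r \<le> osc (flow F (s + k * N) j) (flow F s (k * N) x) (block_rad N r0 F s k x r)"
proof (rule osc_le)
  fix u :: "real ^ 'm" assume "u \<in> unit_cube"
  from flow_in_block_cube[OF assms this, of k]
  obtain w where w: "w \<in> unit_cube" "flow F s (k * N) (x + r *\<^sub>R u) = flow F s (k * N) x + block_rad N r0 F s k x r *\<^sub>R w" by blast
  show "norm (flow F s (k * N + j) (x + r *\<^sub>R u) - flow F s (k * N + j) x) \<le> osc (flow F (s + k * N) j) (flow F s (k * N) x) (block_rad N r0 F s k x r)"
    unfolding flow_add w(2) by (rule le_osc[OF continuous_flow[OF cont] w(1)])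
qed simp

lemma tendsto_0_blocks:
  fixes a :: "nat \<Rightarrow> real"
  assumes "N > 0" "\<And>n. a n \<ge> 0" "V \<longlonglongrightarrow> 0" "\<And>k j. j < N \<Longrightarrow> a (k * N + j) \<le> V k"
  shows "a \<longlonglongrightarrow> 0"
proof (rule tendsto_sandwich[OF _ _ tendsto_const])
  show "\<forall>\<^sub>F n in sequentially. a n \<le> V (n div N)"
    using assms(4)[of "_ mod N" "_ div N"] assms(1) by (intro always_eventually allI) (metis div_mult_mod_eq mod_less_divisor)
  have "filterlim (\<lambda>n. n div N) sequentially sequentially"
  proof (rule filterlim_at_top_mono[where f = "\<lambda>n. n div N", OF _ always_eventually], unfold filterlim_at_top, intro allI)
    fix Z
    show "\<forall>\<^sub>F n in sequentially. Z \<le> n div N"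
      using assms(1) by (intro eventually_sequentiallyI[of "Z * N"]) (simp add: less_eq_div_iff_mult_less_eq)
  qed simp
  then show "(\<lambda>n. V (n div N)) \<longlonglongrightarrow> 0" by (rule filterlim_compose[OF assms(3)])
qed (use assms in auto)

section \<open>Probability of not being contracted\<close>

context random_maps
begin

lemma block_rad_mean:
  assumes contr: "\<And>s x r. 0 \<le> r \<Longrightarrow> r \<le> r0 \<Longrightarrow> nnexp (\<lambda>\<omega>. osc (flow (maps \<omega>) s N) x r) \<le> ennreal (r / 2)"
    and r: "r \<ge> 0"
  shows "nnexp (\<lambda>\<omega>. block_rad N r0 (maps \<omega>) s k x r) \<le> ennreal (r * (1/2) ^ k)"
proof (induction k)
  case 0
  show ?case by (simp add: emeasure_space_1)
next
  case (Suc k)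
  let ?G = "\<lambda>F. (flow F s (k * N) x, block_rad N r0 F s k x r)"
  let ?h = "\<lambda>F p. ennreal (if snd p \<le> r0 then osc (flow F (s + k * N) N) (fst p) (snd p) else 0)"
  have "nnexp (\<lambda>\<omega>. block_rad N r0 (maps \<omega>) s (Suc k) x r) = (\<integral>\<^sup>+\<omega>. ?h (maps \<omega>) (?G (maps \<omega>)) \<partial>M)"
    by (simp only: block_rad.simps fst_conv snd_conv)
  also have "\<dots> \<le> (\<integral>\<^sup>+\<omega>. (\<lambda>p. ennreal (snd p / 2)) (?G (maps \<omega>)) \<partial>M)"
  proof (rule freeze[where N="borel \<Otimes>\<^sub>M borel" and t="s + k * N" and P="\<lambda>p. 0 \<le> snd p" and G="?G" and h="?h"])
    fix p :: "(real ^ 'm) \<times> real" assume "0 \<le> snd p"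
    then show "(\<integral>\<^sup>+\<omega>. ?h (maps \<omega>) p \<partial>M) \<le> ennreal (snd p / 2)"
      using contr[of "snd p"] by (cases "snd p \<le> r0") auto
  next
    fix F F' :: "nat \<Rightarrow> real ^ 'm \<Rightarrow> real ^ 'm" assume "\<And>i. i < s + k * N \<Longrightarrow> F i = F' i"
    then show "?G F = ?G F'" by (auto intro!: flow_cong block_rad_cong)
  next
    fix F F' :: "nat \<Rightarrow> real ^ 'm \<Rightarrow> real ^ 'm" and p :: "(real ^ 'm) \<times> real"
    assume "\<And>i. s + k * N \<le> i \<Longrightarrow> F i = F' i"
    then have "osc (flow F (s + k * N) N) y \<rho> = osc (flow F' (s + k * N) N) y \<rho>" for y \<rho>
      by (intro osc_flow_cong) auto
    then show "?h F p = ?h F' p" by simp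
  next
    show "(\<lambda>p. ?h (fst p) (snd p)) \<in> borel_measurable (PiM UNIV (\<lambda>_. fun_sigma) \<Otimes>\<^sub>M (borel \<Otimes>\<^sub>M borel))"
      by measurable
  qed (auto simp: block_rad_nonneg r)
  also have "\<dots> \<le> ennreal (0 + 1/2 * (r * (1/2) ^ k))"
    by (rule nn_integral_affine_le[where X="\<lambda>\<omega>. block_rad N r0 (maps \<omega>) s k x r", OF _ prob_space_axioms])
      (use r Suc.IH block_rad_nonneg[OF r] in auto)
  finally show ?case by simp
qed

text \<open>The summand \<open>m\<close> is for \<open>n = 0\<close>, where the Euclidean
  oscillation of the identity over a cube of half side \<open>r\<close> can exceed \<open>r\<close>;
  from \<open>n = 1\<close> on, \<open>rad\<close> dominates.\<close>

lemma osc_flow_mean: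
  assumes "r \<ge> 0"
  shows "nnexp (\<lambda>\<omega>. osc (flow (maps \<omega>) s n) x r) \<le> ennreal ((real CARD('m) + growth ^ n) * r)"
proof (cases "n = 0")
  case True
  have "osc (flow F s 0) x r \<le> real CARD('m) * r" for F :: "nat \<Rightarrow> real ^ 'm \<Rightarrow> real ^ 'm"
    using norm_unit_cube assms by (intro osc_le) (auto simp: mult.commute intro!: mult_left_mono)
  also have "\<dots> \<le> (real CARD('m) + growth ^ n) * r" using assms growth_ge_1 by (intro mult_right_mono) auto
  finally have "nnexp (\<lambda>\<omega>. osc (flow (maps \<omega>) s n) x r) \<le> nnexp (\<lambda>\<omega>. (real CARD('m) + growth ^ n) * r)"
    unfolding True by (intro nn_integral_mono ennreal_leI)
  then show ?thesis by (simp add: emeasure_space_1)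
next
  case False
  have "nnexp (\<lambda>\<omega>. osc (flow (maps \<omega>) s n) x r) \<le> nnexp (\<lambda>\<omega>. rad (maps \<omega>) s n x r ^ 1)"
    using False osc_flow_le_rad[OF maps_continuous] by (intro nn_integral_mono ennreal_leI) auto
  also have "\<dots> \<le> ennreal (growth ^ n * r ^ 1)" by (intro rad_moment assms) auto
  also have "\<dots> \<le> ennreal ((real CARD('m) + growth ^ n) * r)" using assms by (intro ennreal_leI) (simp add: distrib_right)
  finally show ?thesis .
qed

text \<open>The block radii have summable means, so by Markov's inequality they all stay within
  \<open>r0\<close> except with probability at most \<open>2 * r / r0\<close>. Off that event the
  truncation never acts and they majorise the flow at block times; \<open>V\<close> handles the
  times in between.\<close>

lemma local_stability:
  "\<exists>C\<ge>0. \<forall>s x. \<forall>r\<ge>0. emeasure M {\<omega> \<in> space M. lim_osc (maps \<omega>) s x r \<noteq> 0} \<le> ennreal (C * r)"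
proof -
  obtain N r0 where N: "N > 0" and r0: "r0 > 0" and contr:
    "\<And>s x r. 0 \<le> r \<Longrightarrow> r \<le> r0 \<Longrightarrow> nnexp (\<lambda>\<omega>. osc (flow (maps \<omega>) s N) x r) \<le> ennreal (r / 2)"
    using block_contraction by blast
  \<comment> \<open>Growth within one block, for the mean of \<open>V\<close>; the constant of the
    statement is \<open>2 / r0\<close>.\<close>
  define C where "C = (\<Sum>j<N. real CARD('m) + growth ^ j)"
  have C: "C \<ge> 0" unfolding C_def using growth_ge_1 by (intro sum_nonneg) auto
  have "emeasure M {\<omega> \<in> space M. lim_osc (maps \<omega>) s x r \<noteq> 0} \<le> ennreal (2 / r0 * r)" if r: "r \<ge> 0" for s x r
  proof -
    define \<rho> where "\<rho> k \<omega> = block_rad N r0 (maps \<omega>) s k x r" for k \<omega>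
    have \<rho> [measurable]: "\<rho> k \<in> borel_measurable M" for k unfolding \<rho>_def by measurable
    have \<rho>_nonneg: "\<rho> k \<omega> \<ge> 0" for k \<omega> unfolding \<rho>_def by (rule block_rad_nonneg[OF r])
    have \<rho>_mean: "nnexp (\<lambda>\<omega>. \<rho> k \<omega>) \<le> ennreal (r * (1/2) ^ k)" for k
      unfolding \<rho>_def using contr r by (rule block_rad_mean)
    \<comment> \<open>Bounds all oscillations inside block \<open>k\<close>. Its means are summable
      too, so it tends to 0 almost surely.\<close>
    define V where "V k \<omega> = (\<Sum>j<N. osc (flow (maps \<omega>) (s + k * N) j) (flow (maps \<omega>) s (k * N) x) (\<rho> k \<omega>))" for k \<omega>
    have V [measurable]: "V k \<in> borel_measurable M" for k unfolding V_def by measurable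
    have V_nonneg: "V k \<omega> \<ge> 0" for k \<omega> unfolding V_def by (intro sum_nonneg) auto
    have V_mean: "nnexp (\<lambda>\<omega>. V k \<omega>) \<le> ennreal (C * r * (1/2) ^ k)" for k
    proof -
      have "nnexp (\<lambda>\<omega>. V k \<omega>) \<le> ennreal (\<Sum>j<N. (real CARD('m) + growth ^ j) * (r * (1/2) ^ k))"
      proof (rule nn_integral_sum_le[where X="\<lambda>j \<omega>. osc (flow (maps \<omega>) (s + k * N) j) (flow (maps \<omega>) s (k * N) x) (\<rho> k \<omega>)"])
        fix j
        let ?G = "\<lambda>F. (flow F s (k * N) x, block_rad N r0 F s k x r)"
        let ?h = "\<lambda>F p. ennreal (osc (flow F (s + k * N) j) (fst p) (snd p))"
        have "(\<integral>\<^sup>+\<omega>. ?h (maps \<omega>) (?G (maps \<omega>)) \<partial>M) \<le> (\<integral>\<^sup>+\<omega>. (\<lambda>p. ennreal ((real CARD('m) + growth ^ j) * snd p)) (?G (maps \<omega>)) \<partial>M)"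
        proof (rule freeze[where N="borel \<Otimes>\<^sub>M borel" and t="s + k * N" and P="\<lambda>p. 0 \<le> snd p" and G="?G" and h="?h"])
          fix F F' :: "nat \<Rightarrow> real ^ 'm \<Rightarrow> real ^ 'm" assume "\<And>i. i < s + k * N \<Longrightarrow> F i = F' i"
          then show "?G F = ?G F'" by (auto intro!: flow_cong block_rad_cong)
        next
          fix F F' :: "nat \<Rightarrow> real ^ 'm \<Rightarrow> real ^ 'm" and p :: "(real ^ 'm) \<times> real"
          assume "\<And>i. s + k * N \<le> i \<Longrightarrow> F i = F' i"
          then have "osc (flow F (s + k * N) j) y \<rho> = osc (flow F' (s + k * N) j) y \<rho>" for y \<rho>
            by (intro osc_flow_cong) auto
          then show "?h F p = ?h F' p" by simp
        next
          show "(\<lambda>p. ?h (fst p) (snd p)) \<in> borel_measurable (PiM UNIV (\<lambda>_. fun_sigma) \<Otimes>\<^sub>M (borel \<Otimes>\<^sub>M borel))"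
            by measurable
        qed (auto simp: block_rad_nonneg r osc_flow_mean)
        also have "\<dots> \<le> ennreal (0 + (real CARD('m) + growth ^ j) * (r * (1/2) ^ k))"
          by (rule nn_integral_affine_le[where X="\<rho> k", OF _ prob_space_axioms])
            (use r growth_ge_1 \<rho>_nonneg \<rho>_mean in \<open>auto simp: \<rho>_def\<close>)
        finally show "nnexp (\<lambda>\<omega>. osc (flow (maps \<omega>) (s + k * N) j) (flow (maps \<omega>) s (k * N) x) (\<rho> k \<omega>))
          \<le> ennreal ((real CARD('m) + growth ^ j) * (r * (1/2) ^ k))" by (simp add: \<rho>_def)
      qed (use r growth_ge_1 in \<open>auto simp: V_def\<close>)
      then show ?thesis by (simp add: C_def sum_distrib_right mult.assoc)
    qed
    have geo: "(\<Sum>k. ennreal (c * (1/2) ^ k)) = ennreal (2 * c)" if "c \<ge> 0" for c :: real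
    proof (subst suminf_ennreal2)
      show "0 \<le> c * (1/2) ^ k" for k using that by simp
      show "summable (\<lambda>k. c * (1/2 :: real) ^ k)" by (intro summable_mult summable_geometric) auto
      show "ennreal (\<Sum>k. c * (1/2) ^ k) = ennreal (2 * c)"
        by (subst suminf_mult) (auto simp: suminf_geometric mult.commute)
    qed
    have exceed: "emeasure M {\<omega> \<in> space M. \<exists>k. \<rho> k \<omega> > r0} \<le> ennreal (2 / r0 * r)"
    proof -
      have "emeasure M {\<omega> \<in> space M. \<exists>k. \<rho> k \<omega> > r0} = (\<integral>\<^sup>+\<omega>. indicator {\<omega> \<in> space M. \<exists>k. \<rho> k \<omega> > r0} \<omega> \<partial>M)"
        by (rule nn_integral_indicator[symmetric]) measurable
      also have "\<dots> \<le> (\<integral>\<^sup>+\<omega>. (\<Sum>k. ennreal (1 / r0 * \<rho> k \<omega>)) \<partial>M)"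
      proof (rule nn_integral_mono)
        fix \<omega>
        show "indicator {\<omega> \<in> space M. \<exists>k. \<rho> k \<omega> > r0} \<omega> \<le> (\<Sum>k. ennreal (1 / r0 * \<rho> k \<omega>))"
        proof (cases "\<exists>k. \<rho> k \<omega> > r0")
          case True
          then obtain k where "\<rho> k \<omega> > r0" by blast
          then have "ennreal 1 \<le> ennreal (1 / r0 * \<rho> k \<omega>)" using r0 by (intro ennreal_leI) (simp add: field_simps)
          also have "\<dots> = (\<Sum>i\<in>{k}. ennreal (1 / r0 * \<rho> i \<omega>))" by simp
          also have "\<dots> \<le> (\<Sum>k. ennreal (1 / r0 * \<rho> k \<omega>))" by (rule sum_le_suminf[OF summableI]) auto
          finally show ?thesis by (auto split: split_indicator)
        qed auto
      qed
      also have "\<dots> = (\<Sum>k. \<integral>\<^sup>+\<omega>. ennreal (1 / r0 * \<rho> k \<omega>) \<partial>M)"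
        by (rule nn_integral_suminf) measurable
      also have "\<dots> \<le> (\<Sum>k. ennreal (r / r0 * (1/2) ^ k))"
      proof (intro suminf_le summableI)
        fix k
        have "nnexp (\<lambda>\<omega>. 1 / r0 * \<rho> k \<omega>) \<le> ennreal (0 + 1 / r0 * (r * (1/2) ^ k))"
          by (rule nn_integral_affine_le[where X="\<rho> k", OF _ prob_space_axioms])
            (use r r0 \<rho>_nonneg \<rho>_mean in auto)
        then show "nnexp (\<lambda>\<omega>. 1 / r0 * \<rho> k \<omega>) \<le> ennreal (r / r0 * (1/2) ^ k)" by simp
      qed
      also have "\<dots> = ennreal (2 * (r / r0))" using r r0 by (intro geo) auto
      finally show ?thesis by (simp add: mult.commute)
    qed
    have "AE \<omega> in M. (\<Sum>k. ennreal (V k \<omega>)) \<noteq> \<infinity>"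
    proof (rule nn_integral_PInf_AE)
      have "(\<integral>\<^sup>+\<omega>. (\<Sum>k. ennreal (V k \<omega>)) \<partial>M) = (\<Sum>k. \<integral>\<^sup>+\<omega>. ennreal (V k \<omega>) \<partial>M)"
        by (rule nn_integral_suminf) measurable
      also have "\<dots> \<le> (\<Sum>k. ennreal (C * r * (1/2) ^ k))" by (intro suminf_le summableI V_mean)
      also have "\<dots> = ennreal (2 * (C * r))" using r C by (intro geo) auto
      finally show "(\<integral>\<^sup>+\<omega>. (\<Sum>k. ennreal (V k \<omega>)) \<partial>M) \<noteq> \<infinity>"
        by (auto simp: top_unique)
    qed measurable
    then have "AE \<omega> in M. (\<lambda>k. V k \<omega>) \<longlonglongrightarrow> 0"
    proof (rule AE_mp, intro AE_I2 impI)
      fix \<omega> assume "(\<Sum>k. ennreal (V k \<omega>)) \<noteq> \<infinity>"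
      then have "summable (\<lambda>k. V k \<omega>)" using V_nonneg by (intro summable_suminf_not_top) auto
      then show "(\<lambda>k. V k \<omega>) \<longlonglongrightarrow> 0" by (rule summable_LIMSEQ_zero)
    qed
    then have "AE \<omega> in M. \<omega> \<in> {\<omega> \<in> space M. lim_osc (maps \<omega>) s x r \<noteq> 0} \<longrightarrow> \<omega> \<in> {\<omega> \<in> space M. \<exists>k. \<rho> k \<omega> > r0}"
    proof (rule AE_mp, intro AE_I2 impI)
      fix \<omega> assume \<omega>: "\<omega> \<in> space M" and V0: "(\<lambda>k. V k \<omega>) \<longlonglongrightarrow> 0"
        and "\<omega> \<in> {\<omega> \<in> space M. lim_osc (maps \<omega>) s x r \<noteq> 0}"
      then have nz: "lim_osc (maps \<omega>) s x r \<noteq> 0" by simp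
      have "\<exists>k. \<rho> k \<omega> > r0"
      proof (rule ccontr)
        assume "\<not> (\<exists>k. \<rho> k \<omega> > r0)"
        then have small: "block_rad N r0 (maps \<omega>) s k x r \<le> r0" for k by (auto simp: \<rho>_def not_less)
        have "(\<lambda>n. osc (flow (maps \<omega>) s n) x r) \<longlonglongrightarrow> 0"
        proof (rule tendsto_0_blocks[OF N _ V0])
          fix k j assume j: "j < N"
          have "osc (flow (maps \<omega>) s (k * N + j)) x r \<le> osc (flow (maps \<omega>) (s + k * N) j) (flow (maps \<omega>) s (k * N) x) (\<rho> k \<omega>)"
            unfolding \<rho>_def by (rule osc_flow_block_le[OF maps_continuous[OF \<omega>] small])
          also have "\<dots> \<le> V k \<omega>" unfolding V_def using j
            by (intro member_le_sum[of j _ "\<lambda>j. osc (flow (maps \<omega>) (s + k * N) j) (flow (maps \<omega>) s (k * N) x) (\<rho> k \<omega>)"]) auto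
          finally show "osc (flow (maps \<omega>) s (k * N + j)) x r \<le> V k \<omega>" .
        qed simp
        then show False using nz lim_osc_eq_0 by blast
      qed
      then show "\<omega> \<in> {\<omega> \<in> space M. \<exists>k. \<rho> k \<omega> > r0}" using \<omega> by simp
    qed
    then have "emeasure M {\<omega> \<in> space M. lim_osc (maps \<omega>) s x r \<noteq> 0} \<le> emeasure M {\<omega> \<in> space M. \<exists>k. \<rho> k \<omega> > r0}"
      by (rule emeasure_mono_AE) measurable
    also note exceed
    finally show ?thesis .
  qed
  then show ?thesis using r0 by (intro exI[of _ "2 / r0"]) auto
qed

lemma nn_integral_two_values:
  assumes [measurable]: "E \<in> events" and "0 \<le> lo" "lo \<le> hi"
  shows "nnexp (\<lambda>\<omega>. if \<omega> \<in> E then lo else hi) = ennreal (hi - (hi - lo) * prob E)"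
proof -
  have "nnexp (\<lambda>\<omega>. if \<omega> \<in> E then lo else hi) = nnexp (\<lambda>\<omega>. hi - (hi - lo) * indicator E \<omega>)"
    by (intro nn_integral_cong) (auto split: split_indicator)
  also have "\<dots> = ennreal (\<integral>\<omega>. hi - (hi - lo) * indicator E \<omega> \<partial>M)"
    using assms by (intro nn_integral_eq_integral AE_I2) (auto split: split_indicator simp: emeasure_eq_measure)
  also have "(\<integral>\<omega>. hi - (hi - lo) * indicator E \<omega> \<partial>M) = hi - (hi - lo) * prob E"
    by (subst Bochner_Integration.integral_diff) (auto simp: prob_space emeasure_eq_measure)
  finally show ?thesis .
qed

definition escape_prob :: "nat \<Rightarrow> real ^ 'm \<Rightarrow> real \<Rightarrow> real" where
  "escape_prob s x r = prob {\<omega> \<in> space M. lim_osc (maps \<omega>) s x r \<noteq> 0}"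

lemma escape_prob_le_restart:
  assumes r: "r \<ge> 0" and ab: "0 \<le> lo" "lo \<le> hi"
    and small: "\<And>y \<rho>. 0 \<le> \<rho> \<Longrightarrow> \<rho> \<le> B \<Longrightarrow> escape_prob (s + n) y \<rho> \<le> lo"
    and large: "\<And>y \<rho>. 0 \<le> \<rho> \<Longrightarrow> escape_prob (s + n) y \<rho> \<le> hi"
    and g: "g \<le> prob {\<omega> \<in> space M. rad (maps \<omega>) s n x r \<le> B}"
  shows "escape_prob s x r \<le> hi - (hi - lo) * g"
proof -
  let ?h = "\<lambda>F p. if lim_osc F (s + n) (fst p) (snd p) \<noteq> 0 then 1 else 0 :: ennreal"
  let ?G = "\<lambda>F. (flow F s n x, rad F s n x r)"
  have bad_eq: "(\<integral>\<^sup>+\<omega>. (if lim_osc (maps \<omega>) t y \<rho> \<noteq> 0 then 1 else 0) \<partial>M) = ennreal (escape_prob t y \<rho>)" for t y \<rho>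
  proof -
    have "(\<integral>\<^sup>+\<omega>. (if lim_osc (maps \<omega>) t y \<rho> \<noteq> 0 then 1 else 0) \<partial>M) = (\<integral>\<^sup>+\<omega>. indicator {\<omega> \<in> space M. lim_osc (maps \<omega>) t y \<rho> \<noteq> 0} \<omega> \<partial>M)"
      by (intro nn_integral_cong) auto
    also have "\<dots> = emeasure M {\<omega> \<in> space M. lim_osc (maps \<omega>) t y \<rho> \<noteq> 0}"
      by (rule nn_integral_indicator) measurable
    finally show ?thesis by (simp add: escape_prob_def emeasure_eq_measure)
  qed
  have "ennreal (escape_prob s x r) \<le> (\<integral>\<^sup>+\<omega>. ?h (maps \<omega>) (?G (maps \<omega>)) \<partial>M)"
    unfolding bad_eq[symmetric]
  proof (rule nn_integral_mono)
    fix \<omega> assume "\<omega> \<in> space M"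
    then have "lim_osc (maps \<omega>) s x r \<le> lim_osc (maps \<omega>) (s + n) (flow (maps \<omega>) s n x) (rad (maps \<omega>) s n x r)"
      by (intro lim_osc_step_le maps_continuous)
    then show "(if lim_osc (maps \<omega>) s x r \<noteq> 0 then 1 else 0) \<le> ?h (maps \<omega>) (?G (maps \<omega>))" by auto
  qed
  also have "\<dots> \<le> (\<integral>\<^sup>+\<omega>. (\<lambda>p. ennreal (if snd p \<le> B then lo else hi)) (?G (maps \<omega>)) \<partial>M)"
  proof (rule freeze[where N="borel \<Otimes>\<^sub>M borel" and t="s + n" and P="\<lambda>p. 0 \<le> snd p" and G="?G" and h="?h"])
    fix p :: "(real ^ 'm) \<times> real" assume "0 \<le> snd p"
    then show "(\<integral>\<^sup>+\<omega>. ?h (maps \<omega>) p \<partial>M) \<le> ennreal (if snd p \<le> B then lo else hi)"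
      unfolding bad_eq using small[of "snd p" "fst p"] large[of "snd p" "fst p"] by (intro ennreal_leI) auto
  next
    fix F F' :: "nat \<Rightarrow> real ^ 'm \<Rightarrow> real ^ 'm" assume "\<And>i. i < s + n \<Longrightarrow> F i = F' i"
    then show "?G F = ?G F'" by (auto intro!: flow_cong rad_cong)
  next
    fix F F' :: "nat \<Rightarrow> real ^ 'm \<Rightarrow> real ^ 'm" and p :: "(real ^ 'm) \<times> real"
    assume "\<And>i. s + n \<le> i \<Longrightarrow> F i = F' i"
    then have "lim_osc F (s + n) (fst p) (snd p) = lim_osc F' (s + n) (fst p) (snd p)" by (rule lim_osc_cong)
    then show "?h F p = ?h F' p" by simp
  next
    show "(\<lambda>p. ?h (fst p) (snd p)) \<in> borel_measurable (PiM UNIV (\<lambda>_. fun_sigma) \<Otimes>\<^sub>M (borel \<Otimes>\<^sub>M borel))"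
      by measurable
  qed (auto simp: rad_nonneg r)
  also have "\<dots> = nnexp (\<lambda>\<omega>. if \<omega> \<in> {\<omega> \<in> space M. rad (maps \<omega>) s n x r \<le> B} then lo else hi)"
    by (intro nn_integral_cong) auto
  also have "\<dots> = ennreal (hi - (hi - lo) * prob {\<omega> \<in> space M. rad (maps \<omega>) s n x r \<le> B})"
    by (intro nn_integral_two_values ab) measurable
  finally have "ennreal (escape_prob s x r) \<le> ennreal (hi - (hi - lo) * prob {\<omega> \<in> space M. rad (maps \<omega>) s n x r \<le> B})" .
  moreover have "0 \<le> hi - (hi - lo) * prob {\<omega> \<in> space M. rad (maps \<omega>) s n x r \<le> B}"
    using ab mult_left_mono[of "prob {\<omega> \<in> space M. rad (maps \<omega>) s n x r \<le> B}" 1 "hi - lo"] by simp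
  ultimately have "escape_prob s x r \<le> hi - (hi - lo) * prob {\<omega> \<in> space M. rad (maps \<omega>) s n x r \<le> B}" by simp
  moreover have "(hi - lo) * g \<le> (hi - lo) * prob {\<omega> \<in> space M. rad (maps \<omega>) s n x r \<le> B}"
    using g ab by (intro mult_left_mono) auto
  ultimately show ?thesis by linarith
qed

text \<open>Let \<open>S\<close> be the supremum of all probabilities of not contracting. From any start the radius comes below a
  fixed \<open>B\<close> with probability \<open>1/2\<close>, then below \<open>d\<close> with probability \<open>g\<close>, and from there the probability of not
  contracting is at most \<open>S / 2\<close>; hence \<open>S \<le> S - g * S / 4\<close>.\<close>

lemma escape_prob_eq_0:
  assumes "r \<ge> 0"
  shows "escape_prob s x r = 0"
proof -
  define A where "A = {escape_prob s x r | s x r. 0 \<le> r}"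
  define S where "S = Sup A"
  have bad01: "0 \<le> escape_prob s x r" "escape_prob s x r \<le> 1" for s x r by (simp_all add: escape_prob_def)
  have bdd: "bdd_above A" using bad01(2) by (auto simp: A_def intro!: bdd_aboveI[of _ 1])
  have bad_S: "escape_prob s x r \<le> S" if "r \<ge> 0" for s x r
    unfolding S_def using that by (intro cSup_upper bdd) (auto simp: A_def)
  have "S \<le> 0"
  proof (rule ccontr)
    assume "\<not> S \<le> 0"
    then have S: "S > 0" by simp
    obtain C where C: "C \<ge> 0" "\<And>s x r. r \<ge> 0 \<Longrightarrow> emeasure M {\<omega> \<in> space M. lim_osc (maps \<omega>) s x r \<noteq> 0} \<le> ennreal (C * r)"
      using local_stability by blast
    \<comment> \<open>Makes \<open>C * d\<close> at most \<open>S / 2\<close>; the denominator is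
      \<open>C + 1\<close> because \<open>C\<close> may be 0.\<close>
    define d where "d = S / 2 / (C + 1)"
    have d: "d > 0" using S C by (simp add: d_def)
    have bad_d: "escape_prob s x r \<le> S / 2" if "0 \<le> r" "r \<le> d" for s x r
    proof -
      have "escape_prob s x r \<le> C * r" using C(2)[OF that(1), of s x] that C(1) by (simp add: escape_prob_def emeasure_eq_measure)
      also have "\<dots> \<le> (C + 1) * d" using that C d by (intro mult_mono) auto
      also have "\<dots> = S / 2"
      proof -
        have "C + 1 \<noteq> 0" using C(1) by simp
        then show ?thesis unfolding d_def by (metis nonzero_mult_div_cancel_left times_divide_eq_right)
      qed
      finally show ?thesis .
    qed
    obtain b' where b': "b' \<ge> 0" "\<And>s x r n. r \<ge> 0 \<Longrightarrow> nnexp (\<lambda>\<omega>. rad (maps \<omega>) s n x r) \<le> ennreal (r / 2 ^ n + b')"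
      using rad_drift by blast
    \<comment> \<open>By Markov's inequality the radius exceeds \<open>B\<close> with probability at
      most 1/2 once its mean is at most \<open>1 + b'\<close>, which holds after \<open>n\<close>
      steps with \<open>r < 2^n\<close>.\<close>
    define B where "B = 2 * (b' + 1)"
    have B: "B > 0" using b' by (simp add: B_def)
    obtain g where g: "g > 0" "\<And>n x. g \<le> prob {\<omega> \<in> space M. osc (\<xi> n \<omega>) x B \<le> d}"
      using small_ball[OF B d] by blast
    have g1: "g \<le> 1" using g(2)[of 0 0] prob_le_1 order_trans by blast
    have mid: "escape_prob s y \<rho> \<le> S - S / 2 * g" if \<rho>: "0 \<le> \<rho>" "\<rho> \<le> B" for s y \<rho>
    proof -
      have "g \<le> prob {\<omega> \<in> space M. rad (maps \<omega>) s 1 y \<rho> \<le> d}"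
      proof (rule order_trans[OF g(2)[of s y] finite_measure_mono])
        show "{\<omega> \<in> space M. osc (\<xi> s \<omega>) y B \<le> d} \<subseteq> {\<omega> \<in> space M. rad (maps \<omega>) s 1 y \<rho> \<le> d}"
        proof (intro subsetI CollectI conjI)
          fix \<omega> assume \<omega>: "\<omega> \<in> {\<omega> \<in> space M. osc (\<xi> s \<omega>) y B \<le> d}"
          then have "osc (\<xi> s \<omega>) y \<rho> \<le> osc (\<xi> s \<omega>) y B" by (intro osc_mono continuous \<rho>) simp
          then show "rad (maps \<omega>) s 1 y \<rho> \<le> d" using \<omega> by (simp add: reg_random_map)
        qed simp
      qed measurable
      then have "escape_prob s y \<rho> \<le> S - (S - S / 2) * g"
        by (rule escape_prob_le_restart[where n=1 and B=d and lo="S / 2" and hi=S and g=g, rotated -1])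
          (use \<rho> S d bad_d bad_S in auto)
      then show ?thesis by simp
    qed
    have "escape_prob s x r \<le> S - S / 4 * g" if r: "r \<ge> 0" for s x r
    proof -
      obtain n where n: "r < 2 ^ n" using real_arch_pow[of 2 r] by auto
      have "nnexp (\<lambda>\<omega>. rad (maps \<omega>) s n x r) \<le> ennreal (r / 2 ^ n + b')" by (rule b'(2)[OF r])
      also have "\<dots> \<le> ennreal (1 + b')" using n by (intro ennreal_leI) (simp add: field_simps)
      finally have mean: "nnexp (\<lambda>\<omega>. rad (maps \<omega>) s n x r) \<le> ennreal (1 + b')" .
      have "emeasure M {\<omega> \<in> space M. \<not> rad (maps \<omega>) s n x r \<le> B} = (\<integral>\<^sup>+\<omega>. indicator {\<omega> \<in> space M. \<not> rad (maps \<omega>) s n x r \<le> B} \<omega> \<partial>M)"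
        by (rule nn_integral_indicator[symmetric]) measurable
      also have "\<dots> \<le> nnexp (\<lambda>\<omega>. 1 / B * rad (maps \<omega>) s n x r)"
      proof (rule nn_integral_mono)
        fix \<omega>
        show "indicator {\<omega> \<in> space M. \<not> rad (maps \<omega>) s n x r \<le> B} \<omega> \<le> ennreal (1 / B * rad (maps \<omega>) s n x r)"
          using B by (auto split: split_indicator simp: field_simps intro!: ennreal_leI[of 1, simplified])
      qed
      also have "\<dots> \<le> ennreal (0 + 1 / B * (1 + b'))"
        by (rule nn_integral_affine_le[where X="\<lambda>\<omega>. rad (maps \<omega>) s n x r", OF _ prob_space_axioms])
          (use B b' mean rad_nonneg[OF r] in auto)
      also have "0 + 1 / B * (1 + b') = 1/2" using b' by (simp add: B_def field_simps)
      finally have "prob {\<omega> \<in> space M. \<not> rad (maps \<omega>) s n x r \<le> B} \<le> 1/2"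
        unfolding emeasure_eq_measure by (subst (asm) ennreal_le_iff) auto
      moreover have "prob {\<omega> \<in> space M. \<not> rad (maps \<omega>) s n x r \<le> B} = 1 - prob {\<omega> \<in> space M. rad (maps \<omega>) s n x r \<le> B}"
        by (rule prob_neg) measurable
      ultimately have half: "1/2 \<le> prob {\<omega> \<in> space M. rad (maps \<omega>) s n x r \<le> B}" by simp
      \<comment> \<open>Keeps \<open>lo\<close> nonnegative in the restart; this is where
        \<open>g \<le> 1\<close> enters.\<close>
      have "S / 2 * g \<le> S / 2 * 1" using S g1 by (intro mult_left_mono) auto
      then have "escape_prob s x r \<le> S - (S - (S - S / 2 * g)) * (1/2)"
        using S g(1) B mid bad_S r
        by (intro escape_prob_le_restart[where n=n and B=B and lo="S - S / 2 * g" and hi=S and g="1/2", OF _ _ _ _ _ half]) auto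
      then show ?thesis by simp
    qed
    then have "S \<le> S - S / 4 * g"
      unfolding S_def by (intro cSup_least) (auto simp: A_def S_def[unfolded A_def])
    then show False using S g(1) by (simp add: not_less[symmetric])
  qed
  then show ?thesis using bad_S[OF assms, of s x] bad01(1)[of s x r] by linarith
qed

theorem synchronisation:
  "AE \<omega> in M. \<forall>y z. (\<lambda>n. norm (flow (maps \<omega>) 0 n y - flow (maps \<omega>) 0 n z)) \<longlonglongrightarrow> 0"
proof -
  \<comment> \<open>Countably many cubes around 0 contain all pairs of points, so one null set
    serves every \<open>y\<close> and \<open>z\<close>.\<close>
  have "AE \<omega> in M. lim_osc (maps \<omega>) 0 0 (real k) = 0" for k
  proof (rule AE_I[where N="{\<omega> \<in> space M. lim_osc (maps \<omega>) 0 0 (real k) \<noteq> 0}"])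
    show "emeasure M {\<omega> \<in> space M. lim_osc (maps \<omega>) 0 0 (real k) \<noteq> 0} = 0"
      using escape_prob_eq_0[of "real k" 0 0] by (simp add: escape_prob_def emeasure_eq_measure)
  qed (auto, measurable)
  then have "AE \<omega> in M. \<forall>k. lim_osc (maps \<omega>) 0 0 (real k) = 0" by (simp add: AE_all_countable)
  then show ?thesis
  proof (rule AE_mp, intro AE_I2 impI allI)
    fix \<omega> and y z :: "real ^ 'm" assume \<omega>: "\<omega> \<in> space M" and 0: "\<forall>k. lim_osc (maps \<omega>) 0 0 (real k) = 0"
    obtain k where k: "max (norm y) (norm z) < real k" using reals_Archimedean2 by blast
    let ?f = "flow (maps \<omega>) 0"
    have le: "norm (?f n v - ?f n 0) \<le> osc (?f n) 0 (real k)" if "v = y \<or> v = z" for n v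
      using that k by (intro le_osc_norm continuous_flow maps_continuous \<omega>) auto
    show "(\<lambda>n. norm (?f n y - ?f n z)) \<longlonglongrightarrow> 0"
    proof (rule Lim_null_comparison[OF always_eventually], rule allI)
      fix n
      have "norm (?f n y - ?f n z) \<le> norm (?f n y - ?f n 0) + norm (?f n z - ?f n 0)"
        using norm_triangle_ineq4[of "?f n y - ?f n 0" "?f n z - ?f n 0"] by simp
      then show "norm (norm (?f n y - ?f n z)) \<le> 2 * osc (?f n) 0 (real k)" using le[of y n] le[of z n] by simp
    next
      show "(\<lambda>n. 2 * osc (?f n) 0 (real k)) \<longlonglongrightarrow> 0"
        using tendsto_mult_left[OF lim_osc_0_tendsto[OF 0[rule_format, of k]], of 2] by simp
    qed
  qed
qed

end

section \<open>Laws of Gaussian processes\<close>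

text \<open>The law of \<open>U\<close> under the normalised weight \<open>w\<close>: weighted
  trigonometric means become its characteristic function, and weighted indicators its
  probabilities.\<close>

lemma (in prob_space) char_distr_density:
  fixes w U :: "'a \<Rightarrow> real"
  assumes [measurable]: "w \<in> borel_measurable M" "U \<in> borel_measurable M" and w: "\<And>\<omega>. 0 \<le> w \<omega>" "\<And>\<omega>. w \<omega> \<le> B"
    and pos: "0 < expectation w"
  defines "N \<equiv> distr (density M (\<lambda>\<omega>. ennreal (w \<omega> / expectation w))) borel U"
  shows "real_distribution N"
    and "char N t = Complex (expectation (\<lambda>\<omega>. w \<omega> * cos (t * U \<omega>)) / expectation w)
      (expectation (\<lambda>\<omega>. w \<omega> * sin (t * U \<omega>)) / expectation w)"
    and "A \<in> sets borel \<Longrightarrow> measure N A = expectation (\<lambda>\<omega>. w \<omega> * indicator A (U \<omega>)) / expectation w"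
proof -
  let ?c = "expectation w" and ?D = "density M (\<lambda>\<omega>. ennreal (w \<omega> / expectation w))"
  have bnd: "integrable M (\<lambda>\<omega>. w \<omega> * f \<omega>)" if [measurable]: "f \<in> borel_measurable M" and "\<And>\<omega>. \<bar>f \<omega>\<bar> \<le> 1" for f
    by (rule integrable_const_bound[of _ B])
      (use w that in \<open>auto simp: abs_mult intro!: AE_I2 order_trans[OF mult_mono[of "w _" B "\<bar>f _\<bar>" 1]] order_trans[OF w(1) w(2)]\<close>)
  have iw: "integrable M w" using bnd[of "\<lambda>_. 1"] by simp
  have D: "prob_space ?D"
  proof (rule prob_spaceI)
    have "emeasure ?D (space ?D) = nnexp (\<lambda>\<omega>. w \<omega> / ?c)"
      by (subst emeasure_density) (auto intro!: nn_integral_cong)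
    also have "\<dots> = ennreal (expectation (\<lambda>\<omega>. w \<omega> / ?c))"
      using iw w pos by (intro nn_integral_eq_integral) auto
    also have "\<dots> = 1" using pos by simp
    finally show "emeasure ?D (space ?D) = 1" .
  qed
  interpret D: prob_space ?D by fact
  have U': "U \<in> borel_measurable ?D" by simp
  show "real_distribution N" unfolding N_def by (rule D.real_distribution_distr[OF U'])
  have ns: "AE \<omega> in M. 0 \<le> w \<omega> / ?c" using w pos by (intro AE_I2) simp
  have "char N t = (\<integral>\<omega>. iexp (t * U \<omega>) \<partial>?D)"
    unfolding char_def N_def by (rule integral_distr) (auto)
  also have "\<dots> = (\<integral>\<omega>. (w \<omega> / ?c) *\<^sub>R iexp (t * U \<omega>) \<partial>M)"
    by (rule integral_density[OF _ _ ns]) auto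
  also have "\<dots> = (\<integral>\<omega>. Complex (w \<omega> * cos (t * U \<omega>) / ?c) (w \<omega> * sin (t * U \<omega>) / ?c) \<partial>M)"
    by (intro Bochner_Integration.integral_cong) (auto simp: complex_eq_iff Re_exp Im_exp)
  also have "\<dots> = Complex (expectation (\<lambda>\<omega>. w \<omega> * cos (t * U \<omega>)) / ?c) (expectation (\<lambda>\<omega>. w \<omega> * sin (t * U \<omega>)) / ?c)"
  proof -
    have "integrable M (\<lambda>\<omega>. Complex (w \<omega> * cos (t * U \<omega>) / ?c) (w \<omega> * sin (t * U \<omega>) / ?c))"
    proof -
      have "integrable M (\<lambda>\<omega>. complex_of_real (w \<omega> * cos (t * U \<omega>) / ?c) + \<i> * complex_of_real (w \<omega> * sin (t * U \<omega>) / ?c))"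
        by (intro Bochner_Integration.integrable_add integrable_mult_right integrable_of_real integrable_divide bnd) auto
      then show ?thesis by (simp add: Complex_eq)
    qed
    then show ?thesis by (simp add: complex_eq_iff flip: integral_Re integral_Im)
  qed
  finally show "char N t = Complex (expectation (\<lambda>\<omega>. w \<omega> * cos (t * U \<omega>)) / ?c) (expectation (\<lambda>\<omega>. w \<omega> * sin (t * U \<omega>)) / ?c)" .
  show "measure N A = expectation (\<lambda>\<omega>. w \<omega> * indicator A (U \<omega>)) / ?c" if [measurable]: "A \<in> sets borel"
  proof -
    interpret N: prob_space N unfolding N_def by (rule D.prob_space_distr[OF U'])
    have "measure N A = (\<integral>x. indicator A x \<partial>N)" using that by (simp add: N_def)
    also have "\<dots> = (\<integral>\<omega>. indicator A (U \<omega>) \<partial>?D)" unfolding N_def by (rule integral_distr) auto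
    also have "\<dots> = (\<integral>\<omega>. (w \<omega> / ?c) *\<^sub>R indicator A (U \<omega>) \<partial>M)"
      by (rule integral_density[OF _ _ ns]) auto
    also have "\<dots> = expectation (\<lambda>\<omega>. w \<omega> * indicator A (U \<omega>)) / ?c" by simp
    finally show ?thesis .
  qed
qed

text \<open>The phase \<open>p\<close> encodes both parts of the characteristic function: 0 gives
  the cosine, \<open>- (pi / 2)\<close> the sine, and \<open>t = 0\<close> equal total weights. The
  bounds 1 and 3 fit weights \<open>2 + Q\<close> with \<open>\<bar>Q\<bar> \<le> 1\<close>.\<close>

lemma (in prob_space) weighted_law_eqI:
  fixes w w' U U' :: "'a \<Rightarrow> real"
  assumes [measurable]: "w \<in> borel_measurable M" "U \<in> borel_measurable M" "w' \<in> borel_measurable M" "U' \<in> borel_measurable M"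
    and w: "\<And>\<omega>. 1 \<le> w \<omega>" "\<And>\<omega>. w \<omega> \<le> 3" and w': "\<And>\<omega>. 1 \<le> w' \<omega>" "\<And>\<omega>. w' \<omega> \<le> 3"
    and eq: "\<And>t p. expectation (\<lambda>\<omega>. w \<omega> * cos (t * U \<omega> + p)) = expectation (\<lambda>\<omega>. w' \<omega> * cos (t * U' \<omega> + p))"
    and A: "A \<in> sets borel"
  shows "expectation (\<lambda>\<omega>. w \<omega> * indicator A (U \<omega>)) = expectation (\<lambda>\<omega>. w' \<omega> * indicator A (U' \<omega>))"
proof -
  have e: "expectation w = expectation w'" using eq[of 0 0] by simp
  have iw: "integrable M v" if [measurable]: "v \<in> borel_measurable M" and "\<And>\<omega>. 1 \<le> v \<omega>" "\<And>\<omega>. v \<omega> \<le> (3 :: real)" for v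
  proof (rule integrable_const_bound[of _ 3])
    have "\<bar>v \<omega>\<bar> \<le> 3" for \<omega> using that(2)[of \<omega>] that(3)[of \<omega>] by linarith
    then show "AE \<omega> in M. norm (v \<omega>) \<le> 3" by simp
  qed measurable
  have ge: "1 \<le> expectation v" if "v \<in> borel_measurable M" and "\<And>\<omega>. 1 \<le> v \<omega>" "\<And>\<omega>. v \<omega> \<le> (3 :: real)" for v
    using integral_mono[of M "\<lambda>_. 1" v] iw[OF that] that by (simp add: prob_space)
  have c: "0 < expectation w" "0 < expectation w'"
    using ge[OF _ w] ge[OF _ w'] by (auto intro: less_le_trans[OF zero_less_one])
  have n: "0 \<le> w \<omega>" "0 \<le> w' \<omega>" for \<omega> using w(1)[of \<omega>] w'(1)[of \<omega>] by linarith+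
  note 1 = char_distr_density[of w U 3, OF _ _ n(1) w(2) c(1)] and 2 = char_distr_density[of w' U' 3, OF _ _ n(2) w'(2) c(2)]
  let ?N = "distr (density M (\<lambda>\<omega>. ennreal (w \<omega> / expectation w))) borel U"
  let ?N' = "distr (density M (\<lambda>\<omega>. ennreal (w' \<omega> / expectation w'))) borel U'"
  have "?N = ?N'"
  proof (rule Levy_uniqueness)
    show "char ?N = char ?N'"
    proof
      fix t
      have "cos (x + - (pi / 2)) = sin x" for x :: real by (simp add: cos_diff)
      then have "expectation (\<lambda>\<omega>. w \<omega> * sin (t * U \<omega>)) = expectation (\<lambda>\<omega>. w' \<omega> * sin (t * U' \<omega>))"
        using eq[of t "- (pi / 2)"] by simp
      then show "char ?N t = char ?N' t"
        using eq[of t 0] by (subst 1(2), (simp; fail), (simp; fail), subst 2(2), (simp; fail), (simp; fail)) (simp add: e)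
    qed
  qed (use 1(1) 2(1) in auto)
  then have "measure ?N A = measure ?N' A" by simp
  then show ?thesis using 1(3)[OF _ _ A] 2(3)[OF _ _ A] c e by simp
qed

text \<open>Replacing one phase \<open>a k * X k\<close> after the other by an indicator of \<open>X k\<close>, each time by uniqueness of
  characteristic functions on the line under the strictly positive density \<open>2 + P * cos\<close>.\<close>

lemma (in prob_space) cramer_wold:
  fixes X Y :: "'i \<Rightarrow> 'a \<Rightarrow> real"
  assumes J: "finite J" and X [measurable]: "\<And>j. X j \<in> borel_measurable M" and Y [measurable]: "\<And>j. Y j \<in> borel_measurable M"
    and eq: "\<And>a. distr M borel (\<lambda>\<omega>. \<Sum>j\<in>J. a j * X j \<omega>) = distr M borel (\<lambda>\<omega>. \<Sum>j\<in>J. a j * Y j \<omega>)"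
    and B: "\<And>j. B j \<in> sets borel"
  shows "prob {\<omega> \<in> space M. \<forall>j\<in>J. X j \<omega> \<in> B j} = prob {\<omega> \<in> space M. \<forall>j\<in>J. Y j \<omega> \<in> B j}"
proof -
  \<comment> \<open>Interpolates between two kinds of test function: indicators for the indices in
    \<open>K\<close>, one joint phase for the others.\<close>
  define P where "P Z K a p \<omega> = (\<Prod>k\<in>K. indicator (B k) (Z k \<omega>)) * cos ((\<Sum>j\<in>J - K. a j * Z j \<omega>) + p)"
    for Z :: "'i \<Rightarrow> 'a \<Rightarrow> real" and K a p \<omega>
  note B [measurable]
  have P [measurable]: "P Z K a p \<in> borel_measurable M" if [measurable]: "\<And>j. Z j \<in> borel_measurable M" for Z K a p
    unfolding P_def by measurable
  have prod01: "0 \<le> (\<Prod>k\<in>K. indicator (B k) (Z k \<omega>) :: real)" "(\<Prod>k\<in>K. indicator (B k) (Z k \<omega>) :: real) \<le> 1"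
    for K and Z :: "'i \<Rightarrow> 'a \<Rightarrow> real" and \<omega>
    by (auto intro!: prod_nonneg prod_le_1)
  have P1: "\<bar>P Z K a p \<omega>\<bar> \<le> 1" for Z K a p \<omega>
    unfolding P_def abs_mult by (intro mult_le_one) (auto simp: abs_of_nonneg[OF prod01(1)] prod01(2))
  have bint: "integrable M (\<lambda>\<omega>. f \<omega> * c :: real)" if "f \<in> borel_measurable M" "\<And>\<omega>. \<bar>f \<omega>\<bar> \<le> 1" for f c
    using that by (intro integrable_mult_left integrable_const_bound[of _ 1]) auto
  have base: "expectation (P X {} a p) = expectation (P Y {} a p)" for a p
  proof -
    have "expectation (P Z {} a p) = (\<integral>x. cos (x + p) \<partial>distr M borel (\<lambda>\<omega>. \<Sum>j\<in>J. a j * Z j \<omega>))"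
      if [measurable]: "\<And>j. Z j \<in> borel_measurable M" for Z
      unfolding P_def by (subst integral_distr) auto
    then show ?thesis using eq[of a] by simp
  qed
  have "expectation (P X K a p) = expectation (P Y K a p)" if "K \<subseteq> J" for K a p
    using finite_subset[OF that J] that
  proof (induction K arbitrary: a p)
    case empty
    show ?case by (rule base)
  next
    case (insert k K)
    have k: "k \<in> J" "k \<notin> K" and JK: "J - K = insert k (J - insert k K)" "finite (J - insert k K)" using insert J by auto
    \<comment> \<open>Gives the index \<open>k\<close> a free coefficient in the joint phase, so
      that the induction hypothesis for \<open>K\<close> applies.\<close>
    define b where "b t s = (\<lambda>j. if j = k then t else s * a j)" for t s
    have split: "(\<Sum>j\<in>J - K. b t s j * Z j \<omega>) = t * Z k \<omega> + s * (\<Sum>j\<in>J - insert k K. a j * Z j \<omega>)" for t s Z \<omega>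
    proof -
      have "(\<Sum>j\<in>J - insert k K. b t s j * Z j \<omega>) = (\<Sum>j\<in>J - insert k K. s * (a j * Z j \<omega>))"
        by (intro sum.cong) (auto simp: b_def)
      then show ?thesis unfolding JK(1) using JK(2) by (simp add: b_def sum_distrib_left)
    qed
    define Q where "Q Z \<omega> = (\<Prod>k\<in>K. indicator (B k) (Z k \<omega>)) * cos ((\<Sum>j\<in>J - insert k K. a j * Z j \<omega>) + p)"
      for Z :: "'i \<Rightarrow> 'a \<Rightarrow> real" and \<omega>
    have Q [measurable]: "Q Z \<in> borel_measurable M" if [measurable]: "\<And>j. Z j \<in> borel_measurable M" for Z
      unfolding Q_def by measurable
    have Q1: "\<bar>Q Z \<omega>\<bar> \<le> 1" for Z \<omega>
      unfolding Q_def abs_mult by (intro mult_le_one) (auto simp: abs_of_nonneg[OF prod01(1)] prod01(2))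
    \<comment> \<open>The product formula for cosines merges the separate phase in
      \<open>Z k\<close> into the joint one, leaving two means covered by the induction
      hypothesis.\<close>
    have cosQE: "expectation (\<lambda>\<omega>. Q Z \<omega> * cos (t * Z k \<omega> + q))
        = expectation (P Z K (b t 1) (p + q)) / 2 + expectation (P Z K (b (- t) 1) (p - q)) / 2"
      if Z [measurable]: "\<And>j. Z j \<in> borel_measurable M" for Z t q
    proof -
      have "Q Z \<omega> * cos (t * Z k \<omega> + q) = P Z K (b t 1) (p + q) \<omega> * (1/2) + P Z K (b (- t) 1) (p - q) \<omega> * (1/2)" for \<omega>
      proof -
        let ?S = "\<Sum>j\<in>J - insert k K. a j * Z j \<omega>"
        have gen: "(R * c1) * c2 = R * u * (1/2) + R * v * (1/2)" if "c1 * c2 = (u + v) / 2" for R c1 c2 u v :: real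
        proof -
          have "(R * c1) * c2 = R * (c1 * c2)" by simp
          then show ?thesis unfolding that by (simp add: algebra_simps)
        qed
        have "cos (?S + p) * cos (t * Z k \<omega> + q) = (cos ((t * Z k \<omega> + 1 * ?S) + (p + q)) + cos ((- t * Z k \<omega> + 1 * ?S) + (p - q))) / 2"
          unfolding cos_times_cos by (simp add: algebra_simps)
        then show ?thesis unfolding Q_def P_def split by (rule gen)
      qed
      note * = this
      have "expectation (\<lambda>\<omega>. P Z K (b t 1) (p + q) \<omega> * (1/2) + P Z K (b (- t) 1) (p - q) \<omega> * (1/2))
          = expectation (\<lambda>\<omega>. P Z K (b t 1) (p + q) \<omega> * (1/2)) + expectation (\<lambda>\<omega>. P Z K (b (- t) 1) (p - q) \<omega> * (1/2))"
        by (intro Bochner_Integration.integral_add bint P Z P1)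
      then show ?thesis unfolding * by simp
    qed
    have QE: "expectation (\<lambda>\<omega>. Q X \<omega> * cos (t * X k \<omega> + q)) = expectation (\<lambda>\<omega>. Q Y \<omega> * cos (t * Y k \<omega> + q))" for t q
    proof -
      have "expectation (P X K c r) = expectation (P Y K c r)" for c r using insert by simp
      then show ?thesis by (simp only: cosQE[of X t q, OF X] cosQE[of Y t q, OF Y])
    qed
    have "expectation (P Z {} (\<lambda>j. if j = k then t else 0) q) = expectation (\<lambda>\<omega>. cos (t * Z k \<omega> + q))" for Z t q
      unfolding P_def using k(1) J by (simp add: if_distrib[of "\<lambda>x. x * _"] sum.delta' cong: if_cong)
    then have E1: "expectation (\<lambda>\<omega>. cos (t * X k \<omega> + q)) = expectation (\<lambda>\<omega>. cos (t * Y k \<omega> + q))" for t q using base by metis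
    have QB: "expectation (\<lambda>\<omega>. (2 + Q X \<omega>) * indicator (B k) (X k \<omega>)) = expectation (\<lambda>\<omega>. (2 + Q Y \<omega>) * indicator (B k) (Y k \<omega>))"
    proof (rule weighted_law_eqI)
      have q: "1 \<le> 2 + Q Z \<omega>" "2 + Q Z \<omega> \<le> 3" for Z \<omega> using Q1[of Z \<omega>] by (auto simp: abs_le_iff)
      show "1 \<le> 2 + Q X \<omega>" "2 + Q X \<omega> \<le> 3" "1 \<le> 2 + Q Y \<omega>" "2 + Q Y \<omega> \<le> 3" for \<omega> by (rule q)+
      have *: "expectation (\<lambda>\<omega>. (2 + Q Z \<omega>) * cos (t * Z k \<omega> + q)) = expectation (\<lambda>\<omega>. cos (t * Z k \<omega> + q)) * 2 + expectation (\<lambda>\<omega>. Q Z \<omega> * cos (t * Z k \<omega> + q))"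
        if [measurable]: "\<And>j. Z j \<in> borel_measurable M" for Z t q
      proof -
        have "integrable M (\<lambda>\<omega>. cos (t * Z k \<omega> + q) * 2)" by (rule bint) auto
        moreover have "integrable M (\<lambda>\<omega>. (Q Z \<omega> * cos (t * Z k \<omega> + q)) * 1)"
          by (rule bint) (use Q1 that in \<open>auto simp: abs_mult intro!: mult_le_one\<close>)
        ultimately show ?thesis
          by (simp add: distrib_right mult.commute[of 2] Bochner_Integration.integral_add)
      qed
      show "expectation (\<lambda>\<omega>. (2 + Q X \<omega>) * cos (t * X k \<omega> + q)) = expectation (\<lambda>\<omega>. (2 + Q Y \<omega>) * cos (t * Y k \<omega> + q))" for t q
        unfolding *[of X t q, OF X] *[of Y t q, OF Y] E1 QE ..
    qed (use B in auto)
    \<comment> \<open>\<open>Q\<close> may be negative, so the weight was shifted by 2; the law of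
      the single variable with index \<open>k\<close> removes the shift.\<close>
    have E2: "expectation (\<lambda>\<omega>. 2 * indicator (B k) (X k \<omega>) :: real) = expectation (\<lambda>\<omega>. 2 * indicator (B k) (Y k \<omega>))"
      by (rule weighted_law_eqI) (use E1 B in auto)
    have fin: "expectation (P Z (insert k K) a p) = expectation (\<lambda>\<omega>. (2 + Q Z \<omega>) * indicator (B k) (Z k \<omega>)) - expectation (\<lambda>\<omega>. 2 * indicator (B k) (Z k \<omega>))"
      if [measurable]: "\<And>j. Z j \<in> borel_measurable M" for Z
    proof -
      have "integrable M (\<lambda>\<omega>. (2 + Q Z \<omega>) * indicator (B k) (Z k \<omega>))"
      proof (rule integrable_const_bound[of _ 3])
        have "\<bar>2 + Q Z \<omega>\<bar> \<le> 3" for \<omega> using Q1[of Z \<omega>] by linarith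
        then show "AE \<omega> in M. norm ((2 + Q Z \<omega>) * indicator (B k) (Z k \<omega>)) \<le> 3"
          by (intro AE_I2) (auto split: split_indicator)
      qed measurable
      moreover have "integrable M (\<lambda>\<omega>. 2 * indicator (B k) (Z k \<omega>) :: real)"
        by (rule integrable_const_bound[of _ 2]) (auto split: split_indicator)
      ultimately have "expectation (\<lambda>\<omega>. (2 + Q Z \<omega>) * indicator (B k) (Z k \<omega>)) - expectation (\<lambda>\<omega>. 2 * indicator (B k) (Z k \<omega>))
          = expectation (\<lambda>\<omega>. (2 + Q Z \<omega>) * indicator (B k) (Z k \<omega>) - 2 * indicator (B k) (Z k \<omega>))"
        by (rule Bochner_Integration.integral_diff[symmetric])
      also have "\<dots> = expectation (P Z (insert k K) a p)"
        unfolding P_def Q_def using insert.hyps by (intro Bochner_Integration.integral_cong) (auto simp: algebra_simps)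
      finally show ?thesis by simp
    qed
    show ?case unfolding fin[of X, OF X] fin[of Y, OF Y] QB E2 ..
  qed
  from this[of J "\<lambda>_. 0" 0] have "expectation (P X J (\<lambda>_. 0) 0) = expectation (P Y J (\<lambda>_. 0) 0)" by simp
  moreover have "expectation (P Z J (\<lambda>_. 0) 0) = prob {\<omega> \<in> space M. \<forall>j\<in>J. Z j \<omega> \<in> B j}" if [measurable]: "\<And>j. Z j \<in> borel_measurable M" for Z
  proof -
    have "P Z J (\<lambda>_. 0) 0 \<omega> = indicator {\<omega> \<in> space M. \<forall>j\<in>J. Z j \<omega> \<in> B j} \<omega>" if "\<omega> \<in> space M" for \<omega>
    proof (cases "\<forall>j\<in>J. Z j \<omega> \<in> B j")
      case False
      then have "(\<Prod>k\<in>J. indicator (B k) (Z k \<omega>) :: real) = 0" using J by (intro prod_zero) (auto simp: indicator_eq_0_iff)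
      then show ?thesis using False by (auto simp: P_def)
    qed (use that in \<open>auto simp: P_def\<close>)
    then have "expectation (P Z J (\<lambda>_. 0) 0) = expectation (indicator {\<omega> \<in> space M. \<forall>j\<in>J. Z j \<omega> \<in> B j})"
      by (intro Bochner_Integration.integral_cong) auto
    also have "\<dots> = prob {\<omega> \<in> space M. \<forall>j\<in>J. Z j \<omega> \<in> B j}"
    proof -
      have "{\<omega> \<in> space M. \<forall>j\<in>J. Z j \<omega> \<in> B j} \<in> events" using J by measurable
      then show ?thesis by simp
    qed
    finally show ?thesis .
  qed
  ultimately show ?thesis using X Y by simp
qed

text \<open>The double factorial \<open>(2k - 1)!!\<close>, the moment of order \<open>2k\<close> of
  the standard normal law.\<close>

definition gauss_const :: "nat \<Rightarrow> real" where
  "gauss_const k = fact (2 * k) / (2 ^ k * fact k)"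

lemma gauss_const_simps [simp]: "gauss_const 0 = 1" "gauss_const 1 = 1" "gauss_const (Suc 0) = 1" "0 \<le> gauss_const k"
  by (simp_all add: gauss_const_def)

text \<open>The variance \<open>v\<close> covers both cases of \<open>centred_gaussian\<close>, with
  the point mass at \<open>v = 0\<close>; there \<open>0 ^ 0 = 1\<close> keeps the moment formula
  valid for \<open>k = 0\<close>.\<close>

lemma centred_gaussian_moment_aux:
  assumes "centred_gaussian \<mu>"
  obtains v where "0 \<le> v" "\<And>k. integrable \<mu> (\<lambda>x. x ^ (2 * k))" "\<And>k. (\<integral>x. x ^ (2 * k) \<partial>\<mu>) = gauss_const k * v ^ k"
    "\<mu> = (if v = 0 then return borel 0 else density lborel (normal_density 0 (sqrt v)))"
  using assms unfolding centred_gaussian_def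
proof (elim disjE exE conjE)
  assume \<mu>: "\<mu> = return borel 0"
  have "(0::real) ^ (2 * k) = gauss_const k * 0 ^ k" for k by (cases k) auto
  then show ?thesis by (intro that[of 0]) (auto simp: \<mu> integral_return integrable_iff_bounded nn_integral_return)
next
  fix s :: real assume s: "s > 0" and \<mu>: "\<mu> = density lborel (normal_density 0 s)"
  have m: "has_bochner_integral lborel (\<lambda>x. normal_density 0 s x * x ^ (2 * k)) (gauss_const k * (s\<^sup>2) ^ k)" for k
    using normal_moment_even[OF s, of 0 k] s by (simp add: gauss_const_def power_divide)
  show ?thesis
  proof (rule that[of "s\<^sup>2"])
    show "integrable \<mu> (\<lambda>x. x ^ (2 * k))" for k
      unfolding \<mu> using m[of k] by (subst integrable_density) (auto simp: has_bochner_integral_iff)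
    show "(\<integral>x. x ^ (2 * k) \<partial>\<mu>) = gauss_const k * (s\<^sup>2) ^ k" for k
      unfolding \<mu> using m[of k] by (subst integral_density) (auto simp: has_bochner_integral_iff)
  qed (use s \<mu> in auto)
qed

lemma centred_gaussian_moment:
  assumes "centred_gaussian \<mu>"
  shows "integrable \<mu> (\<lambda>x. x ^ (2 * k))" "(\<integral>x. x ^ (2 * k) \<partial>\<mu>) = gauss_const k * (\<integral>x. x\<^sup>2 \<partial>\<mu>) ^ k"
proof -
  obtain v where v: "\<And>k. integrable \<mu> (\<lambda>x. x ^ (2 * k))" "\<And>k. (\<integral>x. x ^ (2 * k) \<partial>\<mu>) = gauss_const k * v ^ k"
    using centred_gaussian_moment_aux[OF assms] by metis
  show "integrable \<mu> (\<lambda>x. x ^ (2 * k))" by (rule v)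
  show "(\<integral>x. x ^ (2 * k) \<partial>\<mu>) = gauss_const k * (\<integral>x. x\<^sup>2 \<partial>\<mu>) ^ k"
    using v(2)[of 1] v(2)[of k] by simp
qed

lemma centred_gaussian_unique:
  assumes "centred_gaussian \<mu>" "centred_gaussian \<nu>" "(\<integral>x. x\<^sup>2 \<partial>\<mu>) = (\<integral>x. x\<^sup>2 \<partial>\<nu>)"
  shows "\<mu> = \<nu>"
proof -
  obtain v where v: "\<And>k. (\<integral>x. x ^ (2 * k) \<partial>\<mu>) = gauss_const k * v ^ k"
    "\<mu> = (if v = 0 then return borel 0 else density lborel (normal_density 0 (sqrt v)))"
    using centred_gaussian_moment_aux[OF assms(1)] by metis
  obtain v' where v': "\<And>k. (\<integral>x. x ^ (2 * k) \<partial>\<nu>) = gauss_const k * v' ^ k"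
    "\<nu> = (if v' = 0 then return borel 0 else density lborel (normal_density 0 (sqrt v')))"
    using centred_gaussian_moment_aux[OF assms(2)] by metis
  show ?thesis using v(1)[of 1] v'(1)[of 1] v(2) v'(2) assms(3) by simp
qed

lemma (in prob_space) centred_gaussian_diff:
  assumes indep: "indep_var borel X borel Y" and X: "distr M borel X = \<mu>" and Y: "distr M borel Y = \<mu>"
    and \<mu>: "centred_gaussian \<mu>"
  shows "distr M borel (\<lambda>\<omega>. (X \<omega> - Y \<omega>) / sqrt 2) = \<mu>"
proof -
  have [measurable]: "X \<in> borel_measurable M" "Y \<in> borel_measurable M"
    using indep by (auto dest: indep_var_rv1 indep_var_rv2)
  from \<mu> show ?thesis unfolding centred_gaussian_def
  proof (elim disjE exE conjE)
    assume r: "\<mu> = return borel 0"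
    have 0: "AE \<omega> in M. Z \<omega> = 0" if [measurable]: "Z \<in> borel_measurable M" and "distr M borel Z = \<mu>" for Z
    proof -
      have "AE x in distr M borel Z. x = 0" unfolding that(2) r by (subst AE_return) auto
      then show ?thesis by (subst (asm) AE_distr_iff) auto
    qed
    have "distr M borel (\<lambda>\<omega>. (X \<omega> - Y \<omega>) / sqrt 2) = distr M borel (\<lambda>_. 0 :: real)"
    proof (rule distr_cong_AE)
      show "AE \<omega> in M. (X \<omega> - Y \<omega>) / sqrt 2 = 0"
        using 0[of X] 0[of Y] X Y by auto
    qed auto
    also have "\<dots> = return borel 0" by (rule distr_const) auto
    finally show ?thesis unfolding r .
  next
    fix s :: real assume s: "s > 0" and r: "\<mu> = density lborel (normal_density 0 s)"
    have d: "distributed M lborel Z (normal_density 0 s)" if "Z \<in> borel_measurable M" "distr M borel Z = \<mu>" for Z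
      using that r unfolding distributed_def by (auto simp: distr_cong[of M M lborel borel Z Z])
    have "distributed M lborel (\<lambda>x. X x - Y x) (normal_density (0 - 0) (sqrt (s\<^sup>2 + s\<^sup>2)))"
      by (rule diff_indep_normal[OF indep s s d d]) (use X Y in auto)
    also have "sqrt (s\<^sup>2 + s\<^sup>2) = sqrt 2 * s" using s by (simp add: real_sqrt_mult flip: mult_2)
    finally have "distributed M lborel (\<lambda>x. 0 + (1 / sqrt 2) * (X x - Y x)) (normal_density (0 + (1 / sqrt 2) * 0) (\<bar>1 / sqrt 2\<bar> * (sqrt 2 * s)))"
      by (intro normal_density_affine) (use s in auto)
    then have "distributed M lborel (\<lambda>x. (X x - Y x) / sqrt 2) (normal_density 0 s)" by simp
    then show ?thesis unfolding r distributed_def by (auto simp: distr_cong[of M M lborel borel])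
  qed
qed

lemma centred_gaussian_process_measurable:
  assumes "centred_gaussian_process M c X"
  shows "(\<lambda>\<omega>. X \<omega> z) \<in> borel_measurable M"
proof -
  have "X \<in> measurable M (PiM UNIV (\<lambda>_. borel))" using assms by (simp add: centred_gaussian_process_def)
  from measurable_compose[OF this measurable_component_singleton[of z UNIV "\<lambda>_. borel"]] show ?thesis by simp
qed

text \<open>\<open>p\<close> may repeat points, whereas the finite-dimensional laws are indexed by
  sets; coefficients of equal points are added up.\<close>

lemma centred_gaussian_process_lincomb:
  assumes gp: "centred_gaussian_process M c X" and I: "finite I"
  shows "centred_gaussian (distr M borel (\<lambda>\<omega>. \<Sum>k\<in>I. b k * X \<omega> (p k)))"
proof -
  note [measurable] = centred_gaussian_process_measurable[OF gp]
  let ?F = "p ` I"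
  define a where "a z = (\<Sum>k | k \<in> I \<and> p k = z. b k)" for z
  have "(\<Sum>k\<in>I. b k * X \<omega> (p k)) = (\<Sum>z\<in>?F. a z * restrict (X \<omega>) ?F z)" for \<omega>
  proof -
    have "(\<Sum>k\<in>I. b k * X \<omega> (p k)) = (\<Sum>z\<in>?F. \<Sum>k | k \<in> I \<and> p k = z. b k * X \<omega> (p k))"
      using I by (intro sum.group[symmetric]) auto
    also have "\<dots> = (\<Sum>z\<in>?F. a z * X \<omega> z)"
      unfolding a_def by (intro sum.cong) (auto simp: sum_distrib_right)
    finally show ?thesis by simp
  qed
  then have "distr M borel (\<lambda>\<omega>. \<Sum>k\<in>I. b k * X \<omega> (p k))
      = distr (distr M (PiM ?F (\<lambda>_. borel)) (\<lambda>\<omega>. restrict (X \<omega>) ?F)) borel (\<lambda>f. \<Sum>z\<in>?F. a z * f z)"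
    by (subst distr_distr) (auto simp: comp_def intro!: measurable_restrict)
  moreover have "centred_gaussian_PiM ?F (distr M (PiM ?F (\<lambda>_. borel)) (\<lambda>\<omega>. restrict (X \<omega>) ?F))"
    using gp I by (auto simp: centred_gaussian_process_def)
  ultimately show ?thesis by (simp add: centred_gaussian_PiM_def)
qed

text \<open>The covariance equation does not by itself give integrability, since the integral of a
  non-integrable product is 0 by convention; it comes from the Gaussian marginals.\<close>

lemma centred_gaussian_process_products:
  assumes gp: "centred_gaussian_process M c X"
  shows "integrable M (\<lambda>\<omega>. X \<omega> y * X \<omega> z)" "(\<integral>\<omega>. X \<omega> y * X \<omega> z \<partial>M) = c y z"
proof -
  note [measurable] = centred_gaussian_process_measurable[OF gp]
  have sq: "integrable M (\<lambda>\<omega>. (X \<omega> z)\<^sup>2)" for z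
  proof -
    have "centred_gaussian (distr M borel (\<lambda>\<omega>. X \<omega> z))"
      using centred_gaussian_process_lincomb[OF gp, of "{()}" "\<lambda>_. 1" "\<lambda>_. z"] by simp
    from centred_gaussian_moment(1)[OF this, of 1] show ?thesis
      by (simp add: integrable_distr_eq)
  qed
  show "integrable M (\<lambda>\<omega>. X \<omega> y * X \<omega> z)"
  proof (rule Bochner_Integration.integrable_bound)
    show "integrable M (\<lambda>\<omega>. (X \<omega> y)\<^sup>2 + (X \<omega> z)\<^sup>2)" by (intro Bochner_Integration.integrable_add sq)
    have "\<bar>u * v\<bar> \<le> u\<^sup>2 + v\<^sup>2" for u v :: real
      using sum_squares_bound[of u v] sum_squares_bound[of u "- v"] zero_le_power2[of u] zero_le_power2[of v] by (auto simp: abs_le_iff)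
    then show "AE \<omega> in M. norm (X \<omega> y * X \<omega> z) \<le> norm ((X \<omega> y)\<^sup>2 + (X \<omega> z)\<^sup>2)" by (intro AE_I2) simp
  qed measurable
  show "(\<integral>\<omega>. X \<omega> y * X \<omega> z \<partial>M) = c y z" using gp by (simp add: centred_gaussian_process_def)
qed

lemma centred_gaussian_process_increments:
  fixes b :: "'k \<Rightarrow> real" and p :: "'k \<Rightarrow> 'i" and x :: 'i
  assumes gp: "centred_gaussian_process M c X" and I: "finite I"
  defines "S \<equiv> \<lambda>\<omega>. \<Sum>k\<in>I. b k * (X \<omega> (p k) - X \<omega> x)"
    and "V \<equiv> \<Sum>k\<in>I. \<Sum>l\<in>I. b k * b l * (c (p k) (p l) - c (p k) x - c x (p l) + c x x)"
  shows "centred_gaussian (distr M borel S)" and "(\<integral>x. x\<^sup>2 \<partial>distr M borel S) = V" and "0 \<le> V"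
    and "(\<integral>\<^sup>+\<omega>. ennreal (S \<omega> ^ (2 * n)) \<partial>M) = ennreal (gauss_const n * V ^ n)"
proof -
  note [measurable] = centred_gaussian_process_measurable[OF gp]
  have S [measurable]: "S \<in> borel_measurable M" unfolding S_def by measurable
  \<comment> \<open>The base point \<open>x\<close> gets the extra index \<open>None\<close>, with
    minus the sum of the other coefficients.\<close>
  have "S \<omega> = (\<Sum>k\<in>insert None (Some ` I). (case k of None \<Rightarrow> - (\<Sum>k\<in>I. b k) | Some k \<Rightarrow> b k) * X \<omega> (case k of None \<Rightarrow> x | Some k \<Rightarrow> p k))" for \<omega>
    using I by (simp add: S_def sum.reindex right_diff_distrib sum_subtractf sum_distrib_right image_iff)
  then have "S = (\<lambda>\<omega>. \<Sum>k\<in>insert None (Some ` I). (case k of None \<Rightarrow> - (\<Sum>k\<in>I. b k) | Some k \<Rightarrow> b k) * X \<omega> (case k of None \<Rightarrow> x | Some k \<Rightarrow> p k))" by auto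
  then show g: "centred_gaussian (distr M borel S)"
    using centred_gaussian_process_lincomb[OF gp, of "insert None (Some ` I)"
      "\<lambda>k. case k of None \<Rightarrow> - (\<Sum>k\<in>I. b k) | Some k \<Rightarrow> b k" "\<lambda>k. case k of None \<Rightarrow> x | Some k \<Rightarrow> p k"] I by simp
  note pr = centred_gaussian_process_products[OF gp]
  have D: "integrable M (\<lambda>\<omega>. (X \<omega> y - X \<omega> x) * (X \<omega> z - X \<omega> x))"
    "(\<integral>\<omega>. (X \<omega> y - X \<omega> x) * (X \<omega> z - X \<omega> x) \<partial>M) = c y z - c y x - c x z + c x x" for y z
  proof -
    have eq: "(X \<omega> y - X \<omega> x) * (X \<omega> z - X \<omega> x) = X \<omega> y * X \<omega> z - X \<omega> y * X \<omega> x - X \<omega> x * X \<omega> z + X \<omega> x * X \<omega> x" for \<omega>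
      by (simp add: algebra_simps)
    show "integrable M (\<lambda>\<omega>. (X \<omega> y - X \<omega> x) * (X \<omega> z - X \<omega> x))"
      unfolding eq by (intro Bochner_Integration.integrable_add Bochner_Integration.integrable_diff pr)
    show "(\<integral>\<omega>. (X \<omega> y - X \<omega> x) * (X \<omega> z - X \<omega> x) \<partial>M) = c y z - c y x - c x z + c x x"
      unfolding eq by (simp add: pr)
  qed
  have "(\<integral>x. x\<^sup>2 \<partial>distr M borel S) = (\<integral>\<omega>. (S \<omega>)\<^sup>2 \<partial>M)" by (rule integral_distr) auto
  also have "\<dots> = (\<integral>\<omega>. (\<Sum>k\<in>I. \<Sum>l\<in>I. b k * b l * ((X \<omega> (p k) - X \<omega> x) * (X \<omega> (p l) - X \<omega> x))) \<partial>M)"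
    by (intro Bochner_Integration.integral_cong) (auto simp: S_def power2_eq_square sum_product mult_ac)
  also have "\<dots> = V"
    unfolding V_def by (simp add: D)
  finally show eq: "(\<integral>x. x\<^sup>2 \<partial>distr M borel S) = V" .
  then show "0 \<le> V" by (metis integral_nonneg_AE AE_I2 zero_le_power2)
  have "(\<integral>\<^sup>+\<omega>. ennreal (S \<omega> ^ (2 * n)) \<partial>M) = (\<integral>\<^sup>+x. ennreal (x ^ (2 * n)) \<partial>distr M borel S)"
    by (subst nn_integral_distr) auto
  also have "\<dots> = ennreal (\<integral>x. x ^ (2 * n) \<partial>distr M borel S)"
    by (intro nn_integral_eq_integral centred_gaussian_moment g) auto
  finally show "(\<integral>\<^sup>+\<omega>. ennreal (S \<omega> ^ (2 * n)) \<partial>M) = ennreal (gauss_const n * V ^ n)"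
    using centred_gaussian_moment(2)[OF g, of n] eq by simp
qed

section \<open>The squared exponential kernel\<close>

lemma sq_exp_0 [simp]: "sq_exp \<sigma> w 0 = \<sigma>\<^sup>2"
  by (simp add: sq_exp_def)

text \<open>First-order Taylor expansion in \<open>d^2 / (2 * w^2)\<close>; its error of order
  \<open>d^4\<close> is what gives affine defects a variance of order \<open>r^4\<close>.\<close>

lemma sq_exp_expansion:
  assumes "w\<^sup>2 > 0"
  shows "\<bar>sq_exp \<sigma> w d - \<sigma>\<^sup>2 * (1 - d\<^sup>2 / (2 * w\<^sup>2))\<bar> \<le> \<sigma>\<^sup>2 * d ^ 4 / (8 * w ^ 4)"
proof -
  define u where "u = d\<^sup>2 / (2 * w\<^sup>2)"
  have u: "u \<ge> 0" using assms by (simp add: u_def)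
  have lo: "1 - u \<le> exp (- u)" using exp_ge_add_one_self[of "- u"] by simp
  have hi: "exp (- u) \<le> 1 - u + u\<^sup>2 / 2"
  proof -
    have "exp (- u) * (1 + u + u\<^sup>2 / 2) \<le> exp (- u) * exp u"
      using exp_lower_Taylor_quadratic[OF u] by (intro mult_left_mono) auto
    also have "\<dots> = 1" by (simp flip: exp_add)
    \<comment> \<open>A difference of squares:
      \<open>(1 + u^2 / 2)^2 - u^2 = 1 + u^4 / 4\<close>.\<close>
    also have "1 \<le> (1 - u + u\<^sup>2 / 2) * (1 + u + u\<^sup>2 / 2)"
    proof -
      have "(1 - u + u\<^sup>2 / 2) * (1 + u + u\<^sup>2 / 2) = 1 + u ^ 4 / 4"
        by (simp add: algebra_simps power2_eq_square power4_eq_xxxx)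
      then show ?thesis by simp
    qed
    finally show ?thesis by (rule mult_right_le_imp_le) (use u in \<open>auto intro: add_pos_nonneg\<close>)
  qed
  have "sq_exp \<sigma> w d - \<sigma>\<^sup>2 * (1 - d\<^sup>2 / (2 * w\<^sup>2)) = \<sigma>\<^sup>2 * (exp (- u) - (1 - u))"
    by (simp add: sq_exp_def u_def right_diff_distrib)
  also have "\<bar>\<dots>\<bar> \<le> \<sigma>\<^sup>2 * (u\<^sup>2 / 2)" unfolding abs_mult using lo hi by (intro mult_mono) auto
  also have "\<dots> = \<sigma>\<^sup>2 * d ^ 4 / (8 * w ^ 4)"
    by (simp add: u_def power_divide power_mult_distrib flip: power_mult)
  finally show ?thesis .
qed

lemma sq_exp_bounds:
  assumes "w\<^sup>2 > 0"
  shows "0 \<le> sq_exp \<sigma> w d" "sq_exp \<sigma> w d \<le> \<sigma>\<^sup>2" "\<sigma>\<^sup>2 * (1 - d\<^sup>2 / (2 * w\<^sup>2)) \<le> sq_exp \<sigma> w d"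
proof -
  show "0 \<le> sq_exp \<sigma> w d" by (simp add: sq_exp_def)
  show "sq_exp \<sigma> w d \<le> \<sigma>\<^sup>2" using assms by (auto simp: sq_exp_def intro!: mult_left_le)
  show "\<sigma>\<^sup>2 * (1 - d\<^sup>2 / (2 * w\<^sup>2)) \<le> sq_exp \<sigma> w d"
    using exp_ge_add_one_self[of "- (d\<^sup>2 / (2 * w\<^sup>2))"] by (auto simp: sq_exp_def intro!: mult_left_mono)
qed

section \<open>Flows of Gaussian processes\<close>

lemma norm_power2_cart: "(norm v)\<^sup>2 = (\<Sum>i\<in>UNIV. (v $ i)\<^sup>2)" for v :: "real ^ 'm"
  unfolding power2_norm_eq_inner by (simp add: inner_vec_def power2_eq_square)

lemma norm_power_even_le:
  fixes v :: "real ^ 'm"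
  shows "norm v ^ (2 * k) \<le> real CARD('m) ^ k * (\<Sum>i\<in>UNIV. (v $ i) ^ (2 * k))"
proof -
  define a where "a = Max ((\<lambda>i. (v $ i)\<^sup>2) ` UNIV)"
  have "a \<in> (\<lambda>i. (v $ i)\<^sup>2) ` UNIV" unfolding a_def by (intro Max_in) auto
  then obtain i where i: "a = (v $ i)\<^sup>2" by auto
  have "(norm v)\<^sup>2 \<le> (\<Sum>i\<in>(UNIV :: 'm set). a)"
    unfolding norm_power2_cart by (intro sum_mono) (auto simp: a_def)
  then have "((norm v)\<^sup>2) ^ k \<le> (real CARD('m) * a) ^ k" by (intro power_mono) auto
  also have "\<dots> = real CARD('m) ^ k * (v $ i) ^ (2 * k)" by (simp add: i power_mult_distrib power_mult)
  also have "\<dots> \<le> real CARD('m) ^ k * (\<Sum>i\<in>UNIV. (v $ i) ^ (2 * k))"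
    by (intro mult_left_mono member_le_sum) (auto simp: power_mult)
  finally show ?thesis by (simp add: power_mult)
qed

text \<open>The maps are indexed from 0, as the flow uses them. \<open>same_law\<close> concerns the
  two maps whose difference is the reference in the small ball estimate; laws of increments of the
  other maps are identified through \<open>gp\<close>.\<close>

locale gaussian_maps = prob_space M for M :: "'w measure" +
  fixes \<xi> :: "nat \<Rightarrow> 'w \<Rightarrow> real ^ 'm \<Rightarrow> real ^ 'm" and \<sigma> w :: real
  assumes w: "w\<^sup>2 > 0" and subcritical: "\<sigma>\<^sup>2 < w\<^sup>2 / real CARD('m)"
    and indep_maps: "indep_vars (\<lambda>_. fun_sigma) \<xi> UNIV"
    and same_law: "distr M fun_sigma (\<xi> 0) = distr M fun_sigma (\<xi> 1)"
    and cont_maps: "\<And>n \<omega>. \<omega> \<in> space M \<Longrightarrow> continuous_on UNIV (\<xi> n \<omega>)"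
    and indep_components: "\<And>n. indep_vars (\<lambda>_. PiM UNIV (\<lambda>_. borel)) (\<lambda>i \<omega> z. \<xi> n \<omega> z $ i) UNIV"
    and gp: "\<And>n i. centred_gaussian_process M (\<lambda>z z'. sq_exp \<sigma> w (norm (z - z'))) (\<lambda>\<omega> z. \<xi> n \<omega> z $ i)"
begin

lemma measurable_map [measurable]: "\<xi> n \<in> measurable M fun_sigma"
  using indep_maps by (auto simp: indep_vars_def)

lemma measurable_map_value [measurable]: "(\<lambda>\<omega>. \<xi> n \<omega> z) \<in> borel_measurable M"
  using measurable_compose[OF measurable_map measurable_component_singleton[of z UNIV "\<lambda>_. borel"]] by simp

text \<open>The variance is twice the drop of the kernel from distance 0 to
  \<open>norm (y - z)\<close>. Its quadratic bound gives the moments and the contraction, its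
  uniform bound the sublinear growth.\<close>

lemma component_increment_moment:
  obtains V where "0 \<le> V" "V \<le> \<sigma>\<^sup>2 / w\<^sup>2 * (norm (y - z))\<^sup>2" "V \<le> 2 * \<sigma>\<^sup>2"
    "\<And>k. nnexp (\<lambda>\<omega>. (\<xi> n \<omega> y $ i - \<xi> n \<omega> z $ i) ^ (2 * k)) = ennreal (gauss_const k * V ^ k)"
proof -
  note inc = centred_gaussian_process_increments[OF gp[of n i], of "{()}" "\<lambda>_. 1" "\<lambda>_. y" z]
  define V where "V = 2 * (\<sigma>\<^sup>2 - sq_exp \<sigma> w (norm (y - z)))"
  have "V \<le> \<sigma>\<^sup>2 / w\<^sup>2 * (norm (y - z))\<^sup>2"
    using sq_exp_bounds(3)[OF w, of \<sigma> "norm (y - z)"] w by (simp add: V_def field_simps)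
  then show ?thesis
    using inc(3,4) sq_exp_bounds(1)[OF w, of \<sigma> "norm (y - z)"]
    by (intro that[of V]) (simp_all add: V_def norm_minus_commute[of z y])
qed

lemma component_moment_le:
  "nnexp (\<lambda>\<omega>. (\<xi> n \<omega> y $ i - \<xi> n \<omega> z $ i) ^ (2 * k)) \<le> ennreal (gauss_const k * (\<sigma>\<^sup>2 / w\<^sup>2 * (norm (y - z))\<^sup>2) ^ k)"
proof -
  obtain V where "0 \<le> V" "V \<le> \<sigma>\<^sup>2 / w\<^sup>2 * (norm (y - z))\<^sup>2" "V \<le> 2 * \<sigma>\<^sup>2"
    "\<And>k. nnexp (\<lambda>\<omega>. (\<xi> n \<omega> y $ i - \<xi> n \<omega> z $ i) ^ (2 * k)) = ennreal (gauss_const k * V ^ k)"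
    by (rule component_increment_moment[where y=y and z=z and n=n and i=i]) (rule that)
  then show ?thesis by (auto intro!: ennreal_leI mult_left_mono power_mono)
qed

lemma component_variance_le:
  "nnexp (\<lambda>\<omega>. (\<xi> n \<omega> y $ i - \<xi> n \<omega> z $ i)\<^sup>2) \<le> ennreal (2 * \<sigma>\<^sup>2)"
proof -
  obtain V where V: "0 \<le> V" "V \<le> \<sigma>\<^sup>2 / w\<^sup>2 * (norm (y - z))\<^sup>2" "V \<le> 2 * \<sigma>\<^sup>2"
    "\<And>k. nnexp (\<lambda>\<omega>. (\<xi> n \<omega> y $ i - \<xi> n \<omega> z $ i) ^ (2 * k)) = ennreal (gauss_const k * V ^ k)"
    by (rule component_increment_moment[where y=y and z=z and n=n and i=i]) (rule that)
  show ?thesis using V(4)[of 1] V(3) by (simp add: ennreal_leI)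
qed

lemma map_moment:
  "nnexp (\<lambda>\<omega>. norm (\<xi> n \<omega> y - \<xi> n \<omega> z) ^ (2 * k))
    \<le> ennreal (real CARD('m) ^ k * (real CARD('m) * gauss_const k * (\<sigma>\<^sup>2 / w\<^sup>2) ^ k) * norm (y - z) ^ (2 * k))"
proof -
  let ?X = "\<lambda>i \<omega>. (\<xi> n \<omega> y $ i - \<xi> n \<omega> z $ i) ^ (2 * k)" and ?B = "gauss_const k * (\<sigma>\<^sup>2 / w\<^sup>2 * (norm (y - z))\<^sup>2) ^ k"
  have "nnexp (\<lambda>\<omega>. \<Sum>i\<in>UNIV. ?X i \<omega>) \<le> ennreal (\<Sum>i\<in>(UNIV :: 'm set). ?B)"
    by (rule nn_integral_sum_le[OF _ component_moment_le]) (auto simp: power_mult)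
  then have "nnexp (\<lambda>\<omega>. norm (\<xi> n \<omega> y - \<xi> n \<omega> z) ^ (2 * k)) \<le> ennreal (0 + real CARD('m) ^ k * (\<Sum>i\<in>(UNIV :: 'm set). ?B))"
    by (rule nn_integral_affine_le[OF _ prob_space_axioms, rotated -1])
      (use norm_power_even_le[of "\<xi> n _ y - \<xi> n _ z" k] in \<open>auto simp: sum_nonneg power_mult\<close>)
  also have "0 + real CARD('m) ^ k * (\<Sum>i\<in>(UNIV :: 'm set). ?B) = real CARD('m) ^ k * (real CARD('m) * gauss_const k * (\<sigma>\<^sup>2 / w\<^sup>2) ^ k) * norm (y - z) ^ (2 * k)"
  proof -
    have "?B = gauss_const k * ((\<sigma>\<^sup>2 / w\<^sup>2) ^ k * norm (y - z) ^ (2 * k))" by (simp only: power_mult_distrib power_mult)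
    then show ?thesis by (simp add: mult_ac)
  qed
  finally show ?thesis .
qed

lemma map_contraction:
  "nnexp (\<lambda>\<omega>. (norm (\<xi> n \<omega> y - \<xi> n \<omega> z))\<^sup>2) \<le> ennreal ((real CARD('m) * \<sigma>\<^sup>2 / w\<^sup>2) * (norm (y - z))\<^sup>2)"
proof -
  have "nnexp (\<lambda>\<omega>. (norm (\<xi> n \<omega> y - \<xi> n \<omega> z))\<^sup>2) \<le> ennreal (\<Sum>i\<in>(UNIV :: 'm set). \<sigma>\<^sup>2 / w\<^sup>2 * (norm (y - z))\<^sup>2)"
  proof (rule nn_integral_sum_le)
    show "nnexp (\<lambda>\<omega>. (\<xi> n \<omega> y $ i - \<xi> n \<omega> z $ i)\<^sup>2) \<le> ennreal (\<sigma>\<^sup>2 / w\<^sup>2 * (norm (y - z))\<^sup>2)" for i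
      using component_moment_le[of n y i z 1] by simp
  qed (use norm_power2_cart[of "\<xi> n _ y - \<xi> n _ z"] in auto)
  then show ?thesis by (simp add: mult.assoc)
qed

lemma map_bounded_increment:
  "nnexp (\<lambda>\<omega>. norm (\<xi> n \<omega> y - \<xi> n \<omega> z)) \<le> ennreal (1 + 2 * real CARD('m) * \<sigma>\<^sup>2)"
proof -
  have "nnexp (\<lambda>\<omega>. (norm (\<xi> n \<omega> y - \<xi> n \<omega> z))\<^sup>2) \<le> ennreal (\<Sum>i\<in>(UNIV :: 'm set). 2 * \<sigma>\<^sup>2)"
    by (rule nn_integral_sum_le[OF _ component_variance_le]) (auto simp: norm_power2_cart)
  then have "nnexp (\<lambda>\<omega>. norm (\<xi> n \<omega> y - \<xi> n \<omega> z)) \<le> ennreal (1 + 1 * (\<Sum>i\<in>(UNIV :: 'm set). 2 * \<sigma>\<^sup>2))"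
    by (rule nn_integral_affine_le[OF _ prob_space_axioms, rotated -1])
      (use power_le_scaled_power[of 1 _ 1 2] in auto)
  then show ?thesis by (simp add: mult_ac)
qed

text \<open>\<open>(m + 1)^2\<close> pairs of points, each with three kernel errors of at most
  \<open>2 * \<sigma>\<^sup>2 * m^4 / w^4 * r^4\<close>, the distances being at most
  \<open>2 * m * r\<close>.\<close>

definition defect_const :: real where
  "defect_const = real (CARD('m) + 1) ^ 2 * (6 * \<sigma>\<^sup>2 * real CARD('m) ^ 4 / w ^ 4)"

text \<open>The defect combines increments in directions \<open>v\<close> with coefficients
  \<open>b\<close> such that the sum of all \<open>b k *\<^sub>R v k\<close> is 0. The quadratic
  part of the kernel contributes a multiple of the squared norm of this sum, hence nothing; the
  fourth-order errors remain.\<close>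

lemma component_defect_variance:
  assumes u: "u \<in> unit_cube" and r: "r \<ge> 0"
  shows "nnexp (\<lambda>\<omega>. (affine_defect (\<xi> n \<omega>) x r u $ i)\<^sup>2) \<le> ennreal (defect_const * r ^ 4)"
proof -
  let ?m = "real CARD('m)"
  \<comment> \<open>\<open>None\<close> stands for the point \<open>u\<close>, \<open>Some j\<close>
    for the axis points that it is compared with.\<close>
  define v :: "'m option \<Rightarrow> real ^ 'm" where "v k = (case k of None \<Rightarrow> u | Some j \<Rightarrow> axis j 1)" for k
  define b where "b k = (case k of None \<Rightarrow> 1 | Some j \<Rightarrow> - u $ j)" for k
  define p where "p k = x + r *\<^sub>R v k" for k
  define c where "c y z = sq_exp \<sigma> w (norm (y - z))" for y z :: "real ^ 'm"
  define V where "V = (\<Sum>k\<in>UNIV. \<Sum>l\<in>UNIV. b k * b l * (c (p k) (p l) - c (p k) x - c x (p l) + c x x))"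
  have sum_option: "(\<Sum>k\<in>UNIV. f k) = f None + (\<Sum>j\<in>UNIV. f (Some j))" for f :: "'m option \<Rightarrow> 'a :: comm_monoid_add"
    by (simp add: UNIV_option_conv sum.reindex)
  have "affine_defect (\<xi> n \<omega>) x r u $ i = (\<Sum>k\<in>UNIV. b k * (\<xi> n \<omega> (p k) $ i - \<xi> n \<omega> x $ i))" for \<omega>
    by (simp add: sum_option affine_defect_def b_def p_def v_def sum_negf)
  then have int: "nnexp (\<lambda>\<omega>. (affine_defect (\<xi> n \<omega>) x r u $ i)\<^sup>2) = ennreal V"
    using centred_gaussian_process_increments(4)[OF gp[of n i] finite_class.finite_UNIV, of b p x 1] by (simp add: V_def c_def)
  have bv: "(\<Sum>k\<in>UNIV. b k *\<^sub>R v k) = 0"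
    by (simp add: sum_option b_def v_def vec_eq_iff axis_def if_distrib cong: if_cong)
  have v: "norm (v k) \<le> ?m" for k
    using u axis_unit_cube by (intro norm_unit_cube) (auto simp: v_def split: option.split)
  have b: "\<bar>b k\<bar> \<le> 1" for k using u by (auto simp: b_def split: option.split)
  define e where "e d = sq_exp \<sigma> w d - \<sigma>\<^sup>2 * (1 - d\<^sup>2 / (2 * w\<^sup>2))" for d
  have e: "\<bar>e (r * d)\<bar> \<le> 2 * \<sigma>\<^sup>2 * ?m ^ 4 / w ^ 4 * r ^ 4" if "0 \<le> d" "d \<le> 2 * ?m" for d
  proof -
    have "\<bar>e (r * d)\<bar> \<le> \<sigma>\<^sup>2 * (r * d) ^ 4 / (8 * w ^ 4)" unfolding e_def by (rule sq_exp_expansion[OF w])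
    also have "\<dots> \<le> \<sigma>\<^sup>2 * (r * (2 * ?m)) ^ 4 / (8 * w ^ 4)"
      using that r by (intro divide_right_mono mult_left_mono power_mono) auto
    also have "\<dots> = 2 * \<sigma>\<^sup>2 * ?m ^ 4 / w ^ 4 * r ^ 4" by (simp add: power_mult_distrib)
    finally show ?thesis .
  qed
  have c_eq: "c (x + r *\<^sub>R y) (x + r *\<^sub>R z) = \<sigma>\<^sup>2 - \<sigma>\<^sup>2 / (2 * w\<^sup>2) * r\<^sup>2 * (norm (y - z))\<^sup>2 + e (r * norm (y - z))" for y z
  proof -
    have "(x + r *\<^sub>R y) - (x + r *\<^sub>R z) = r *\<^sub>R (y - z)" by (simp add: algebra_simps)
    then have "norm ((x + r *\<^sub>R y) - (x + r *\<^sub>R z)) = r * norm (y - z)" using r by simp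
    then show ?thesis unfolding c_def e_def by (simp add: power_mult_distrib algebra_simps)
  qed
  define t where "t k l = e (r * norm (v k - v l)) - e (r * norm (v k)) - e (r * norm (v l))" for k l
  have t: "\<bar>t k l\<bar> \<le> 6 * \<sigma>\<^sup>2 * ?m ^ 4 / w ^ 4 * r ^ 4" for k l
  proof -
    have "norm (v k - v l) \<le> 2 * ?m" using norm_triangle_ineq4[of "v k" "v l"] v[of k] v[of l] by linarith
    moreover have "norm (v k) \<le> 2 * ?m" "norm (v l) \<le> 2 * ?m" using v[of k] v[of l] by linarith+
    ultimately show ?thesis
      using e[of "norm (v k - v l)"] e[of "norm (v k)"] e[of "norm (v l)"] unfolding t_def by simp
  qed
  have "c (p k) (p l) - c (p k) x - c x (p l) + c x x = \<sigma>\<^sup>2 / w\<^sup>2 * r\<^sup>2 * (v k \<bullet> v l) + t k l" for k l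
  proof -
    define A where "A = \<sigma>\<^sup>2 / (2 * w\<^sup>2) * r\<^sup>2"
    have "c (p k) (p l) = \<sigma>\<^sup>2 - A * (norm (v k - v l))\<^sup>2 + e (r * norm (v k - v l))"
      "c (p k) x = \<sigma>\<^sup>2 - A * (norm (v k))\<^sup>2 + e (r * norm (v k))"
      "c x (p l) = \<sigma>\<^sup>2 - A * (norm (v l))\<^sup>2 + e (r * norm (v l))" "c x x = \<sigma>\<^sup>2"
      using c_eq[of "v k" "v l"] c_eq[of "v k" 0] c_eq[of 0 "v l"] by (simp_all add: p_def A_def c_def)
    then have "c (p k) (p l) - c (p k) x - c x (p l) + c x x
        = A * ((norm (v k))\<^sup>2 + (norm (v l))\<^sup>2 - (norm (v k - v l))\<^sup>2) + t k l"
      by (simp add: t_def algebra_simps)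
    moreover have "(norm (v k))\<^sup>2 + (norm (v l))\<^sup>2 - (norm (v k - v l))\<^sup>2 = 2 * (v k \<bullet> v l)"
      by (simp add: power2_norm_eq_inner inner_diff inner_commute)
    ultimately show ?thesis by (simp add: A_def)
  qed
  then have "V = (\<Sum>k\<in>UNIV. \<Sum>l\<in>UNIV. \<sigma>\<^sup>2 / w\<^sup>2 * r\<^sup>2 * ((b k *\<^sub>R v k) \<bullet> (b l *\<^sub>R v l)) + b k * b l * t k l)"
    unfolding V_def by (intro sum.cong refl) (simp add: algebra_simps)
  also have "\<dots> = \<sigma>\<^sup>2 / w\<^sup>2 * r\<^sup>2 * ((\<Sum>k\<in>UNIV. b k *\<^sub>R v k) \<bullet> (\<Sum>l\<in>UNIV. b l *\<^sub>R v l)) + (\<Sum>k\<in>UNIV. \<Sum>l\<in>UNIV. b k * b l * t k l)"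
  proof -
    have "(\<Sum>k\<in>UNIV. b k *\<^sub>R v k) \<bullet> (\<Sum>l\<in>UNIV. b l *\<^sub>R v l) = (\<Sum>k\<in>UNIV. \<Sum>l\<in>UNIV. (b k *\<^sub>R v k) \<bullet> (b l *\<^sub>R v l))"
      unfolding inner_sum_left inner_sum_right by (rule sum.swap)
    then show ?thesis by (simp only: sum.distrib sum_distrib_left)
  qed
  also have "\<dots> = (\<Sum>k\<in>UNIV. \<Sum>l\<in>UNIV. b k * b l * t k l)" by (simp add: bv)
  also have "\<dots> \<le> (\<Sum>k\<in>(UNIV :: 'm option set). \<Sum>l\<in>(UNIV :: 'm option set). 6 * \<sigma>\<^sup>2 * ?m ^ 4 / w ^ 4 * r ^ 4)"
  proof (intro sum_mono)
    fix k l
    have "b k * b l * t k l \<le> \<bar>b k\<bar> * \<bar>b l\<bar> * \<bar>t k l\<bar>" by (simp flip: abs_mult)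
    also have "\<dots> \<le> (1 * 1) * (6 * \<sigma>\<^sup>2 * ?m ^ 4 / w ^ 4 * r ^ 4)" by (intro mult_mono b t) auto
    finally show "b k * b l * t k l \<le> 6 * \<sigma>\<^sup>2 * ?m ^ 4 / w ^ 4 * r ^ 4" by simp
  qed
  also have "\<dots> = defect_const * r ^ 4"
    by (simp add: defect_const_def card_UNIV_option power2_eq_square)
  finally show ?thesis unfolding int by (rule ennreal_leI)
qed

lemma map_affine_defect:
  assumes u: "u \<in> unit_cube" and r: "r \<ge> 0"
  shows "nnexp (\<lambda>\<omega>. norm (affine_defect (\<xi> n \<omega>) x r u)) \<le> ennreal ((real CARD('m) * (1 + defect_const)) * r\<^sup>2)"
proof (cases "r = 0")
  case True
  then show ?thesis by (simp add: affine_defect_def)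
next
  case False
  then have r: "r > 0" using r by simp
  have const: "defect_const \<ge> 0" using w by (simp add: defect_const_def)
  have meas [measurable]: "(\<lambda>\<omega>. affine_defect (\<xi> n \<omega>) x r u) \<in> borel_measurable M"
    unfolding affine_defect_def by measurable
  have "nnexp (\<lambda>\<omega>. norm (affine_defect (\<xi> n \<omega>) x r u)) \<le> ennreal (\<Sum>i\<in>(UNIV :: 'm set). (1 + defect_const) * r\<^sup>2)"
  proof (rule nn_integral_sum_le)
    fix i
    have "(\<integral>\<^sup>+\<omega>. ennreal \<bar>affine_defect (\<xi> n \<omega>) x r u $ i\<bar> \<partial>M) \<le> ennreal (r\<^sup>2 + 1 / r\<^sup>2 * (defect_const * r ^ 4))"
    proof (rule nn_integral_affine_le[OF _ prob_space_axioms _ _ _ _ _ component_defect_variance[OF u]])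
      show "\<bar>affine_defect (\<xi> n \<omega>) x r u $ i\<bar> \<le> r\<^sup>2 + 1 / r\<^sup>2 * (affine_defect (\<xi> n \<omega>) x r u $ i)\<^sup>2" for \<omega>
        using power_le_scaled_power[of "r\<^sup>2" "\<bar>affine_defect (\<xi> n \<omega>) x r u $ i\<bar>" 1 2] r by simp
    qed (use r const in auto)
    also have "r\<^sup>2 + 1 / r\<^sup>2 * (defect_const * r ^ 4) = (1 + defect_const) * r\<^sup>2"
      using r by (simp add: field_simps power2_eq_square power4_eq_xxxx)
    finally show "(\<integral>\<^sup>+\<omega>. ennreal \<bar>affine_defect (\<xi> n \<omega>) x r u $ i\<bar> \<partial>M) \<le> ennreal ((1 + defect_const) * r\<^sup>2)" .
  qed (use const norm_le_l1_cart in auto)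
  then show ?thesis by (simp add: mult_ac)
qed

text \<open>By uniform continuity and since there are only countably many cells of values on the centres of one level, two
  independent copies of a component are close on the whole cube with positive probability; their scaled difference
  is again a copy.\<close>

lemma difference_small_ball:
  assumes R: "R > 0" and d: "d > 0"
  shows "0 < prob {\<omega> \<in> space M. \<forall>q\<in>dyadics.
    \<bar>((\<xi> 0 \<omega> (R *\<^sub>R q) $ i - \<xi> 0 \<omega> 0 $ i) - (\<xi> 1 \<omega> (R *\<^sub>R q) $ i - \<xi> 1 \<omega> 0 $ i)) / sqrt 2\<bar> \<le> d}"
    (is "0 < prob ?E")
proof -
  let ?m = "real CARD('m)"
  \<comment> \<open>Equal integer parts put the increments of two functions of one cell within
    \<open>d / 4\<close> of each other at the centres, and each function varies by at most
    \<open>d / 4\<close> around a centre.\<close>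
  define cell where "cell = (\<lambda>(k, c). {f \<in> space fun_sigma. (\<forall>v\<in>centres k. osc (reg f) (R *\<^sub>R v) (R / 2 ^ k) \<le> d / 4)
    \<and> (\<forall>v\<in>centres k. \<lfloor>(f (R *\<^sub>R v) $ i - f 0 $ i) * (4 / d)\<rfloor> = c v)})"
  \<comment> \<open>Extensional functions on a finite set of centres keep the index set
    countable.\<close>
  define T where "T = Sigma UNIV (\<lambda>k. (centres k :: (real ^ 'm) set) \<rightarrow>\<^sub>E (UNIV :: int set))"
  have T: "countable T" unfolding T_def by (intro countable_SIGMA countable_PiE) auto
  have comp [measurable]: "(\<lambda>f. f z) \<in> measurable fun_sigma borel" for z :: "real ^ 'm"
    by (rule measurable_component_singleton) simp
  have cell [measurable]: "cell p \<in> sets fun_sigma" for p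
  proof -
    obtain k c where p: "p = (k, c)" by (cases p)
    have [measurable]: "countable (centres k)" by (intro countable_finite) simp
    show ?thesis unfolding p cell_def case_prod_conv by measurable
  qed
  have cover: "\<exists>p\<in>T. \<xi> 0 \<omega> \<in> cell p" if \<omega>: "\<omega> \<in> space M" for \<omega>
  proof -
    let ?f = "\<xi> 0 \<omega>" and ?K = "cball (0 :: real ^ 'm) (2 * ?m * R)"
    have "uniformly_continuous_on ?K ?f"
      by (intro compact_uniformly_continuous continuous_on_subset[OF cont_maps[OF \<omega>]]) auto
    then obtain e where e: "e > 0" "\<And>y z. y \<in> ?K \<Longrightarrow> z \<in> ?K \<Longrightarrow> dist y z < e \<Longrightarrow> dist (?f y) (?f z) < d / 4"
      unfolding uniformly_continuous_on_def using d by (metis divide_pos_pos zero_less_numeral)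
    obtain k where k: "?m * R / e < 2 ^ k" using real_arch_pow[of 2] by auto
    have "osc (reg ?f) (R *\<^sub>R v) (R / 2 ^ k) \<le> d / 4" if v: "v \<in> centres k" for v
      unfolding reg_continuous[OF cont_maps[OF \<omega>]]
    proof (rule osc_le)
      fix u :: "real ^ 'm" assume u: "u \<in> unit_cube"
      have nv: "norm (R *\<^sub>R v) \<le> ?m * R" using norm_unit_cube[of v] v centres_subset_cube[of k] R by (auto simp: mult.commute)
      have nu: "norm ((R / 2 ^ k) *\<^sub>R u) \<le> ?m * R / 2 ^ k"
        using norm_unit_cube[OF u] R by (simp add: divide_right_mono mult.commute)
      also have "\<dots> \<le> ?m * R" using R mult_left_mono[of 1 "2 ^ k" "?m * R"] by (simp add: divide_le_eq)
      finally have nu': "norm ((R / 2 ^ k) *\<^sub>R u) \<le> ?m * R" .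
      have "?m * R / 2 ^ k < e" using k e(1) by (simp add: field_simps)
      then have "dist (?f (R *\<^sub>R v + (R / 2 ^ k) *\<^sub>R u)) (?f (R *\<^sub>R v)) < d / 4"
      proof (intro e(2))
        have "norm (R *\<^sub>R v + (R / 2 ^ k) *\<^sub>R u) \<le> 2 * ?m * R"
          using nv nu' norm_triangle_ineq[of "R *\<^sub>R v" "(R / 2 ^ k) *\<^sub>R u"] by linarith
        then show "R *\<^sub>R v + (R / 2 ^ k) *\<^sub>R u \<in> ?K" by (simp only: mem_cball_0)
        have "norm (R *\<^sub>R v) \<le> 2 * ?m * R" using nv order_trans[OF norm_ge_zero nv] by linarith
        then show "R *\<^sub>R v \<in> ?K" by (simp only: mem_cball_0)
        show "dist (R *\<^sub>R v + (R / 2 ^ k) *\<^sub>R u) (R *\<^sub>R v) < e"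
          using nu \<open>?m * R / 2 ^ k < e\<close> by (simp add: dist_norm)
      qed
      then show "norm (?f (R *\<^sub>R v + (R / 2 ^ k) *\<^sub>R u) - ?f (R *\<^sub>R v)) \<le> d / 4" by (simp add: dist_norm)
    qed (use d in simp)
    then have "?f \<in> cell (k, \<lambda>v\<in>centres k. \<lfloor>(?f (R *\<^sub>R v) $ i - ?f 0 $ i) * (4 / d)\<rfloor>)"
      by (auto simp: cell_def space_PiM)
    moreover have "(k, \<lambda>v\<in>centres k. \<lfloor>(?f (R *\<^sub>R v) $ i - ?f 0 $ i) * (4 / d)\<rfloor>) \<in> T" by (auto simp: T_def)
    ultimately show ?thesis by blast
  qed
  define A where "A n p = \<xi> n -` cell p \<inter> space M" for n p
  have A [measurable]: "A n p \<in> events" for n p unfolding A_def by measurable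
  have "\<exists>p. 0 < prob (A 0 p)"
  proof (rule ccontr)
    assume "\<not> (\<exists>p. 0 < prob (A 0 p))"
    then have "\<not> 0 < prob (A 0 p)" for p by blast
    then have "prob (A 0 p) = 0" for p using measure_nonneg[of M "A 0 p"] by (simp add: less_le)
    then have "A 0 p \<in> null_sets M" for p using A by (auto simp: null_sets_def emeasure_eq_measure)
    then have "(\<Union>p\<in>T. A 0 p) \<in> null_sets M" by (intro null_sets_UN' T) auto
    moreover have "(\<Union>p\<in>T. A 0 p) = space M" using cover by (auto simp: A_def)
    ultimately show False using emeasure_space_1 by (auto simp: null_sets_def)
  qed
  then obtain p where p: "0 < prob (A 0 p)" by blast
  have "prob (A 1 p) = measure (distr M fun_sigma (\<xi> 1)) (cell p)" unfolding A_def by (simp add: measure_distr)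
  also have "\<dots> = prob (A 0 p)" unfolding same_law[symmetric] A_def by (simp add: measure_distr)
  finally have p1: "prob (A 1 p) = prob (A 0 p)" .
  have "prob (\<Inter>j\<in>{0, 1}. \<xi> j -` cell p \<inter> space M) = (\<Prod>j\<in>{0, 1}. prob (\<xi> j -` cell p \<inter> space M))"
    by (rule indep_varsD[OF indep_maps]) auto
  then have "prob (A 0 p \<inter> A 1 p) = prob (A 0 p) * prob (A 0 p)" using p1 by (simp add: A_def)
  then have "0 < prob (A 0 p \<inter> A 1 p)" using p by simp
  also have "prob (A 0 p \<inter> A 1 p) \<le> prob ?E"
  proof (rule finite_measure_mono)
    show "A 0 p \<inter> A 1 p \<subseteq> ?E"
    proof (intro subsetI CollectI conjI)
      show "\<omega> \<in> space M" if "\<omega> \<in> A 0 p \<inter> A 1 p" for \<omega> using that by (simp add: A_def)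
    next
      fix \<omega> assume \<omega>A: "\<omega> \<in> A 0 p \<inter> A 1 p"
      then have \<omega>: "\<omega> \<in> space M" by (simp add: A_def)
      show "\<forall>q\<in>dyadics. \<bar>((\<xi> 0 \<omega> (R *\<^sub>R q) $ i - \<xi> 0 \<omega> 0 $ i) - (\<xi> 1 \<omega> (R *\<^sub>R q) $ i - \<xi> 1 \<omega> 0 $ i)) / sqrt 2\<bar> \<le> d"
      proof
      fix q assume q: "q \<in> (dyadics :: (real ^ 'm) set)"
      obtain k c where kc: "p = (k, c)" by (cases p)
      have cells: "\<And>n v. n \<in> {0, 1} \<Longrightarrow> v \<in> centres k \<Longrightarrow> osc (\<xi> n \<omega>) (R *\<^sub>R v) (R / 2 ^ k) \<le> d / 4"
        "\<And>n v. n \<in> {0, 1} \<Longrightarrow> v \<in> centres k \<Longrightarrow> \<lfloor>(\<xi> n \<omega> (R *\<^sub>R v) $ i - \<xi> n \<omega> 0 $ i) * (4 / d)\<rfloor> = c v"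
        using \<omega>A \<omega> by (auto simp: A_def cell_def kc reg_continuous[OF cont_maps])
      obtain v u where vu: "v \<in> centres k" "u \<in> unit_cube" "q = v + (1/2^k) *\<^sub>R u"
        using cube_cover[of q k] q dyadics_subset_cube by blast
      have Rq: "R *\<^sub>R q = R *\<^sub>R v + (R / 2 ^ k) *\<^sub>R u" by (simp add: vu(3) algebra_simps)
      have near: "\<bar>\<xi> n \<omega> (R *\<^sub>R q) $ i - \<xi> n \<omega> (R *\<^sub>R v) $ i\<bar> \<le> d / 4" if "n \<in> {0, 1}" for n
        using component_le_norm_cart[of "\<xi> n \<omega> (R *\<^sub>R q) - \<xi> n \<omega> (R *\<^sub>R v)" i]
          le_osc[OF cont_maps[OF \<omega>] vu(2), of n "R *\<^sub>R v" "R / 2 ^ k"] cells(1)[OF that vu(1)] by (simp add: Rq)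
      let ?a = "\<xi> 0 \<omega> (R *\<^sub>R v) $ i - \<xi> 0 \<omega> 0 $ i" and ?b = "\<xi> 1 \<omega> (R *\<^sub>R v) $ i - \<xi> 1 \<omega> 0 $ i"
      have "\<lfloor>?a * (4 / d)\<rfloor> = \<lfloor>?b * (4 / d)\<rfloor>" using cells(2)[of 0 v] cells(2)[of 1 v] vu(1) by simp
      moreover have "\<bar>s - t\<bar> \<le> d / 4" if "\<lfloor>s * (4 / d)\<rfloor> = \<lfloor>t * (4 / d)\<rfloor>" for s t :: real
      proof -
        have "\<bar>y - z\<bar> \<le> 1" if "\<lfloor>y\<rfloor> = \<lfloor>z\<rfloor>" for y z :: real using that by linarith
        from this[OF that] have "\<bar>(s - t) * (4 / d)\<bar> \<le> 1" by (simp only: left_diff_distrib)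
        then have "\<bar>s - t\<bar> * (4 / d) \<le> 1" using d by (simp only: abs_mult) simp
        then show ?thesis using d by (simp add: field_simps)
      qed
      ultimately have ab: "\<bar>?a - ?b\<bar> \<le> d / 4" by blast
      have "\<bar>(\<xi> 0 \<omega> (R *\<^sub>R q) $ i - \<xi> 0 \<omega> 0 $ i) - (\<xi> 1 \<omega> (R *\<^sub>R q) $ i - \<xi> 1 \<omega> 0 $ i)\<bar> \<le> d"
      proof -
        \<comment> \<open>Three errors of \<open>d / 4\<close>: one between the copies at the
          centre, and one for each copy within its subcube.\<close>
        have "\<bar>(s - t) - (s' - t')\<bar> \<le> d"
          if "\<bar>(y - t) - (y' - t')\<bar> \<le> d / 4" "\<bar>s - y\<bar> \<le> d / 4" "\<bar>s' - y'\<bar> \<le> d / 4" for s t s' t' y y' :: real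
          using that d unfolding abs_le_iff by linarith
        from this[OF ab near near] show ?thesis by simp
      qed
      also have "d \<le> d * sqrt 2" using d by simp
      finally show "\<bar>((\<xi> 0 \<omega> (R *\<^sub>R q) $ i - \<xi> 0 \<omega> 0 $ i) - (\<xi> 1 \<omega> (R *\<^sub>R q) $ i - \<xi> 1 \<omega> 0 $ i)) / sqrt 2\<bar> \<le> d"
        by (simp add: abs_divide divide_le_eq)
      qed
    qed
  qed (measurable)
  finally show ?thesis .
qed

text \<open>Variances of linear combinations of increments depend neither on \<open>n\<close> nor on
  \<open>i\<close> or \<open>x\<close>, and the scaled difference of two copies shares them, so the
  one-dimensional images agree and Cramer-Wold applies. This makes the small ball bound uniform in
  the position.\<close>

lemma component_increments_law:
  fixes J :: "(real ^ 'm) set"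
  assumes J: "finite J"
  shows "prob {\<omega> \<in> space M. \<forall>q\<in>J. \<bar>\<xi> n \<omega> (x + R *\<^sub>R q) $ i - \<xi> n \<omega> x $ i\<bar> \<le> d} =
    prob {\<omega> \<in> space M. \<forall>q\<in>J. \<bar>((\<xi> 0 \<omega> (R *\<^sub>R q) $ j - \<xi> 0 \<omega> 0 $ j) - (\<xi> 1 \<omega> (R *\<^sub>R q) $ j - \<xi> 1 \<omega> 0 $ j)) / sqrt 2\<bar> \<le> d}"
proof -
  define S where "S n i x a \<omega> = (\<Sum>q\<in>J. a q * (\<xi> n \<omega> (x + R *\<^sub>R q) $ i - \<xi> n \<omega> x $ i))" for n i x and a :: "real ^ 'm \<Rightarrow> real" and \<omega>
  have law: "centred_gaussian (distr M borel (S n i x a))" "distr M borel (S n i x a) = distr M borel (S n' i' x' a)" for n i x n' i' x' a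
  proof -
    have inc: "centred_gaussian (distr M borel (S n i x a))" for n i x
      unfolding S_def using centred_gaussian_process_increments(1)[OF gp[of n i] J, of a "\<lambda>q. x + R *\<^sub>R q" x] .
    have var: "(\<integral>y. y\<^sup>2 \<partial>distr M borel (S n i x a)) = (\<Sum>k\<in>J. \<Sum>l\<in>J. a k * a l *
        (sq_exp \<sigma> w (norm (R *\<^sub>R k - R *\<^sub>R l)) - sq_exp \<sigma> w (norm (R *\<^sub>R k)) - sq_exp \<sigma> w (norm (R *\<^sub>R l)) + sq_exp \<sigma> w 0))" for n i x
      unfolding S_def using centred_gaussian_process_increments(2)[OF gp[of n i] J, of a "\<lambda>q. x + R *\<^sub>R q" x] by simp
    show "centred_gaussian (distr M borel (S n i x a))" by (rule inc)
    show "distr M borel (S n i x a) = distr M borel (S n' i' x' a)"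
      by (rule centred_gaussian_unique[OF inc inc]) (simp only: var)
  qed
  have indep2: "indep_var borel (S 0 j 0 a) borel (S 1 j 0 a)" for a
  proof -
    define g where "g n F = (\<Sum>q\<in>J. a q * (F n (0 + R *\<^sub>R q) $ j - F n 0 $ j))" for n :: nat and F :: "nat \<Rightarrow> real ^ 'm \<Rightarrow> real ^ 'm"
    have g: "g n \<in> measurable (PiM {n} (\<lambda>_. fun_sigma)) borel" for n
    proof -
      have [measurable]: "(\<lambda>F. F n z) \<in> measurable (PiM {n} (\<lambda>_. fun_sigma)) borel" for z :: "real ^ 'm"
        using measurable_compose[OF measurable_component_singleton[of n "{n}" "\<lambda>_. fun_sigma"] measurable_component_singleton[of z UNIV "\<lambda>_. borel"]] by simp
      show ?thesis unfolding g_def by measurable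
    qed
    have "indep_var (PiM {0} (\<lambda>_. fun_sigma)) (\<lambda>\<omega>. restrict (\<lambda>n. \<xi> n \<omega>) {0}) (PiM {1} (\<lambda>_. fun_sigma)) (\<lambda>\<omega>. restrict (\<lambda>n. \<xi> n \<omega>) {1})"
      by (rule indep_var_restrict[OF indep_maps]) auto
    from indep_var_compose[OF this g g] show ?thesis by (simp add: comp_def g_def S_def[abs_def])
  qed
  let ?Y = "\<lambda>q \<omega>. ((\<xi> 0 \<omega> (R *\<^sub>R q) $ j - \<xi> 0 \<omega> 0 $ j) - (\<xi> 1 \<omega> (R *\<^sub>R q) $ j - \<xi> 1 \<omega> 0 $ j)) / sqrt 2"
  have "prob {\<omega> \<in> space M. \<forall>q\<in>J. \<xi> n \<omega> (x + R *\<^sub>R q) $ i - \<xi> n \<omega> x $ i \<in> {- d..d}} =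
    prob {\<omega> \<in> space M. \<forall>q\<in>J. ?Y q \<omega> \<in> {- d..d}}"
  proof (rule cramer_wold[OF J])
    fix a
    have "distr M borel (\<lambda>\<omega>. \<Sum>q\<in>J. a q * (\<xi> n \<omega> (x + R *\<^sub>R q) $ i - \<xi> n \<omega> x $ i)) = distr M borel (S 0 j 0 a)"
      using law(2)[of n i x a 0 j 0] by (simp add: S_def[abs_def])
    also have "\<dots> = distr M borel (\<lambda>\<omega>. (S 0 j 0 a \<omega> - S 1 j 0 a \<omega>) / sqrt 2)"
      by (rule centred_gaussian_diff[OF indep2 refl law(2) law(1), symmetric])
    also have "(\<lambda>\<omega>. (S 0 j 0 a \<omega> - S 1 j 0 a \<omega>) / sqrt 2) = (\<lambda>\<omega>. \<Sum>q\<in>J. a q * ?Y q \<omega>)"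
      by (auto simp: S_def sum_subtractf right_diff_distrib diff_divide_distrib sum_divide_distrib)
    finally show "distr M borel (\<lambda>\<omega>. \<Sum>q\<in>J. a q * (\<xi> n \<omega> (x + R *\<^sub>R q) $ i - \<xi> n \<omega> x $ i)) = distr M borel (\<lambda>\<omega>. \<Sum>q\<in>J. a q * ?Y q \<omega>)" .
  qed auto
  moreover have "y \<in> {- d..d} \<longleftrightarrow> \<bar>y\<bar> \<le> d" for y :: real by auto
  ultimately show ?thesis by (simp only:)
qed

text \<open>Laws are compared on finite sets of points; finite sets exhaust the dyadic points, and
  the corresponding events decrease.\<close>

lemma component_small_ball:
  assumes R: "R > 0" and d: "d > 0"
  shows "\<exists>g>0. \<forall>n i x. g \<le> prob {\<omega> \<in> space M. \<forall>q\<in>dyadics. \<bar>\<xi> n \<omega> (x + R *\<^sub>R q) $ i - \<xi> n \<omega> x $ i\<bar> \<le> d}"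
proof -
  define j :: 'm where "j = undefined"
  define Y where "Y q \<omega> = ((\<xi> 0 \<omega> (R *\<^sub>R q) $ j - \<xi> 0 \<omega> 0 $ j) - (\<xi> 1 \<omega> (R *\<^sub>R q) $ j - \<xi> 1 \<omega> 0 $ j)) / sqrt 2" for q \<omega>
  define g where "g = prob {\<omega> \<in> space M. \<forall>q\<in>dyadics. \<bar>Y q \<omega>\<bar> \<le> d}"
  have "g > 0" unfolding g_def Y_def by (rule difference_small_ball[OF R d])
  moreover have "g \<le> prob {\<omega> \<in> space M. \<forall>q\<in>dyadics. \<bar>\<xi> n \<omega> (x + R *\<^sub>R q) $ i - \<xi> n \<omega> x $ i\<bar> \<le> d}" for n i x
  proof -
    \<comment> \<open>Unions over levels, because the centres of successive levels are not
      nested.\<close>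
    define V where "V k = (\<Union>l\<le>k. centres l :: (real ^ 'm) set)" for k
    have V: "finite (V k)" "V k \<subseteq> dyadics" for k by (auto simp: V_def dyadics_def)
    define A where "A k = {\<omega> \<in> space M. \<forall>q\<in>V k. \<bar>\<xi> n \<omega> (x + R *\<^sub>R q) $ i - \<xi> n \<omega> x $ i\<bar> \<le> d}" for k
    have A: "A k \<in> events" for k
    proof -
      have [measurable]: "countable (V k)" using V(1) by (rule countable_finite)
      show ?thesis unfolding A_def by measurable
    qed
    have "g \<le> prob (A k)" for k
    proof -
      have "{\<omega> \<in> space M. \<forall>q\<in>V k. \<bar>Y q \<omega>\<bar> \<le> d} \<in> events"
      proof -
        have [measurable]: "countable (V k)" using V(1) by (rule countable_finite)
        show ?thesis unfolding Y_def by measurable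
      qed
      then have "g \<le> prob {\<omega> \<in> space M. \<forall>q\<in>V k. \<bar>Y q \<omega>\<bar> \<le> d}"
        unfolding g_def using V(2)[of k] by (intro finite_measure_mono) auto
      also have "\<dots> = prob (A k)"
        unfolding A_def Y_def by (rule component_increments_law[OF V(1), symmetric])
      finally show ?thesis .
    qed
    moreover have "(\<lambda>k. prob (A k)) \<longlonglongrightarrow> prob (\<Inter>k. A k)"
    proof (rule finite_Lim_measure_decseq)
      show "decseq A" by (intro decseq_SucI) (auto simp: A_def V_def)
    qed (use A in auto)
    ultimately have "g \<le> prob (\<Inter>k. A k)" by (intro LIMSEQ_le_const) auto
    also have "(\<Inter>k. A k) = {\<omega> \<in> space M. \<forall>q\<in>dyadics. \<bar>\<xi> n \<omega> (x + R *\<^sub>R q) $ i - \<xi> n \<omega> x $ i\<bar> \<le> d}"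
      by (auto simp: A_def V_def dyadics_def)
    finally show ?thesis .
  qed
  ultimately show ?thesis by blast
qed

text \<open>Independence of the components multiplies their bounds, giving \<open>g^m\<close>; the
  level is divided by \<open>m\<close> because the norm is at most the sum of the absolute
  coordinates.\<close>

lemma map_small_ball:
  assumes R: "R > 0" and d: "d > 0"
  shows "\<exists>g>0. \<forall>n x. g \<le> prob {\<omega> \<in> space M. osc (\<xi> n \<omega>) x R \<le> d}"
proof -
  let ?d = "d / real CARD('m)"
  have "?d > 0" using d by simp
  then obtain g where g: "g > 0"
    "\<And>n i x. g \<le> prob {\<omega> \<in> space M. \<forall>q\<in>dyadics. \<bar>\<xi> n \<omega> (x + R *\<^sub>R q) $ i - \<xi> n \<omega> x $ i\<bar> \<le> ?d}"
    using component_small_ball[OF R] by blast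
  have "g ^ CARD('m) \<le> prob {\<omega> \<in> space M. osc (\<xi> n \<omega>) x R \<le> d}" for n x
  proof -
    define B where "B = {h \<in> space (PiM UNIV (\<lambda>_ :: real ^ 'm. borel :: real measure)). \<forall>q\<in>dyadics. \<bar>h (x + R *\<^sub>R q) - h x\<bar> \<le> ?d}"
    have [measurable]: "(\<lambda>h. h z) \<in> measurable (PiM UNIV (\<lambda>_ :: real ^ 'm. borel :: real measure)) borel" for z
      by (rule measurable_component_singleton) simp
    have B: "B \<in> sets (PiM UNIV (\<lambda>_. borel))" unfolding B_def by measurable
    have eq: "(\<lambda>\<omega> z. \<xi> n \<omega> z $ i) -` B \<inter> space M = {\<omega> \<in> space M. \<forall>q\<in>dyadics. \<bar>\<xi> n \<omega> (x + R *\<^sub>R q) $ i - \<xi> n \<omega> x $ i\<bar> \<le> ?d}" for i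
      by (auto simp: B_def space_PiM)
    have "g ^ CARD('m) = (\<Prod>i\<in>(UNIV :: 'm set). g)" by simp
    also have "\<dots> \<le> (\<Prod>i\<in>UNIV. prob ((\<lambda>\<omega> z. \<xi> n \<omega> z $ i) -` B \<inter> space M))"
      using g by (intro prod_mono) (auto simp: eq)
    also have "\<dots> = prob (\<Inter>i\<in>UNIV. (\<lambda>\<omega> z. \<xi> n \<omega> z $ i) -` B \<inter> space M)"
      by (rule indep_varsD_finite[OF indep_components, symmetric]) (use B in auto)
    also have "\<dots> \<le> prob {\<omega> \<in> space M. osc (\<xi> n \<omega>) x R \<le> d}"
    proof (rule finite_measure_mono)
      show "(\<Inter>i\<in>UNIV. (\<lambda>\<omega> z. \<xi> n \<omega> z $ i) -` B \<inter> space M) \<subseteq> {\<omega> \<in> space M. osc (\<xi> n \<omega>) x R \<le> d}"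
        unfolding eq
      proof (intro subsetI CollectI conjI)
        fix \<omega> assume \<omega>: "\<omega> \<in> (\<Inter>i. {\<omega> \<in> space M. \<forall>q\<in>dyadics. \<bar>\<xi> n \<omega> (x + R *\<^sub>R q) $ i - \<xi> n \<omega> x $ i\<bar> \<le> ?d})"
        then show "\<omega> \<in> space M" by auto
        show "osc (\<xi> n \<omega>) x R \<le> d"
          unfolding osc_def
        proof (rule cube_sup_le)
          fix q :: "real ^ 'm" assume q: "q \<in> dyadics"
          have "norm (\<xi> n \<omega> (x + R *\<^sub>R q) - \<xi> n \<omega> x) \<le> (\<Sum>i\<in>UNIV. \<bar>(\<xi> n \<omega> (x + R *\<^sub>R q) - \<xi> n \<omega> x) $ i\<bar>)"
            by (rule norm_le_l1_cart)
          also have "\<dots> \<le> (\<Sum>i\<in>(UNIV :: 'm set). ?d)" using \<omega> q by (intro sum_mono) auto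
          finally show "norm (\<xi> n \<omega> (x + R *\<^sub>R q) - \<xi> n \<omega> x) \<le> d" by simp
        qed (use d in simp)
      qed
      have "(\<lambda>\<omega>. osc (reg (\<xi> n \<omega>)) x R) \<in> borel_measurable M" by measurable
      then have [measurable]: "(\<lambda>\<omega>. osc (\<xi> n \<omega>) x R) \<in> borel_measurable M"
        by (rule measurable_cong[THEN iffD1, rotated]) (simp add: reg_continuous[OF cont_maps])
      show "{\<omega> \<in> space M. osc (\<xi> n \<omega>) x R \<le> d} \<in> events" by measurable
    qed
    finally show ?thesis .
  qed
  then show ?thesis using g(1) by (intro exI[of _ "g ^ CARD('m)"]) auto
qed

sublocale random_maps M \<xi>
  "real CARD('m) ^ CARD('m) * (real CARD('m) * gauss_const CARD('m) * (\<sigma>\<^sup>2 / w\<^sup>2) ^ CARD('m))"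
  "real CARD('m) * \<sigma>\<^sup>2 / w\<^sup>2" "1 + 2 * real CARD('m) * \<sigma>\<^sup>2" "real CARD('m) * (1 + defect_const)"
proof
  \<comment> \<open>\<kappa> < 1 is the assumption relating \<sigma> and \<open>w\<close>, the
    factor \<open>m\<close> coming from the sum over components.\<close>
  show "real CARD('m) * \<sigma>\<^sup>2 / w\<^sup>2 < 1" using subcritical w by (simp add: field_simps)
  show "0 \<le> real CARD('m) * (1 + defect_const)" by (simp add: defect_const_def)
qed (rule indep_maps | rule cont_maps, assumption | rule map_moment | rule map_contraction | rule map_bounded_increment
  | rule map_affine_defect, assumption, assumption | rule map_small_ball, assumption, assumption | simp)+

end

section \<open>Transfer to the deep Gaussian process\<close>

lemma (in prob_space) indep_vars_Suc:
  assumes "indep_vars (\<lambda>_. N) X {1..}"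
  shows "indep_vars (\<lambda>_. N) (\<lambda>k. X (Suc k)) UNIV"
proof -
  define F where "F i = sigma_sets (space M) {X i -` A \<inter> space M |A. A \<in> sets N}" for i
  have X: "\<And>i. i \<ge> 1 \<Longrightarrow> random_variable N (X i)" using assms by (auto simp: indep_vars_def)
  have F: "indep_sets F {1..}" using assms unfolding indep_vars_def F_def[abs_def] by blast
  have "indep_sets (\<lambda>k. F (Suc k)) UNIV"
  proof (rule indep_setsI)
    show "F (Suc k) \<subseteq> events" for k using F by (auto simp: indep_sets_def)
    fix A and J :: "nat set" assume J: "J \<noteq> {}" "finite J" and A: "\<forall>j\<in>J. A j \<in> F (Suc j)"
    have "prob (\<Inter>i\<in>Suc ` J. A (i - 1)) = (\<Prod>i\<in>Suc ` J. prob (A (i - 1)))"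
      by (rule indep_setsD[OF F]) (use J A in auto)
    then show "prob (\<Inter>j\<in>J. A j) = (\<Prod>j\<in>J. prob (A j))" by (simp add: prod.reindex)
  qed
  then show ?thesis using X unfolding indep_vars_def F_def[abs_def] by auto
qed

lemma deep_gp_eq_flow:
  assumes "\<And>k. continuous_on UNIV (\<xi> (Suc k) \<omega>)"
  shows "deep_gp u0 \<xi> n \<omega> x = flow (\<lambda>k. \<xi> (Suc k) \<omega>) 0 n (u0 \<omega> x)"
  by (induction n) (simp_all add: reg_continuous[OF assms])

theorem theorem4:
  fixes M :: "'w measure"
    and D :: "(real ^ 'd) set"
    and \<sigma> w :: real
    and u0 :: "'w \<Rightarrow> real ^ 'd \<Rightarrow> real ^ 'm"
    and \<xi> :: "nat \<Rightarrow> 'w \<Rightarrow> real ^ 'm \<Rightarrow> real ^ 'm"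
  assumes "prob_space M"
    and "\<sigma>\<^sup>2 > 0" and "w\<^sup>2 > 0"
    and u0_measurable: "(\<lambda>\<omega>. restrict (u0 \<omega>) D) \<in> measurable M (PiM D (\<lambda>_. borel))"
    and u0_bounded: "AE \<omega> in M. \<forall>B. B \<subseteq> D \<and> bounded B \<longrightarrow> bounded (u0 \<omega> ` B)"
    and \<xi>_iid: "iid_vars M (PiM UNIV (\<lambda>_. borel)) \<xi> {1..}"
    and \<xi>_indep_u0: "indep_rvs M
          (PiM D (\<lambda>_. borel)) (\<lambda>\<omega>. restrict (u0 \<omega>) D)
          (PiM {1..} (\<lambda>_. PiM UNIV (\<lambda>_. borel))) (\<lambda>\<omega>. \<lambda>n\<in>{1..}. \<xi> n \<omega>)"
    and \<xi>_continuous: "\<And>n \<omega>. n \<ge> 1 \<Longrightarrow> \<omega> \<in> space M \<Longrightarrow> continuous_on UNIV (\<xi> n \<omega>)"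
    and \<xi>_components_iid: "\<And>n. n \<ge> 1 \<Longrightarrow>
          iid_vars M (PiM UNIV (\<lambda>_. borel)) (\<lambda>i \<omega> z. \<xi> n \<omega> z $ i) UNIV"
    and \<xi>_gaussian: "\<And>n i. n \<ge> 1 \<Longrightarrow>
          centred_gaussian_process M (\<lambda>z z'. sq_exp \<sigma> w (norm (z - z'))) (\<lambda>\<omega> z. \<xi> n \<omega> z $ i)"
    and "\<sigma>\<^sup>2 < w\<^sup>2 / real CARD('m)"
  shows "AE \<omega> in M. \<forall>x\<in>D. \<forall>x'\<in>D.
           (\<lambda>n. norm (deep_gp u0 \<xi> n \<omega> x - deep_gp u0 \<xi> n \<omega> x')) \<longlonglongrightarrow> 0"
proof -
  interpret prob_space M by fact
  interpret gaussian_maps M "\<lambda>k. \<xi> (Suc k)" \<sigma> w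
  proof
    show "indep_vars (\<lambda>_. fun_sigma) (\<lambda>k. \<xi> (Suc k)) UNIV"
      using \<xi>_iid by (intro indep_vars_Suc) (simp add: iid_vars_def)
    show "distr M fun_sigma (\<xi> (Suc 0)) = distr M fun_sigma (\<xi> (Suc 1))"
      using \<xi>_iid by (auto simp: iid_vars_def)
  qed (use assms in \<open>auto simp: iid_vars_def\<close>)
  \<comment> \<open>The null set of \<open>synchronisation\<close> is common to all starting points,
    so \<open>u0 \<omega> x\<close> and \<open>u0 \<omega> x'\<close> can be inserted path by
    path.\<close>
  show ?thesis
    using synchronisation by (rule AE_mp) (auto intro!: AE_I2 simp: deep_gp_eq_flow[OF \<xi>_continuous])
qed

end
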